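(* Let $q>2$ be a prime and $k\ge0$ an integer. The automorphism group $G:=\operatorname{Aut}(\operatorname{M}(2,q,2kq))$ is isomorphic to $\mathbb Z_{2q(k+2)}$ (generated by the vertex shift $v\mapsto v+1 \bmod 2q(k+2)$), and, with respect to a suitable basis of the first homology group $H_1(\operatorname{M}(2,q,2kq),\mathbb Z)=\mathbb Z^{q-1}$, it acts on $H_1(\operatorname{M}(2,q,2kq),\mathbb Z)$ by $$\rho:\ G\to\operatorname{SL}(q-1,\mathbb Z);\qquad g\mapsto\begin{pmatrix}0&\cdots&\cdots&0&-1\\1&0&\cdots&0&1\\0&\ddots&\ddots&\vdots&\vdots\\\vdots&\ddots&\ddots&0&-1\\0&\cdots&0&1&1\end{pmatrix}^{g}$$ (where $g\in\mathbb Z_{2q(k+2)}$ stands for the automorphism $v\mapsto v+g$, and the matrix is the $(q-1)\times(q-1)$ matrix with ones on the subdiagonal, last column $(-1,1,-1,1,\ldots,-1,1)^T$ and all other entries zero). Moreover $|\rho(G)|=2q$.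
   Context: For positive integers $a_0,\ldots,a_d$ with $n=\sum a_i$, the difference cycle $(a_0:\ldots:a_d)$ is the collection of $d$-simplices $\{x,x+a_0,x+a_0+a_1,\ldots,x+a_0+\cdots+a_{d-1}\}$, $x\in\mathbb Z_n$, on the vertex set $\mathbb Z_n$. A set of difference cycles stands for the simplicial complex whose facets are all simplices in their union. $\operatorname{Aut}(M)$ is the group of all permutations of the vertices of $M$ that map $M$ to itself. Definition of $\operatorname{M}(p,q,r)$ for co-prime $2\le p<q$, $r\ge0$, on vertex set $\mathbb Z_{2pq+r}$ (here used with $p=2$ and $r=2kq$, where $k$ is the parameter of the theorem): let $m\in\{1,\ldots,q-1\}$ and $k'\in\{1,\ldots,p-1\}$ be the integers with $mp-k'q=1$. Put $$\operatorname{B}(p,q,r)=\{(1:k'q:(q-m)p:pq+r),\ (1:k'q:pq+r:(q-m)p),\ (1:pq+r:k'q:(q-m)p)\}.$$ Subtractive Euclidean algorithm: from positive integers $x,y$ with greatest common divisor $g$ put $a_0=\max\{x,y\}$, $b_0=\min\{x,y\}$ and, as long as $a_i\ne b_i$, $(a_{i+1},b_{i+1})=(a_i-b_i,b_i)$ if $a_i>b_i$ and $(a_{i+1},b_{i+1})=(b_i-a_i,a_i)$ if $a_i<b_i$; let $N(x,y)\ge0$ be the number of steps until $a_N=b_N=g$. With $(a_i,b_i)$ the sequence for $x=(p-k')q$, $y=k'q$, and $(c_i,d_i)$ the sequence for $x=(q-m)p$, $y=mp$, put $$\operatorname{F}_1(p,q,r)=\{(b_i:a_i:b_i:2pq-2b_i-a_i+r)\mid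 1\le i\le N((p-k')q,k'q)\},$$ $$\operatorname{F}_2(p,q,r)=\{(d_i:c_i:d_i:2pq-2d_i-c_i+r)\mid 1\le i\le N((q-m)p,mp)\},$$ $$\operatorname{F}_3(p,q,r)=\{(1:pq-1+i:1:pq-1+r-i)\mid 0\le i\le\lfloor r/2\rfloor\},$$ and $\operatorname{M}(p,q,r)=\operatorname{B}\cup\operatorname{F}_1\cup\operatorname{F}_2\cup\operatorname{F}_3$. *)

theory Defs
  imports
    "HOL-Algebra.Bij"
    "HOL-Algebra.Elementary_Groups"
    "HOL-Algebra.Free_Abelian_Groups"
    "HOL-Computational_Algebra.Primes"
    "Jordan_Normal_Form.Determinant"
begin

section \<open>Abstract simplicial complexes and their automorphisms\<close>

text \<open>
  An abstract simplicial complex is given by the set of its nonempty simplices;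
  \<^term>\<open>\<Union>K\<close> is the vertex set of \<open>K\<close>.
\<close>

definition complex_of_facets :: "'a set set \<Rightarrow> 'a set set" where
  "complex_of_facets F = {\<sigma>. \<sigma> \<noteq> {} \<and> (\<exists>\<tau>\<in>F. \<sigma> \<subseteq> \<tau>)}"

definition Aut_complex :: "'a set set \<Rightarrow> ('a \<Rightarrow> 'a) monoid" where
  "Aut_complex K = (BijGroup (\<Union>K)) \<lparr>carrier := {f \<in> Bij (\<Union>K). (`) f ` K = K}\<rparr>"


section \<open>Integral simplicial homology\<close>

text \<open>
  Every simplex is oriented by the linear order of its vertices, so that the \<open>p\<close>-chains are the
  free abelian group on the \<open>p\<close>-simplices.
\<close>

definition simp_chain_group :: "nat \<Rightarrow> 'a set set \<Rightarrow> ('a set \<Rightarrow>\<^sub>0 int) monoid" where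
  "simp_chain_group p K = free_Abelian_group {\<sigma> \<in> K. card \<sigma> = Suc p}"

text \<open>
  If \<open>v\<close> is the \<open>i\<close>-th vertex of \<open>\<sigma>\<close> (counted from \<open>0\<close> in increasing order), then exactly \<open>i\<close>
  vertices of \<open>\<sigma>\<close> are smaller than \<open>v\<close>.
\<close>

definition simp_boundary :: "nat \<Rightarrow> ('a::linorder set \<Rightarrow>\<^sub>0 int) \<Rightarrow> ('a set \<Rightarrow>\<^sub>0 int)" where
  "simp_boundary p c =
     (if p = 0 then 0
      else frag_extend
             (\<lambda>\<sigma>. \<Sum>v\<in>\<sigma>. frag_cmul ((-1) ^ card {u \<in> \<sigma>. u < v}) (frag_of (\<sigma> - {v}))) c)"

definition simp_cycles :: "nat \<Rightarrow> 'a::linorder set set \<Rightarrow> ('a set \<Rightarrow>\<^sub>0 int) set" where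
  "simp_cycles p K = {c \<in> carrier (simp_chain_group p K). simp_boundary p c = 0}"

definition simp_boundaries :: "nat \<Rightarrow> 'a::linorder set set \<Rightarrow> ('a set \<Rightarrow>\<^sub>0 int) set" where
  "simp_boundaries p K = simp_boundary (Suc p) ` carrier (simp_chain_group (Suc p) K)"

definition simp_homology_group ::
    "nat \<Rightarrow> 'a::linorder set set \<Rightarrow> ('a set \<Rightarrow>\<^sub>0 int) set monoid" where
  "simp_homology_group p K =
     subgroup_generated (simp_chain_group p K) (simp_cycles p K) Mod simp_boundaries p K"

text \<open>
  A vertex map sends the oriented simplex \<open>[v\<^sub>0, \<dots>, v\<^sub>p]\<close> to \<open>[f v\<^sub>0, \<dots>, f v\<^sub>p]\<close>, which is \<open>0\<close> if
  two vertices coincide. The number of inversions of \<open>f\<close> on \<open>\<sigma>\<close> gives the sign of the permutation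
  that puts \<open>f v\<^sub>0, \<dots>, f v\<^sub>p\<close> into increasing order.
\<close>

definition simp_chain_map ::
    "('a::linorder \<Rightarrow> 'b::linorder) \<Rightarrow> ('a set \<Rightarrow>\<^sub>0 int) \<Rightarrow> ('b set \<Rightarrow>\<^sub>0 int)" where
  "simp_chain_map f =
     frag_extend
       (\<lambda>\<sigma>. if inj_on f \<sigma>
            then frag_cmul ((-1) ^ card {(u, v). u \<in> \<sigma> \<and> v \<in> \<sigma> \<and> u < v \<and> f v < f u})
                   (frag_of (f ` \<sigma>))
            else 0)"

text \<open>
  The class \<open>X = B\<^sub>p(K) + c\<close> is mapped to \<open>B\<^sub>p(L) + f\<^sub>#(c)\<close>; this coset is written without the choice
  of a representative as the sum of the sets \<open>B\<^sub>p(L)\<close> and \<open>f\<^sub>#(X)\<close>.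
\<close>

definition simp_hom_induced ::
    "nat \<Rightarrow> 'b::linorder set set \<Rightarrow> ('a::linorder \<Rightarrow> 'b)
      \<Rightarrow> ('a set \<Rightarrow>\<^sub>0 int) set \<Rightarrow> ('b set \<Rightarrow>\<^sub>0 int) set" where
  "simp_hom_induced p L f X =
     simp_boundaries p L <#>\<^bsub>simp_chain_group p L\<^esub> (simp_chain_map f ` X)"


section \<open>Integral bases and matrices\<close>

definition lin_comb :: "('h, 'm) monoid_scheme \<Rightarrow> (nat \<Rightarrow> 'h) \<Rightarrow> int vec \<Rightarrow> 'h" where
  "lin_comb H e x = (\<Otimes>\<^bsub>H\<^esub>i\<in>{..<dim_vec x}. e i [^]\<^bsub>H\<^esub> (x $ i))"

definition is_int_basis :: "('h, 'm) monoid_scheme \<Rightarrow> nat \<Rightarrow> (nat \<Rightarrow> 'h) \<Rightarrow> bool" where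
  "is_int_basis H d e \<longleftrightarrow>
     e \<in> {..<d} \<rightarrow> carrier H \<and> lin_comb H e \<in> iso (monoid_vec TYPE(int) d) H"

text \<open>Matrices act on columns of coordinates: column \<open>j\<close> holds the coordinates of \<open>\<phi> (e j)\<close>.\<close>

definition represents ::
    "('h, 'm) monoid_scheme \<Rightarrow> nat \<Rightarrow> (nat \<Rightarrow> 'h) \<Rightarrow> int mat \<Rightarrow> ('h \<Rightarrow> 'h) \<Rightarrow> bool" where
  "represents H d e A \<phi> \<longleftrightarrow>
     A \<in> carrier_mat d d \<and>
     (\<forall>x\<in>carrier_vec d. \<phi> (lin_comb H e x) = lin_comb H e (A *\<^sub>v x))"

definition SL_int :: "nat \<Rightarrow> int mat monoid" where
  "SL_int d = \<lparr>carrier = {A \<in> carrier_mat d d. det A = 1}, monoid.mult = (*), one = 1\<^sub>m d\<rparr>"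

text \<open>Indices start at \<open>0\<close>, so the last column is \<open>-1, 1, -1, 1, \<dots>\<close> from the top.\<close>

definition shift_matrix :: "nat \<Rightarrow> int mat" where
  "shift_matrix d =
     mat d d (\<lambda>(i, j). if j = d - 1 then (-1) ^ Suc i else if i = Suc j then 1 else 0)"


section \<open>Difference cycles\<close>

text \<open>The elements of \<open>\<int>\<^sub>n\<close> are represented by \<open>0, \<dots>, n - 1\<close>, as in \<^const>\<open>integer_mod_group\<close>.\<close>

definition difference_cycle :: "int list \<Rightarrow> int set set" where
  "difference_cycle a =
     (let n = sum_list a in
       {(\<lambda>i. (x + sum_list (take i a)) mod n) ` {..<length a} | x. x \<in> {0..<n}})"

definition complex_of_cycles :: "int list set \<Rightarrow> int set set" where
  "complex_of_cycles C = complex_of_facets (\<Union>a\<in>C. difference_cycle a)"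

definition vertex_shift :: "nat \<Rightarrow> int \<Rightarrow> int \<Rightarrow> int" where
  "vertex_shift n g = (\<lambda>v\<in>{0..<int n}. (v + g) mod int n)"


section \<open>The complexes \<open>M(p, q, r)\<close>\<close>

fun euclid_step :: "int \<times> int \<Rightarrow> int \<times> int" where
  "euclid_step (a, b) = (if a > b then (a - b, b) else if a < b then (b - a, a) else (a, b))"

definition euclid_seq :: "int \<Rightarrow> int \<Rightarrow> nat \<Rightarrow> int \<times> int" where
  "euclid_seq x y i = (euclid_step ^^ i) (max x y, min x y)"

definition euclid_length :: "int \<Rightarrow> int \<Rightarrow> nat" where
  "euclid_length x y = (LEAST i. fst (euclid_seq x y i) = snd (euclid_seq x y i))"

text \<open>The pair \<open>(m, k')\<close> with \<open>m p - k' q = 1\<close>.\<close>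

definition bezout_pair :: "int \<Rightarrow> int \<Rightarrow> int \<times> int" where
  "bezout_pair p q =
     (THE (m, k'). m \<in> {1..q - 1} \<and> k' \<in> {1..p - 1} \<and> m * p - k' * q = 1)"

definition B_cycles :: "int \<Rightarrow> int \<Rightarrow> int \<Rightarrow> int list set" where
  "B_cycles p q r =
     (let (m, k') = bezout_pair p q in
       {[1, k' * q, (q - m) * p, p * q + r],
        [1, k' * q, p * q + r, (q - m) * p],
        [1, p * q + r, k' * q, (q - m) * p]})"

definition F_euclid_cycles :: "int \<Rightarrow> int \<Rightarrow> int \<Rightarrow> int \<Rightarrow> int \<Rightarrow> int list set" where
  "F_euclid_cycles p q r x y =
     {[b, a, b, 2 * p * q - 2 * b - a + r] | a b i.
        1 \<le> i \<and> i \<le> euclid_length x y \<and> euclid_seq x y i = (a, b)}"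

definition F1_cycles :: "int \<Rightarrow> int \<Rightarrow> int \<Rightarrow> int list set" where
  "F1_cycles p q r =
     (let (m, k') = bezout_pair p q in F_euclid_cycles p q r ((p - k') * q) (k' * q))"

definition F2_cycles :: "int \<Rightarrow> int \<Rightarrow> int \<Rightarrow> int list set" where
  "F2_cycles p q r =
     (let (m, k') = bezout_pair p q in F_euclid_cycles p q r ((q - m) * p) (m * p))"

definition F3_cycles :: "int \<Rightarrow> int \<Rightarrow> int \<Rightarrow> int list set" where
  "F3_cycles p q r =
     {[1, p * q - 1 + i, 1, p * q - 1 + r - i] | i. 0 \<le> i \<and> i \<le> r div 2}"

definition M_complex :: "int \<Rightarrow> int \<Rightarrow> int \<Rightarrow> int set set" where
  "M_complex p q r =
     complex_of_cycles (B_cycles p q r \<union> F1_cycles p q r \<union> F2_cycles p q r \<union> F3_cycles p q r)"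

end

(*
  Write n = 4q + r with r = 2kq for the number of vertices.

  Automorphisms. Call the number of triangles on an edge its degree. In a triangle with vertices
  a, b, c such that ab has degree 3 and ac has degree 5, necessarily c = a + q and b = a + 2q - 1.
  Such triangles exist at every vertex, so an automorphism f satisfies f(x + q) = f(x) + q and
  f(x + 2q - 1) = f(x) + 2q - 1, hence f(x + 1) = f(x) + 1.

  Homology. Modulo boundaries, the 1-chains form a Z[t]-module, t being the vertex shift. Let e be
  the class of the edge [0, 1] and u that of the triangle [0, 1] + [1, 2] - [0, 2]. The triangles
  express all edges by e and u; the triangles of B and F2 leave the single relation
  (1 - t + t^2 - ... + t^(q-1)) u = 0, and those of F3 the relation
  (1 + t + ... + t^(n-1)) e = 0. Thus H_1 is Z[t] / (1 - t + ... + t^(q-1)), generated by u, and t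
  acts by the companion matrix. Here t^q = -1, so the order of the action is 2q and the determinant
  of the matrix, being a q-th root of (-1)^(q-1), is 1.
*)

theory Submission
  imports Defs
begin

section \<open>The difference cycles for p = 2\<close>

text \<open>No quotient ring or module is formed. Ring elements are coordinate vectors in 1, t, ...,
  t^(q-2), with \<open>W y\<close> standing for t^y. Two linear maps compute H_1: \<open>U\<close>
  turns coordinates into cycles, and the cocycle \<open>\<Psi>\<close> turns chains into
  coordinates. Since \<open>\<Psi>\<close> kills boundaries and \<open>\<Psi> (U v) = v\<close>, the
  proposed basis is independent; since every cycle c is homologous to \<open>U (\<Psi> c)\<close>,
  it generates. Each relation therefore occurs twice: between chains up to boundaries
  (\<open>loop_add\<close>, \<open>usum_relation\<close>) and as an equality of coordinates
  (\<open>loop_coords_add\<close>, \<open>Wsum_relation\<close>). The link between vertices modulo n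
  and exponents modulo 2q is that 2q divides n.

  For the automorphisms, degree 3 alone is ambiguous: the difference 2q - 1 shares its degree with
  its reverse n - (2q - 1), and for q \<ge> 7 the differences 4 and n - 4 compete as well. The
  neighbouring edge of degree 5 removes both ambiguities, and its position also fixes the
  direction.\<close>

lemma bezout_pair_2:
  assumes "odd q" "3 \<le> q"
  shows "bezout_pair 2 q = ((q + 1) div 2, 1)"
  unfolding bezout_pair_def
proof (rule the_equality)
  show "case ((q + 1) div 2, 1) of (m, k') \<Rightarrow>
      m \<in> {1..q - 1} \<and> k' \<in> {1..2 - 1} \<and> m * 2 - k' * q = 1"
    using assms by (auto elim!: oddE)
next
  fix x :: "int \<times> int"
  assume "case x of (m, k') \<Rightarrow> m \<in> {1..q - 1} \<and> k' \<in> {1..2 - 1} \<and> m * 2 - k' * q = 1"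
  then obtain m k' where x: "x = (m, k')" "k' = 1" "m * 2 - k' * q = 1"
    by (cases x) auto
  then show "x = ((q + 1) div 2, 1)" by auto
qed

text \<open>For q = 2h + 1 one has m = h + 1, so F_2 runs the algorithm on 2h and 2h + 2. The first
  step leaves (2, 2h), where the two entries have changed places; afterwards 2 is subtracted
  repeatedly until (2, 2). Hence index 1 is stated apart from the indices
  \<open>Suc j\<close>.\<close>

lemma euclid_seq_consecutive_evens:
  fixes h :: int
  assumes "1 \<le> h"
  shows "euclid_seq (2 * h) (2 * h + 2) 0 = (2 * h + 2, 2 * h)"
    and "euclid_seq (2 * h) (2 * h + 2) 1 = (2, 2 * h)"
    and "1 \<le> j \<Longrightarrow> int j < h \<Longrightarrow>
           euclid_seq (2 * h) (2 * h + 2) (Suc j) = (2 * h - 2 * int j, 2)"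
proof -
  show "euclid_seq (2 * h) (2 * h + 2) 0 = (2 * h + 2, 2 * h)"
    by (simp add: euclid_seq_def)
  show 1: "euclid_seq (2 * h) (2 * h + 2) 1 = (2, 2 * h)"
    by (simp add: euclid_seq_def)
  show "euclid_seq (2 * h) (2 * h + 2) (Suc j) = (2 * h - 2 * int j, 2)"
    if "1 \<le> j" "int j < h" for j
    using that
  proof (induction j rule: dec_induct)
    case base
    then show ?case using 1 by (simp add: euclid_seq_def)
  next
    case (step j)
    then have "euclid_seq (2 * h) (2 * h + 2) (Suc j) = (2 * h - 2 * int j, 2)" by simp
    with step show ?case by (auto simp: euclid_seq_def)
  qed
qed

lemma euclid_length_consecutive_evens:
  fixes h :: int
  assumes "1 \<le> h"
  shows "euclid_length (2 * h) (2 * h + 2) = nat h"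
  unfolding euclid_length_def
proof (rule Least_equality)
  show "fst (euclid_seq (2 * h) (2 * h + 2) (nat h)) = snd (euclid_seq (2 * h) (2 * h + 2) (nat h))"
  proof (cases "h = 1")
    case True
    then show ?thesis using euclid_seq_consecutive_evens(2)[OF assms] by simp
  next
    case False
    then have "nat h = Suc (nat (h - 1))" using assms by simp
    then show ?thesis using euclid_seq_consecutive_evens(3)[OF assms, of "nat (h - 1)"] False assms
      by simp
  qed
next
  fix i
  assume eq: "fst (euclid_seq (2 * h) (2 * h + 2) i) = snd (euclid_seq (2 * h) (2 * h + 2) i)"
  show "nat h \<le> i"
  proof (rule ccontr)
    assume "\<not> nat h \<le> i"
    then have i: "int i < h" by simp
    consider "i = 0" | "i = 1" | j where "i = Suc j" "1 \<le> j"
      by (metis One_nat_def not_less_eq_eq le0 not0_implies_Suc le_antisym)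
    then show False
    proof cases
      case 3
      with i eq euclid_seq_consecutive_evens(3)[OF assms, of j] show ?thesis by simp
    qed (use i eq euclid_seq_consecutive_evens(1,2)[OF assms] in simp_all)
  qed
qed

lemma F_euclid_cycles_consecutive_evens:
  fixes h :: int
  assumes "1 \<le> h"
  shows "F_euclid_cycles p q r (2 * h) (2 * h + 2) =
    {[2 * h, 2, 2 * h, 2 * p * q - 4 * h - 2 + r]} \<union>
    {[2, b, 2, 2 * p * q - 4 - b + r] | b. even b \<and> 2 \<le> b \<and> b \<le> 2 * h - 2}"
    (is "?L = ?R1 \<union> ?R2")
proof (intro equalityI subsetI)
  fix l assume "l \<in> ?L"
  then obtain a b i where l: "l = [b, a, b, 2 * p * q - 2 * b - a + r]"
    and i: "1 \<le> i" "i \<le> nat h" "euclid_seq (2 * h) (2 * h + 2) i = (a, b)"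
    by (auto simp: F_euclid_cycles_def euclid_length_consecutive_evens[OF assms])
  consider "i = 1" | j where "i = Suc j" "1 \<le> j"
    using i(1) by (metis One_nat_def Suc_le_D le_SucE le0 not_less_eq_eq)
  then show "l \<in> ?R1 \<union> ?R2"
  proof cases
    case 1
    with i euclid_seq_consecutive_evens(2)[OF assms] show ?thesis by (auto simp: l)
  next
    case 2
    with i euclid_seq_consecutive_evens(3)[OF assms, of j] show ?thesis by (auto simp: l)
  qed
next
  fix l assume "l \<in> ?R1 \<union> ?R2"
  then show "l \<in> ?L"
  proof
    assume "l \<in> ?R1"
    then show ?thesis unfolding F_euclid_cycles_def euclid_length_consecutive_evens[OF assms]
      using euclid_seq_consecutive_evens(2)[OF assms] assms
      by (intro CollectI exI[of _ 2] exI[of _ "2 * h"] exI[of _ 1]) auto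
  next
    assume "l \<in> ?R2"
    then obtain c where b: "l = [2, 2 * c, 2, 2 * p * q - 4 - 2 * c + r]" "1 \<le> c" "c \<le> h - 1"
      by (auto elim!: evenE)
    have "euclid_seq (2 * h) (2 * h + 2) (Suc (nat (h - c))) = (2 * c, 2)"
      using euclid_seq_consecutive_evens(3)[OF assms, of "nat (h - c)"] b by simp
    with b show ?thesis unfolding F_euclid_cycles_def euclid_length_consecutive_evens[OF assms]
      by (intro CollectI exI[of _ "2 * c"] exI[of _ 2] exI[of _ "Suc (nat (h - c))"]) auto
  qed
qed

text \<open>
  The fourth difference is \<open>4 q + r - a - b - c\<close>. For \<open>p = 2\<close> the set \<open>F\<^sub>1\<close> is empty, and \<open>F\<^sub>2\<close> gives the
  disjuncts containing \<open>2\<close>.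
\<close>

definition facet_diffs :: "int \<Rightarrow> int \<Rightarrow> int \<Rightarrow> int \<Rightarrow> int \<Rightarrow> bool" where
  "facet_diffs q r a b c \<longleftrightarrow>
     a = 1 \<and> b = q \<and> c = q - 1 \<or> a = 1 \<and> b = q \<and> c = 2 * q + r \<or> a = 1 \<and> b = 2 * q + r \<and> c = q \<or>
     a = q - 1 \<and> b = 2 \<and> c = q - 1 \<or> a = 2 \<and> c = 2 \<and> even b \<and> 2 \<le> b \<and> b \<le> q - 3 \<or>
     a = 1 \<and> c = 1 \<and> 2 * q - 1 \<le> b \<and> b \<le> 2 * q - 1 + r div 2"

lemma M_complex_2_cycles:
  assumes "odd q" "3 \<le> q"
  shows "B_cycles 2 q r \<union> F1_cycles 2 q r \<union> F2_cycles 2 q r \<union> F3_cycles 2 q r =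
    {[a, b, c, 4 * q + r - a - b - c] | a b c. facet_diffs q r a b c}"
proof -
  define h where "h = q div 2"
  have q: "q = 2 * h + 1" and h: "1 \<le> h" using assms by (auto simp: h_def elim!: oddE)
  note bz = bezout_pair_2[OF assms]
  have "(q + 1) div 2 = h + 1" by (simp add: q)
  note bz = bz[unfolded this]
  \<comment> \<open>For p = 2 one has k' = 1, so both inputs of the algorithm equal q. It stops
    after 0 steps and the index range is empty.\<close>
  have F1: "F1_cycles 2 q r = {}"
  proof -
    have "euclid_length q q = 0"
      by (simp add: euclid_length_def euclid_seq_def)
    then show ?thesis by (auto simp: F1_cycles_def F_euclid_cycles_def bz)
  qed
  have "(q - (h + 1)) * 2 = 2 * h" "(h + 1) * 2 = 2 * h + 2" by (simp_all add: q)
  then have F2: "F2_cycles 2 q r = {[2 * h, 2, 2 * h, 2 * 2 * q - 4 * h - 2 + r]} \<union>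
      {[2, b, 2, 2 * 2 * q - 4 - b + r] | b. even b \<and> 2 \<le> b \<and> b \<le> 2 * h - 2}"
    unfolding F2_cycles_def bz Let_def prod.case by (simp only: F_euclid_cycles_consecutive_evens[OF h])
  have F3: "F3_cycles 2 q r =
      {[1, b, 1, 4 * q + r - 2 - b] | b. 2 * q - 1 \<le> b \<and> b \<le> 2 * q - 1 + r div 2}"
  proof -
    have "(\<exists>i. l = [1, 2 * q - 1 + i, 1, 2 * q - 1 + r - i] \<and> 0 \<le> i \<and> i \<le> r div 2) \<longleftrightarrow>
        (\<exists>b. l = [1, b, 1, 4 * q + r - 2 - b] \<and> 2 * q - 1 \<le> b \<and> b \<le> 2 * q - 1 + r div 2)" for l
    proof
      assume "\<exists>i. l = [1, 2 * q - 1 + i, 1, 2 * q - 1 + r - i] \<and> 0 \<le> i \<and> i \<le> r div 2"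
      then obtain i where "l = [1, 2 * q - 1 + i, 1, 2 * q - 1 + r - i]" "0 \<le> i" "i \<le> r div 2" by auto
      then show "\<exists>b. l = [1, b, 1, 4 * q + r - 2 - b] \<and> 2 * q - 1 \<le> b \<and> b \<le> 2 * q - 1 + r div 2"
        by (intro exI[of _ "2 * q - 1 + i"]) auto
    next
      assume "\<exists>b. l = [1, b, 1, 4 * q + r - 2 - b] \<and> 2 * q - 1 \<le> b \<and> b \<le> 2 * q - 1 + r div 2"
      then obtain b where "l = [1, b, 1, 4 * q + r - 2 - b]" "2 * q - 1 \<le> b" "b \<le> 2 * q - 1 + r div 2"
        by auto
      then show "\<exists>i. l = [1, 2 * q - 1 + i, 1, 2 * q - 1 + r - i] \<and> 0 \<le> i \<and> i \<le> r div 2"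
        by (intro exI[of _ "b - (2 * q - 1)"]) auto
    qed
    then show ?thesis unfolding F3_cycles_def by (intro Collect_cong)
  qed
  have B: "B_cycles 2 q r =
      {[1, q, q - 1, 2 * q + r], [1, q, 2 * q + r, q - 1], [1, 2 * q + r, q, q - 1]}"
  proof -
    have "(q - (h + 1)) * 2 = q - 1" using q by simp
    then show ?thesis unfolding B_cycles_def bz Let_def prod.case by (simp only: mult_1)
  qed
  have qh: "2 * h = q - 1" by (simp add: q)
  have num: "2 * 2 * q = 4 * q" "q - 1 - 2 = q - 3" by simp_all
  show ?thesis
    unfolding F1 F2 F3 B qh num
  proof (intro equalityI subsetI)
    fix l
    assume "l \<in> {[1, q, q - 1, 2 * q + r], [1, q, 2 * q + r, q - 1], [1, 2 * q + r, q, q - 1]} \<union> {} \<union>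
      ({[q - 1, 2, q - 1, 4 * q - 4 * h - 2 + r]} \<union>
       {[2, b, 2, 4 * q - 4 - b + r] | b. even b \<and> 2 \<le> b \<and> b \<le> q - 3}) \<union>
      {[1, b, 1, 4 * q + r - 2 - b] | b. 2 * q - 1 \<le> b \<and> b \<le> 2 * q - 1 + r div 2}"
    then consider "l = [1, q, q - 1, 2 * q + r]" | "l = [1, q, 2 * q + r, q - 1]" |
      "l = [1, 2 * q + r, q, q - 1]" | "l = [q - 1, 2, q - 1, 4 * q - 4 * h - 2 + r]" |
      b where "l = [2, b, 2, 4 * q - 4 - b + r]" "even b \<and> 2 \<le> b \<and> b \<le> q - 3" |
      b where "l = [1, b, 1, 4 * q + r - 2 - b]" "2 * q - 1 \<le> b \<and> b \<le> 2 * q - 1 + r div 2"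
      by blast
    then obtain a b c where "l = [a, b, c, 4 * q + r - a - b - c]" "facet_diffs q r a b c"
    proof cases
      case 1 then show ?thesis by (intro that[of 1 q "q - 1"]) (simp_all add: facet_diffs_def)
    next
      case 2 then show ?thesis by (intro that[of 1 q "2 * q + r"]) (simp_all add: facet_diffs_def)
    next
      case 3 then show ?thesis by (intro that[of 1 "2 * q + r" q]) (simp_all add: facet_diffs_def)
    next
      case 4 then show ?thesis using qh by (intro that[of "q - 1" 2 "q - 1"]) (simp_all add: facet_diffs_def)
    next
      case (5 b) then show ?thesis by (intro that[of 2 b 2]) (simp_all add: facet_diffs_def)
    next
      case (6 b) then show ?thesis by (intro that[of 1 b 1]) (simp_all add: facet_diffs_def)
    qed
    then show "l \<in> {[a, b, c, 4 * q + r - a - b - c] | a b c. facet_diffs q r a b c}" by blast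
  next
    fix l
    assume "l \<in> {[a, b, c, 4 * q + r - a - b - c] | a b c. facet_diffs q r a b c}"
    then obtain a b c where "l = [a, b, c, 4 * q + r - a - b - c]" "facet_diffs q r a b c" by blast
    then show "l \<in> {[1, q, q - 1, 2 * q + r], [1, q, 2 * q + r, q - 1], [1, 2 * q + r, q, q - 1]} \<union> {} \<union>
      ({[q - 1, 2, q - 1, 4 * q - 4 * h - 2 + r]} \<union>
       {[2, b, 2, 4 * q - 4 - b + r] | b. even b \<and> 2 \<le> b \<and> b \<le> q - 3}) \<union>
      {[1, b, 1, 4 * q + r - 2 - b] | b. 2 * q - 1 \<le> b \<and> b \<le> 2 * q - 1 + r div 2}"
      using qh unfolding facet_diffs_def by (elim disjE) simp_all
  qed
qed

section \<open>Edges and triangles\<close>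

lemma difference_cycle_4:
  "difference_cycle [a, b, c, n - a - b - c] =
    {(\<lambda>y. y mod n) ` {x, x + a, x + a + b, x + a + b + c} | x. x \<in> {0..<n}}"
  by (simp add: difference_cycle_def lessThan_Suc insert_commute add.assoc)

text \<open>Of r = 2kq the locale keeps non-negativity and divisibility by 2q. The latter makes r
  even and makes 2q divide n, so that t^n = 1 in the coordinate ring, where t^(2q) = 1.\<close>

locale brieskorn =
  fixes q r n :: int and K :: "int set set"
  assumes odd_q: "odd q" and q_ge_3: "3 \<le> q" and r_nonneg: "0 \<le> r" and dvd_r: "2 * q dvd r"
  defines "n \<equiv> 4 * q + r" and "K \<equiv> M_complex 2 q r"
begin

lemma n_gt_0: "0 < n" using q_ge_3 r_nonneg by (simp add: n_def)

lemma even_r: "even r" using dvd_r by (metis dvd_mult_left)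

lemma r_cases: "r = 0 \<or> 2 * q \<le> r"
  using dvd_r r_nonneg by (metis zdvd_imp_le le_less)

definition pt :: "int \<Rightarrow> int" where "pt x = x mod n"

lemma pt_range: "0 \<le> pt x" "pt x < n" using n_gt_0 by (simp_all add: pt_def)

lemma pt_id: "0 \<le> x \<Longrightarrow> x < n \<Longrightarrow> pt x = x" by (simp add: pt_def)

lemma pt_eq_iff: "pt x = pt y \<longleftrightarrow> n dvd x - y" by (simp add: pt_def mod_eq_dvd_iff)

lemma pt_period: "pt (x + n) = pt x" by (simp add: pt_def)

lemma pt_pt: "pt (pt x) = pt x" "pt (pt x + y) = pt (x + y)" "pt (y + pt x) = pt (y + x)"
  by (simp_all add: pt_def mod_simps)

lemma pt_inj: "pt x = pt y \<Longrightarrow> \<bar>x - y\<bar> < n \<Longrightarrow> x = y"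
  unfolding pt_eq_iff using dvd_imp_le_int[of "x - y" n] n_gt_0 by fastforce

lemma K_iff:
  "\<sigma> \<in> K \<longleftrightarrow> \<sigma> \<noteq> {} \<and> (\<exists>x a b c. facet_diffs q r a b c \<and>
     \<sigma> \<subseteq> pt ` {x, x + a, x + a + b, x + a + b + c})"
proof -
  have "\<sigma> \<in> K \<longleftrightarrow> \<sigma> \<noteq> {} \<and> (\<exists>a b c. facet_diffs q r a b c \<and>
      (\<exists>\<tau>\<in>difference_cycle [a, b, c, n - a - b - c]. \<sigma> \<subseteq> \<tau>))"
    unfolding K_def M_complex_def M_complex_2_cycles[OF odd_q q_ge_3]
      complex_of_cycles_def complex_of_facets_def n_def by blast
  also have "\<dots> \<longleftrightarrow> \<sigma> \<noteq> {} \<and> (\<exists>a b c. facet_diffs q r a b c \<and>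
      (\<exists>x\<in>{0..<n}. \<sigma> \<subseteq> pt ` {x, x + a, x + a + b, x + a + b + c}))"
    unfolding difference_cycle_4 pt_def by blast
  also have "\<dots> \<longleftrightarrow> \<sigma> \<noteq> {} \<and> (\<exists>x a b c. facet_diffs q r a b c \<and>
     \<sigma> \<subseteq> pt ` {x, x + a, x + a + b, x + a + b + c})"
  proof -
    have "pt ` {x, x + a, x + a + b, x + a + b + c} =
        pt ` {pt x, pt x + a, pt x + a + b, pt x + a + b + c}" for x a b c
      by (simp add: pt_pt add.assoc)
    moreover have "pt x \<in> {0..<n}" for x using pt_range by simp
    ultimately show ?thesis by metis
  qed
  finally show ?thesis .
qed

text \<open>
  One representative \<open>(a : b : n - a - b)\<close> of each orbit of triangles under the vertex shift.
\<close>

definition tri :: "int \<Rightarrow> int \<Rightarrow> bool" where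
  "tri a b \<longleftrightarrow>
     a = 1 \<and> b = q \<or> a = q \<and> b = q - 1 \<or> a = q \<and> b = q \<or> a = q - 1 \<and> b = 1 \<or>
     a = q - 1 \<and> b = q + 1 \<or> a = q + 1 \<and> b = q - 1 \<or>
     a = 1 \<and> 2 * q - 1 \<le> b \<and> b \<le> 2 * q + r \<or>
     a = 2 \<and> even b \<and> 2 \<le> b \<and> b \<le> q - 1 \<or> b = 2 \<and> even a \<and> 2 \<le> a \<and> a \<le> q - 1"

text \<open>The three disjuncts read the difference cycle (a : b : n - a - b) from each of its
  vertices.\<close>

definition tri_cyc :: "int \<Rightarrow> int \<Rightarrow> bool" where
  "tri_cyc a b \<longleftrightarrow> tri a b \<or> tri b (n - a - b) \<or> tri (n - a - b) a"

lemma tri_bounds: "tri a b \<Longrightarrow> 0 < a \<and> 0 < b \<and> b \<le> 2 * q + r \<and> a \<le> q + 1 \<and> a + b \<le> 2 * q + r + 1"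
  using q_ge_3 r_nonneg unfolding tri_def by auto

lemma tri_cyc_pos: "tri_cyc a b \<Longrightarrow> 0 < a \<and> 0 < b \<and> a + b < n"
  unfolding tri_cyc_def using tri_bounds[of a b] tri_bounds[of b "n - a - b"]
    tri_bounds[of "n - a - b" a] q_ge_3 by (auto simp: n_def)

lemma tri_cyc_rotate: "tri_cyc a b \<Longrightarrow> tri_cyc b (n - a - b)"
  unfolding tri_cyc_def by auto

text \<open>Each conclusion deletes one vertex of the facet with differences a, b, c: the fourth,
  the first, the third and the second, in this order.\<close>

lemma facet_diffs_tri:
  assumes "facet_diffs q r a b c"
  shows "tri_cyc a b" "tri_cyc b c" "tri_cyc a (b + c)" "tri_cyc (a + b) c"
proof -
  obtain s where s: "r = 2 * s" using even_r by blast
  have "even (q - 1)" using odd_q by simp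
  moreover have "even (2::int)" "even b \<Longrightarrow> even (b + 2)" "even b \<Longrightarrow> even (2 + b)" by simp_all
  moreover have "r div 2 = s" "r = 2 * s" using s by simp_all
  ultimately have *: "tri_cyc a b \<and> tri_cyc b c \<and> tri_cyc a (b + c) \<and> tri_cyc (a + b) c"
    using assms q_ge_3 r_nonneg unfolding facet_diffs_def tri_cyc_def tri_def n_def by (smt (verit))
  then show "tri_cyc a b" "tri_cyc b c" "tri_cyc a (b + c)" "tri_cyc (a + b) c" by simp_all
qed

definition vtri :: "int \<Rightarrow> int \<Rightarrow> int \<Rightarrow> int set" where
  "vtri x a b = {pt x, pt (x + a), pt (x + a + b)}"

lemma vtri_rotate: "vtri (x + a) b (n - a - b) = vtri x a b"
  using pt_period[of x] by (auto simp: vtri_def algebra_simps)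

lemma K_memI:
  "facet_diffs q r a b c \<Longrightarrow> \<sigma> \<noteq> {} \<Longrightarrow> \<sigma> \<subseteq> pt ` {x, x + a, x + a + b, x + a + b + c} \<Longrightarrow> \<sigma> \<in> K"
  unfolding K_iff by blast

lemma vtri_in_K_facet:
  assumes "facet_diffs q r a b c"
  shows "vtri x a b \<in> K" "vtri x b c \<in> K" "vtri x a (b + c) \<in> K" "vtri x (a + b) c \<in> K"
proof -
  show "vtri x a b \<in> K" "vtri x a (b + c) \<in> K" "vtri x (a + b) c \<in> K"
    by (rule K_memI[OF assms, where x = x]; simp add: vtri_def add.assoc)+
  show "vtri x b c \<in> K"
    by (rule K_memI[OF assms, where x = "x - a"]) (simp_all add: vtri_def)
qed

text \<open>Every orbit listed in \<open>tri\<close> is located as a face of a concrete facet, up to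
  translation and rotation. With \<open>K_triangle\<close> this makes the list of triangles
  exact.\<close>

lemma vtri_in_K:
  assumes "tri a b"
  shows "vtri x a b \<in> K"
proof -
  note F = vtri_in_K_facet
  consider "a = 1 \<and> b = q" | "a = q \<and> b = q - 1" | "a = q \<and> b = q" | "a = q - 1 \<and> b = 1" |
    "a = q - 1 \<and> b = q + 1" | "a = q + 1 \<and> b = q - 1" |
    "a = 1 \<and> 2 * q - 1 \<le> b \<and> b \<le> 2 * q - 1 + r div 2" |
    "a = 1 \<and> 2 * q - 1 + r div 2 < b \<and> b \<le> 2 * q - 1 + r" | "a = 1 \<and> b = 2 * q + r" |
    "a = 2 \<and> b = q - 1" | "a = q - 1 \<and> b = 2" |
    "a = 2 \<and> even b \<and> 2 \<le> b \<and> b \<le> q - 3" | "b = 2 \<and> even a \<and> 2 \<le> a \<and> a \<le> q - 3"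
  proof -
    \<comment> \<open>Parity excludes q - 2, so the even values up to q - 1 split into q - 1 and
      those up to q - 3, which belong to facets of different kinds.\<close>
    have "even c \<Longrightarrow> c \<noteq> q - 2" for c using odd_q by auto
    with assms show ?thesis using that unfolding tri_def by (smt (verit))
  qed
  then show ?thesis
  proof cases
    case 1 then show ?thesis using F(1)[of 1 q "q - 1"] by (simp add: facet_diffs_def)
  next
    case 2 then show ?thesis using F(2)[of 1 q "q - 1"] by (simp add: facet_diffs_def)
  next
    case 3 then show ?thesis
      using F(3)[of 1 "2 * q + r" q "x - 1"] F(2)[of 1 "2 * q + r" q "x - (2 * q + r)"]
        vtri_rotate[of "x - (2 * q + r)" "2 * q + r" q]
      by (simp add: facet_diffs_def n_def)
  next
    case 4
    then have ab: "a = q - 1" "b = 1" by simp_all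
    show ?thesis unfolding ab
      using F(3)[of 1 q "2 * q + r" "x + (q - 1)"] vtri_rotate[of x "q - 1" 1]
      by (simp add: facet_diffs_def n_def algebra_simps)
  next
    case 5
    then have ab: "a = q - 1" "b = q + 1" by simp_all
    show ?thesis unfolding ab
      using F(4)[of 1 q "2 * q + r" "x + (q - 1)"] vtri_rotate[of x "q - 1" "q + 1"]
      by (simp add: facet_diffs_def n_def algebra_simps)
  next
    case 6
    then have ab: "a = 1 + q" "b = q - 1" by simp_all
    show ?thesis unfolding ab using F(4)[of 1 q "q - 1"] by (simp add: facet_diffs_def)
  next
    case 7 then show ?thesis using F(1)[of 1 b 1] by (simp add: facet_diffs_def)
  next
    case 8
    \<comment> \<open>F_3 stops halfway. The facet used here has second difference n - 2 - b, so
      that b itself is its fourth difference.\<close>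
    then have f: "facet_diffs q r 1 (4 * q - 2 + r - b) 1"
      using even_r by (auto simp: facet_diffs_def)
    then show ?thesis
      using F(4)[OF f, of "x + 1 + b"] vtri_rotate[of x 1 b] vtri_rotate[of "x + 1" b "n - 1 - b"] 8
      by (simp add: n_def algebra_simps)
  next
    case 9
    have f: "facet_diffs q r 1 (2 * q - 1) 1" using r_nonneg by (simp add: facet_diffs_def)
    show ?thesis
      using F(2)[OF f, of "x + (1 + b)"] vtri_rotate[of x 1 b] vtri_rotate[of "x + 1" b "n - 1 - b"] 9
      by (simp add: n_def algebra_simps)
  next
    case 10 then show ?thesis using F(2)[of "q - 1" 2 "q - 1"] by (simp add: facet_diffs_def)
  next
    case 11 then show ?thesis using F(1)[of "q - 1" 2 "q - 1"] by (simp add: facet_diffs_def)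
  next
    case 12 then show ?thesis using F(1)[of 2 b 2] by (simp add: facet_diffs_def)
  next
    case 13 then show ?thesis using F(2)[of 2 a 2] by (simp add: facet_diffs_def)
  qed
qed

lemma vtri_cyc_in_K:
  assumes "tri_cyc a b"
  shows "vtri x a b \<in> K"
proof -
  have "vtri (x + a + b) (n - a - b) a = vtri x a b"
    using vtri_rotate[of "x + a" b "n - a - b"] vtri_rotate[of x a b] by simp
  with assms show ?thesis
    unfolding tri_cyc_def using vtri_in_K vtri_rotate[of x a b] by metis
qed

end

lemma three_subset_of_four:
  assumes "S \<subseteq> {a, b, c, d}" "card S = 3"
  shows "S = {a, b, c} \<or> S = {b, c, d} \<or> S = {a, c, d} \<or> S = {a, b, d}"
proof -
  have S: "S = T" if "S \<subseteq> T" "card T \<le> 3" "finite T" for T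
    using card_seteq[OF that(3,1)] that(2) assms(2) by simp
  have le: "card {x, y, z} \<le> 3" for x y z :: 'a by (simp add: card_insert_if)
  show ?thesis
  proof (cases "a \<in> S \<and> b \<in> S \<and> c \<in> S \<and> d \<in> S")
    case True
    then have "S = {a, b, c, d}" using assms(1) by auto
    with assms(2) show ?thesis by (auto simp: card_insert_if split: if_splits)
  next
    case False
    then have "S \<subseteq> {a, b, c} \<or> S \<subseteq> {b, c, d} \<or> S \<subseteq> {a, c, d} \<or> S \<subseteq> {a, b, d}"
      using assms(1) by blast
    then show ?thesis using S le by (meson finite.intros)
  qed
qed

lemma sorted_triple_eq:
  fixes a b c :: "'a::linorder"
  assumes "{a, b, c} = {x, y, z}" "a < b" "b < c" "x < y" "y < z"
  shows "a = x" "b = y" "c = z"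
proof -
  have "[a, b, c] = [x, y, z]"
    by (rule sorted_distinct_set_unique) (use assms(2-) in \<open>auto simp: assms(1)\<close>)
  then show "a = x" "b = y" "c = z" by simp_all
qed

context brieskorn begin

lemma tri_cyc_vtri:
  assumes "tri_cyc a b"
  obtains y a' b' where "tri a' b'" "vtri x a b = vtri y a' b'"
proof -
  have "vtri (x + a + b) (n - a - b) a = vtri x a b"
    using vtri_rotate[of "x + a" b "n - a - b"] vtri_rotate[of x a b] by simp
  with assms show ?thesis
    unfolding tri_cyc_def using vtri_rotate[of x a b] that by metis
qed

lemma K_triangle:
  assumes "\<sigma> \<in> K" "card \<sigma> = 3"
  obtains x a b where "tri a b" "\<sigma> = vtri x a b"
proof -
  obtain x a b c where f: "facet_diffs q r a b c"
    and "\<sigma> \<subseteq> {pt x, pt (x + a), pt (x + a + b), pt (x + a + b + c)}"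
    using assms(1) unfolding K_iff by auto
  from three_subset_of_four[OF this(2) assms(2)]
  consider "\<sigma> = vtri x a b" | "\<sigma> = vtri (x + a) b c" | "\<sigma> = vtri x (a + b) c" | "\<sigma> = vtri x a (b + c)"
    unfolding vtri_def by (auto simp: add.assoc)
  then show ?thesis
    using facet_diffs_tri[OF f] tri_cyc_vtri that by cases metis+
qed

lemma vtri_card:
  assumes "tri_cyc a b"
  shows "card (vtri x a b) = 3"
proof -
  have "0 < a" "0 < b" "a + b < n" using tri_cyc_pos[OF assms] by auto
  then have "pt x \<noteq> pt (x + a)" "pt (x + a) \<noteq> pt (x + a + b)" "pt x \<noteq> pt (x + a + b)"
    using pt_inj[of x "x + a"] pt_inj[of "x + a" "x + a + b"] pt_inj[of x "x + a + b"] by auto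
  then show ?thesis by (simp add: vtri_def)
qed

text \<open>The last range is closed under d |-> n - d, because n - (2q - 1) = 2q + r + 1. All other
  edges are listed in one direction only.\<close>

definition edge_diff :: "int \<Rightarrow> bool" where
  "edge_diff d \<longleftrightarrow> d = 1 \<or> d = q \<or> even d \<and> 2 \<le> d \<and> d \<le> q + 1 \<or> 2 * q - 1 \<le> d \<and> d \<le> 2 * q + r + 1"

lemma edge_diff_bounds: "edge_diff d \<Longrightarrow> 0 < d \<and> d < n"
  using q_ge_3 r_nonneg unfolding edge_diff_def n_def by auto

lemma tri_edge_diff:
  assumes "tri a b"
  shows "edge_diff a" "edge_diff b" "edge_diff (a + b)"
proof -
  have "even (q - 1)" "even (q + 1)" using odd_q by simp_all
  moreover have "even (2::int)" "even b \<Longrightarrow> even (2 + b)" "even a \<Longrightarrow> even (a + 2)" by simp_all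
  moreover have "even (q - 1 + 2)" "even (2 + (q - 1))" using odd_q by simp_all
  ultimately have "edge_diff a \<and> edge_diff b \<and> edge_diff (a + b)"
    using assms q_ge_3 r_nonneg unfolding tri_def edge_diff_def by (smt (verit))
  then show "edge_diff a" "edge_diff b" "edge_diff (a + b)" by simp_all
qed

lemma K_finite: "\<sigma> \<in> K \<Longrightarrow> finite \<sigma>"
  unfolding K_iff by (meson finite.emptyI finite.insertI finite_imageI finite_subset)

lemma K_subset: "\<sigma> \<in> K \<Longrightarrow> \<tau> \<subseteq> \<sigma> \<Longrightarrow> \<tau> \<noteq> {} \<Longrightarrow> \<tau> \<in> K"
  unfolding K_iff by blast

text \<open>A facet has at least three distinct vertices, hence one outside the given edge. This
  reduces the classification of edges to that of triangles.\<close>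

lemma K_edge_in_triangle:
  assumes "\<sigma> \<in> K" "card \<sigma> = 2"
  obtains w where "w \<notin> \<sigma>" "insert w \<sigma> \<in> K"
proof -
  obtain x a b c where f: "facet_diffs q r a b c"
    and s: "\<sigma> \<subseteq> pt ` {x, x + a, x + a + b, x + a + b + c}"
    using assms(1) unfolding K_iff by blast
  define P where "P = pt ` {x, x + a, x + a + b, x + a + b + c}"
  have "vtri x a b \<subseteq> P" by (simp add: vtri_def P_def)
  then have "3 \<le> card P"
    using vtri_card[OF facet_diffs_tri(1)[OF f], of x] card_mono[of P "vtri x a b"]
    by (simp add: P_def)
  then have "\<not> P \<subseteq> \<sigma>"
    using card_mono[OF K_finite[OF assms(1)], of P] assms(2) by linarith
  then obtain w where w: "w \<in> P" "w \<notin> \<sigma>" by blast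
  then have "insert w \<sigma> \<subseteq> P" using s P_def by blast
  then have "insert w \<sigma> \<in> K" using K_memI[OF f, of "insert w \<sigma>" x] P_def by blast
  with w show ?thesis using that by blast
qed

lemma two_subset_of_three:
  assumes "S \<subseteq> {a, b, c}" "card S = 2"
  shows "S = {a, b} \<or> S = {b, c} \<or> S = {a, c}"
proof -
  obtain x y where "S = {x, y}" "x \<noteq> y" using assms(2) by (meson card_2_iff)
  with assms(1) show ?thesis by blast
qed

lemma K_edge:
  assumes "\<sigma> \<in> K" "card \<sigma> = 2"
  obtains x d where "edge_diff d" "\<sigma> = {pt x, pt (x + d)}"
proof -
  obtain w where w: "w \<notin> \<sigma>" "insert w \<sigma> \<in> K" using K_edge_in_triangle[OF assms] .
  have "card (insert w \<sigma>) = 3" using w assms K_finite by simp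
  with w obtain x a b where t: "tri a b" "insert w \<sigma> = vtri x a b" using K_triangle by metis
  then have "\<sigma> \<subseteq> {pt x, pt (x + a), pt (x + a + b)}" unfolding vtri_def by blast
  from two_subset_of_three[OF this assms(2)] show ?thesis
    using tri_edge_diff[OF t(1)] that[of a x] that[of b "x + a"] that[of "a + b" x]
    by (auto simp: add.assoc)
qed

lemma K_vertices: "\<Union>K = {0..<n}"
proof
  have "pt ` A \<subseteq> {0..<n}" for A using pt_range by auto
  then show "\<Union>K \<subseteq> {0..<n}" using K_iff by (meson Sup_least subset_trans)
  show "{0..<n} \<subseteq> \<Union>K"
  proof
    fix v assume v: "v \<in> {0..<n}"
    have "tri 1 q" by (simp add: tri_def)
    then have "vtri v 1 q \<in> K" by (rule vtri_in_K)
    moreover have "v \<in> vtri v 1 q" using v pt_id by (simp add: vtri_def)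
    ultimately show "v \<in> \<Union>K" by blast
  qed
qed

lemma K_shift: "\<sigma> \<in> K \<Longrightarrow> (\<lambda>v. pt (v + s)) ` \<sigma> \<in> K"
proof -
  assume "\<sigma> \<in> K"
  then obtain x a b c where f: "facet_diffs q r a b c" and ne: "\<sigma> \<noteq> {}"
    and s: "\<sigma> \<subseteq> pt ` {x, x + a, x + a + b, x + a + b + c}"
    unfolding K_iff by blast
  have "(\<lambda>v. pt (v + s)) ` \<sigma> \<subseteq> (\<lambda>v. pt (v + s)) ` pt ` {x, x + a, x + a + b, x + a + b + c}"
    using s by (rule image_mono)
  also have "\<dots> \<subseteq> pt ` {x + s, x + s + a, x + s + a + b, x + s + a + b + c}"
    by (simp add: pt_pt algebra_simps)
  finally show ?thesis using ne by (intro K_memI[OF f, of _ "x + s"]) auto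
qed

lemma K_shift_iff:
  assumes "\<sigma> \<subseteq> {0..<n}"
  shows "(\<lambda>v. pt (v + s)) ` \<sigma> \<in> K \<longleftrightarrow> \<sigma> \<in> K"
proof
  assume "(\<lambda>v. pt (v + s)) ` \<sigma> \<in> K"
  then have "(\<lambda>v. pt (v + (- s))) ` (\<lambda>v. pt (v + s)) ` \<sigma> \<in> K" by (rule K_shift)
  also have "(\<lambda>v. pt (v + (- s))) ` (\<lambda>v. pt (v + s)) ` \<sigma> = (\<lambda>v. v) ` \<sigma>"
    unfolding image_image using assms pt_id
    by (intro image_cong refl) (auto simp only: pt_pt add.assoc add.right_inverse add_0_right atLeastLessThan_iff)
  finally show "\<sigma> \<in> K" by simp
qed (rule K_shift)

section \<open>Triangles at the vertex 0 and links of edges\<close>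

lemma zero_triangle_iff:
  assumes "0 < u" "u < v" "v < n"
  shows "{0, u, v} \<in> K \<longleftrightarrow> tri_cyc u (v - u)"
proof
  assume "tri_cyc u (v - u)"
  from vtri_cyc_in_K[OF this, of 0] assms show "{0, u, v} \<in> K" by (simp add: vtri_def pt_id)
next
  assume K: "{0, u, v} \<in> K"
  have "card {0, u, v} = 3" using assms by simp
  with K obtain y a b where t: "tri a b" "{0, u, v} = vtri y a b" using K_triangle by metis
  define x where "x = pt y"
  have x: "0 \<le> x" "x < n" using pt_range by (simp_all add: x_def)
  have v: "{0, u, v} = vtri x a b" using t(2) by (simp add: vtri_def x_def pt_pt add.assoc)
  have ab: "0 < a" "0 < b" "a + b < n" using tri_bounds[OF t(1)] q_ge_3 by (auto simp: n_def)
  have minus: "pt z = z - n" if "n \<le> z" "z < 2 * n" for z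
    using pt_period[of "z - n"] pt_id[of "z - n"] that by simp
  \<comment> \<open>The cases count how many of the three points have passed n, which decides which
    of them is the vertex 0.\<close>
  consider "x + a + b < n" | "x + a < n" "n \<le> x + a + b" | "n \<le> x + a" by linarith
  then show "tri_cyc u (v - u)"
  proof cases
    case 1
    then have "{0, u, v} = {x, x + a, x + a + b}" using v x ab by (simp add: vtri_def pt_id)
    from sorted_triple_eq[OF this] ab assms have "x = 0" "u = a" "v = a + b" by simp_all
    with t show ?thesis by (simp add: tri_cyc_def)
  next
    case 2
    then have "{0, u, v} = {x + a + b - n, x, x + a}"
      using v x ab by (auto simp: vtri_def pt_id minus)
    from sorted_triple_eq[OF this] ab assms
    have "x + a + b - n = 0" "u = x" "v = x + a" by simp_all
    then have "n - u - (v - u) = b" "v - u = a" by simp_all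
    with t show ?thesis by (simp add: tri_cyc_def)
  next
    case 3
    then have "{0, u, v} = {x + a - n, x + a + b - n, x}"
      using v x ab by (auto simp: vtri_def pt_id minus)
    from sorted_triple_eq[OF this] ab assms
    have "x + a - n = 0" "u = x + a + b - n" "v = x" by simp_all
    then have "n - u - (v - u) = a" "u = b" by simp_all
    with t show ?thesis by (simp add: tri_cyc_def)
  qed
qed

text \<open>
  The link of the edge \<open>{0, d}\<close>; its cardinality is the degree of all edges \<open>{x, x + d}\<close>.
\<close>

definition link_diffs :: "int \<Rightarrow> int set" where
  "link_diffs d = {w. 0 < w \<and> w < n \<and> (d < w \<and> tri_cyc d (w - d) \<or> w < d \<and> tri_cyc w (d - w))}"

definition link :: "int \<Rightarrow> int \<Rightarrow> int set" where
  "link u v = {w. {u, v, w} \<in> K \<and> w \<noteq> u \<and> w \<noteq> v}"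

lemma link_zero:
  assumes "0 < d" "d < n"
  shows "link 0 d = link_diffs d"
proof (intro equalityI subsetI)
  fix w assume w: "w \<in> link 0 d"
  then have "w \<in> {0..<n}" using K_vertices unfolding link_def by blast
  then have "0 < w" "w < n" using w by (auto simp: link_def)
  moreover have "{0, d, w} = {0, w, d}" by auto
  ultimately show "w \<in> link_diffs d"
    using w zero_triangle_iff[of d w] zero_triangle_iff[of w d] assms
    by (cases "d < w") (auto simp: link_def link_diffs_def)
next
  fix w assume w: "w \<in> link_diffs d"
  moreover have "{0, d, w} = {0, w, d}" by auto
  ultimately show "w \<in> link 0 d"
    using zero_triangle_iff[of d w] zero_triangle_iff[of w d] assms
    by (auto simp: link_def link_diffs_def)
qed

lemma pt_shift_bij: "bij_betw (\<lambda>v. pt (v + s)) {0..<n} {0..<n}"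
proof (rule bij_betwI[where g = "\<lambda>v. pt (v - s)"])
  show "(\<lambda>v. pt (v + s)) \<in> {0..<n} \<rightarrow> {0..<n}" "(\<lambda>v. pt (v - s)) \<in> {0..<n} \<rightarrow> {0..<n}"
    using pt_range by auto
  show "pt (pt (x + s) - s) = x" if "x \<in> {0..<n}" for x
    using that pt_pt(2)[of "x + s" "- s"] by (simp add: pt_id)
  show "pt (pt (x - s) + s) = x" if "x \<in> {0..<n}" for x
    using that pt_pt(2)[of "x - s" s] by (simp add: pt_id)
qed

lemma link_subset: "link u v \<subseteq> {0..<n}"
  using K_vertices unfolding link_def by blast

text \<open>The condition on \<open>K\<close> concerns only subsets of the vertex set, so that
  automorphisms and the maps \<open>\<lambda>v. pt (v + s)\<close> are covered alike.\<close>

lemma link_image: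
  assumes f: "inj_on f {0..<n}" "f ` {0..<n} = {0..<n}"
    and K: "\<And>\<sigma>. \<sigma> \<subseteq> {0..<n} \<Longrightarrow> f ` \<sigma> \<in> K \<longleftrightarrow> \<sigma> \<in> K"
    and uv: "u \<in> {0..<n}" "v \<in> {0..<n}"
  shows "link (f u) (f v) = f ` link u v"
proof (intro equalityI subsetI)
  fix w assume w: "w \<in> link (f u) (f v)"
  then have "w \<in> f ` {0..<n}" using link_subset f(2) by blast
  then obtain x where x: "w = f x" "x \<in> {0..<n}" by blast
  then have "f ` {u, v, x} \<in> K" using w by (simp add: link_def)
  then have "{u, v, x} \<in> K" using K[of "{u, v, x}"] uv x by simp
  then show "w \<in> f ` link u v" using w x by (auto simp: link_def)
next
  fix w assume "w \<in> f ` link u v"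
  then obtain x where x: "w = f x" "{u, v, x} \<in> K" "x \<noteq> u" "x \<noteq> v" by (auto simp: link_def)
  then have "x \<in> {0..<n}" using K_vertices by blast
  then show "w \<in> link (f u) (f v)"
    using x K[of "{u, v, x}"] uv inj_onD[OF f(1)] by (auto simp: link_def)
qed

lemma card_link:
  assumes "u \<in> {0..<n}" "0 < d" "d < n"
  shows "card (link u (pt (u + d))) = card (link_diffs d)"
proof -
  let ?f = "\<lambda>v. pt (v + u)"
  have "link u (pt (u + d)) = link (?f 0) (?f d)" using assms by (simp add: pt_id add.commute)
  also have "\<dots> = ?f ` link 0 d"
    by (rule link_image) (use pt_shift_bij[of u] K_shift_iff assms in \<open>auto simp: bij_betw_def\<close>)
  finally have "link u (pt (u + d)) = ?f ` link_diffs d" using link_zero assms by simp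
  moreover have "inj_on ?f (link_diffs d)"
    using pt_shift_bij[of u] by (rule inj_on_subset[OF bij_betw_imp_inj_on]) (auto simp: link_diffs_def)
  ultimately show ?thesis by (simp add: card_image)
qed

lemma link_commute: "link u v = link v u"
  unfolding link_def by (metis insert_commute)

text \<open>Read from its other end, the edge {0, d} has difference n - d.\<close>

lemma card_link_diffs_neg:
  assumes "0 < d" "d < n"
  shows "card (link_diffs (n - d)) = card (link_diffs d)"
proof -
  have "link 0 (pt (0 + d)) = link d (pt (d + (n - d)))"
    using assms link_commute pt_period[of 0] by (simp add: pt_id)
  moreover have "card (link 0 (pt (0 + d))) = card (link_diffs d)"
    by (rule card_link) (use assms in auto)
  moreover have "card (link d (pt (d + (n - d)))) = card (link_diffs (n - d))"
    by (rule card_link) (use assms in auto)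
  ultimately show ?thesis by simp
qed

end

section \<open>Edge degrees\<close>

lemma card_ge_distinct_list:
  "finite A \<Longrightarrow> set ws \<subseteq> A \<Longrightarrow> distinct ws \<Longrightarrow> length ws \<le> card A"
  by (metis card_mono distinct_card)

context brieskorn begin

lemma finite_link_diffs: "finite (link_diffs d)"
  by (rule finite_subset[of _ "{0..n}"]) (auto simp: link_diffs_def)

text \<open>The triangle 0, a, a + b is viewed over each of its three edges. For the edge of
  difference b it is translated by -a, which sends 0 to n - a.\<close>

lemma link_diffsI:
  assumes "tri_cyc a b"
  shows "a + b \<in> link_diffs a" "n - a \<in> link_diffs b" "a \<in> link_diffs (a + b)"
proof -
  have "tri_cyc b (n - a - b)" using tri_cyc_rotate[OF assms] .
  then have "tri_cyc b (n - a - b)" "0 < a" "0 < b" "a + b < n" using tri_cyc_pos assms by auto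
  then show "a + b \<in> link_diffs a" "n - a \<in> link_diffs b" "a \<in> link_diffs (a + b)"
    using assms by (auto simp: link_diffs_def)
qed

lemma tri_cyc_tri: "tri a b \<Longrightarrow> tri_cyc a b" by (simp add: tri_cyc_def)

lemma tri_cyc_1:
  assumes "2 * q - 1 \<le> d" "d \<le> 2 * q + r"
  shows "tri_cyc 1 d" "tri_cyc d 1"
  using assms by (auto simp: tri_cyc_def tri_def n_def)

lemma tri_cyc_q: "tri_cyc 1 q" "tri_cyc q (q - 1)" "tri_cyc q q" "tri_cyc (q - 1) 1"
    "tri_cyc (q - 1) (q + 1)" "tri_cyc (q + 1) (q - 1)"
  by (rule tri_cyc_tri, simp add: tri_def)+

lemma tri_cyc_2:
  assumes "even d" "2 \<le> d" "d \<le> q - 1"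
  shows "tri_cyc 2 d" "tri_cyc d 2"
  by (rule tri_cyc_tri, use assms in \<open>simp add: tri_def\<close>)+

text \<open>Only the degrees 3 and 5 have to be recognized, so most degrees are merely bounded below
  by exhibiting link vertices. The link of difference 1 grows with r: it has at most 4 members for r
  = 0, and at least 6 otherwise because then r \<ge> 2q \<ge> 6.\<close>

lemma card_link_diffs_1: "card (link_diffs 1) \<noteq> 5"  "4 \<le> card (link_diffs 1)"
proof -
  have mem: "q + 1 \<in> link_diffs 1" "n - q + 1 \<in> link_diffs 1"
    using link_diffsI(1)[OF tri_cyc_q(1)] link_diffsI(2)[OF tri_cyc_q(4)] by (simp_all add: algebra_simps)
  have mem': "w \<in> link_diffs 1" if "2 * q \<le> w" "w \<le> 2 * q + r + 1" for w
    using link_diffsI(1)[OF tri_cyc_1(1), of "w - 1"] that by simp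
  show "4 \<le> card (link_diffs 1)"
    using card_ge_distinct_list[OF finite_link_diffs, of "[q + 1, n - q + 1, 2 * q, 2 * q + 1]" 1]
      mem mem'[of "2 * q"] mem'[of "2 * q + 1"] q_ge_3 r_nonneg by (simp add: n_def)
  show "card (link_diffs 1) \<noteq> 5"
  proof (cases "r = 0")
    case True
    have "link_diffs 1 \<subseteq> {q + 1, n - q + 1, 2 * q, 2 * q + 1}"
      using True q_ge_3 unfolding link_diffs_def tri_cyc_def tri_def n_def by auto
    from card_mono[OF _ this] have "card (link_diffs 1) \<le> card {q + 1, n - q + 1, 2 * q, 2 * q + 1}" by simp
    also have "\<dots> \<le> 4" by (simp add: card_insert_if)
    finally show ?thesis by simp
  next
    case False
    then have "6 \<le> r" using r_cases q_ge_3 by auto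
    then show ?thesis
      using card_ge_distinct_list[OF finite_link_diffs,
          of "[q + 1, 2 * q, 2 * q + 1, 2 * q + 2, 2 * q + 3, 2 * q + 4]" 1]
        mem mem'[of "2 * q"] mem'[of "2 * q + 1"] mem'[of "2 * q + 2"] mem'[of "2 * q + 3"]
        mem'[of "2 * q + 4"] q_ge_3 by simp
  qed
qed

lemma card_link_diffs_2q: "6 \<le> card (link_diffs (2 * q))"
proof -
  have "set [1, 2 * q - 1, q, q - 1, q + 1, 2 * q + 1] \<subseteq> link_diffs (2 * q)"
    using link_diffsI(3)[OF tri_cyc_1(1), of "2 * q - 1"] link_diffsI(3)[OF tri_cyc_1(2), of "2 * q - 1"]
      link_diffsI(3)[OF tri_cyc_q(3)] link_diffsI(3)[OF tri_cyc_q(5)] link_diffsI(3)[OF tri_cyc_q(6)]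
      link_diffsI(1)[OF tri_cyc_1(2), of "2 * q"] q_ge_3 r_nonneg by simp
  from card_ge_distinct_list[OF finite_link_diffs this] show ?thesis using q_ge_3 by simp
qed

lemma card_link_diffs_q_minus_1: "6 \<le> card (link_diffs (q - 1))"
proof -
  have "tri_cyc 2 (q - 1)" "tri_cyc (q - 1) 2" using tri_cyc_2[of "q - 1"] odd_q q_ge_3 by simp_all
  then have "set [q, 2 * q, q + 1, n - q - 1, n - q, n - 2] \<subseteq> link_diffs (q - 1)"
    using link_diffsI(1)[OF tri_cyc_q(4)] link_diffsI(1)[OF tri_cyc_q(5)] link_diffsI(1)[of "q - 1" 2]
      link_diffsI(2)[OF tri_cyc_q(2)] link_diffsI(2)[OF tri_cyc_q(6)] link_diffsI(2)[of 2 "q - 1"]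
    by (simp add: algebra_simps)
  from card_ge_distinct_list[OF finite_link_diffs this] show ?thesis
    using q_ge_3 r_nonneg by (simp add: n_def)
qed

lemma card_link_diffs_2: "5 \<le> q \<Longrightarrow> 4 \<le> card (link_diffs 2)" "7 \<le> q \<Longrightarrow> 6 \<le> card (link_diffs 2)"
proof -
  have mem: "2 + d \<in> link_diffs 2" "n - d \<in> link_diffs 2" if "even d" "2 \<le> d" "d \<le> q - 1" for d
    using link_diffsI(1)[OF tri_cyc_2(1)] link_diffsI(2)[OF tri_cyc_2(2)] that by simp_all
  show "4 \<le> card (link_diffs 2)" if "5 \<le> q"
    using card_ge_distinct_list[OF finite_link_diffs, of "[4, 6, n - 2, n - 4]" 2]
      mem[of 2] mem[of 4] that r_nonneg by (simp add: n_def)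
  show "6 \<le> card (link_diffs 2)" if "7 \<le> q"
    using card_ge_distinct_list[OF finite_link_diffs, of "[4, 6, 8, n - 2, n - 4, n - 6]" 2]
      mem[of 2] mem[of 4] mem[of 6] that r_nonneg by (simp add: n_def)
qed

lemma even_neq_q: "even x \<Longrightarrow> q - x \<noteq> 2" "even x \<Longrightarrow> x \<noteq> q" "even x \<Longrightarrow> q \<noteq> x"
  using odd_q by presburger+

text \<open>The difference 6 matters because it lies in the link of 4. For q = 7 it is q - 1, of
  degree at least 6; for larger q only four link vertices are possible.\<close>

lemma card_link_diffs_6:
  assumes "7 \<le> q" shows "card (link_diffs 6) \<noteq> 5"
proof (cases "q = 7")
  case True
  then show ?thesis using card_link_diffs_q_minus_1 by simp
next
  case False
  then have "9 \<le> q" using assms odd_q by presburger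
  then have "link_diffs 6 \<subseteq> {n - 2, 8, 2, 4}"
    using even_neq_q(2)[of 6] r_nonneg unfolding link_diffs_def tri_cyc_def tri_def n_def by auto
  from card_mono[OF _ this] have "card (link_diffs 6) \<le> card {n - 2, 8, 2, 4}" by simp
  also have "\<dots> \<le> 4" by (simp add: card_insert_if)
  finally show ?thesis by simp
qed

lemma link_diffs_2q_minus_1: "link_diffs (2 * q - 1) = {q, 2 * q, n - 1}"
proof
  show "link_diffs (2 * q - 1) \<subseteq> {q, 2 * q, n - 1}"
  proof
    have S: "a = 1" if "tri a b" "a + b = 2 * q + r + 1" for a b
      using that q_ge_3 r_nonneg unfolding tri_def by auto
    have L: "a = 1" if "tri a (2 * q - 1)" for a
      using that q_ge_3 unfolding tri_def by auto
    have M: "a = q" if "tri a b" "a + b = 2 * q - 1" for a b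
      using that q_ge_3 unfolding tri_def by auto
    define d where "d = 2 * q - 1"
    fix w assume "w \<in> link_diffs (2 * q - 1)"
    then consider "d < w" "tri d (w - d) \<or> tri (w - d) (n - w) \<or> tri (n - w) d"
      | "w < d" "tri w (d - w) \<or> tri (d - w) (n - d) \<or> tri (n - d) w"
      unfolding link_diffs_def tri_cyc_def d_def[symmetric] by (auto simp: algebra_simps)
    then show "w \<in> {q, 2 * q, n - 1}"
    proof cases
      case 1
      then show ?thesis
        using tri_bounds[of d "w - d"] S[of "w - d" "n - w"] L[of "n - w"] q_ge_3
        by (auto simp: n_def d_def)
    next
      case 2
      then show ?thesis
        using M[of w "d - w"] tri_bounds[of "d - w" "n - d"] tri_bounds[of "n - d" w] q_ge_3 r_nonneg
        by (auto simp: n_def d_def)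
    qed
  qed
  show "{q, 2 * q, n - 1} \<subseteq> link_diffs (2 * q - 1)"
    using link_diffsI(3)[OF tri_cyc_q(2)] link_diffsI(1)[OF tri_cyc_1(2), of "2 * q - 1"]
      link_diffsI(2)[OF tri_cyc_1(1), of "2 * q - 1"] r_nonneg by simp
qed

lemma link_diffs_q: "link_diffs q = {n - 1, 2 * q - 1, 2 * q, n - q, q - 1}"
proof
  show "link_diffs q \<subseteq> {n - 1, 2 * q - 1, 2 * q, n - q, q - 1}"
  proof
    fix w assume "w \<in> link_diffs q"
    then show "w \<in> {n - 1, 2 * q - 1, 2 * q, n - q, q - 1}"
      using q_ge_3 r_nonneg even_neq_q[of "q - w"] even_neq_q[of "w"] even_neq_q[of 2]
      unfolding link_diffs_def tri_cyc_def tri_def n_def by simp (smt (verit) even_neq_q)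
  qed
  show "{n - 1, 2 * q - 1, 2 * q, n - q, q - 1} \<subseteq> link_diffs q"
    using link_diffsI(2)[OF tri_cyc_q(1)] link_diffsI(1)[OF tri_cyc_q(2)] link_diffsI(1)[OF tri_cyc_q(3)]
      link_diffsI(2)[OF tri_cyc_q(3)] link_diffsI(3)[OF tri_cyc_q(4)] by simp
qed

text \<open>An even difference d from 6 to q - 3 has the link vertices n - 2, d + 2, 2 and d - 2. At
  d = 4 the last two coincide, which leaves three.\<close>

lemma link_diffs_4:
  assumes "7 \<le> q" shows "link_diffs 4 \<subseteq> {2, 6, n - 2}"
proof
  have R: "b = 2" if "tri 4 b" for b using that assms even_neq_q(2)[of 4] unfolding tri_def by auto
  have L: "a = 2" if "tri a 4" for a using that assms even_neq_q(2)[of 4] unfolding tri_def by auto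
  have M: "a = 2" if "tri a b" "a + b = 4" for a b
    using that assms unfolding tri_def by auto
  fix w assume "w \<in> link_diffs 4"
  then consider "4 < w" "tri 4 (w - 4) \<or> tri (w - 4) (n - w) \<or> tri (n - w) 4"
    | "w < 4" "tri w (4 - w) \<or> tri (4 - w) (n - 4) \<or> tri (n - 4) w"
    unfolding link_diffs_def tri_cyc_def by (auto simp: algebra_simps)
  then show "w \<in> {2, 6, n - 2}"
  proof cases
    case 1
    then show ?thesis
      using R[of "w - 4"] L[of "n - w"] tri_bounds[of "w - 4" "n - w"] assms by (auto simp: n_def)
  next
    case 2
    then show ?thesis
      using M[of w "4 - w"] tri_bounds[of "4 - w" "n - 4"] tri_bounds[of "n - 4" w] r_nonneg assms
      by (auto simp: n_def)
  qed
qed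

text \<open>Translation by -d moves the edge {0, d} to {n - d, 0} and a link vertex e to e - d; the
  disjuncts are its two possible representatives in the vertex range.\<close>

lemma link_diffs_neg:
  assumes "e \<in> link_diffs d"
  shows "e - d \<in> link_diffs (n - d) \<or> e - d + n \<in> link_diffs (n - d)"
proof -
  consider "d < e" "tri_cyc d (e - d)" | "e < d" "tri_cyc e (d - e)"
    using assms by (auto simp: link_diffs_def)
  then show ?thesis
  proof cases
    case 1
    with tri_cyc_rotate[OF 1(2)] tri_cyc_pos[OF 1(2)] show ?thesis by (auto simp: link_diffs_def)
  next
    case 2
    from tri_cyc_rotate[OF tri_cyc_rotate[OF 2(2)]] tri_cyc_pos[OF 2(2)] show ?thesis
      by (auto simp: link_diffs_def algebra_simps)
  qed
qed

lemma card_link_diffs_2q_minus_1: "card (link_diffs (2 * q - 1)) = 3"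
  using q_ge_3 r_nonneg by (simp add: link_diffs_2q_minus_1 n_def)

lemma card_link_diffs_q: "card (link_diffs q) = 5"
  using q_ge_3 r_nonneg by (simp add: link_diffs_q n_def)

lemma card_link_diffs_q_plus_1: "4 \<le> card (link_diffs (q + 1))"
proof -
  have "set [1, q - 1, 2 * q, n - q + 1] \<subseteq> link_diffs (q + 1)"
    using link_diffsI(3)[OF tri_cyc_q(1)] link_diffsI(1)[OF tri_cyc_q(6)] link_diffsI(2)[OF tri_cyc_q(5)]
      link_diffsI(3)[OF tri_cyc_2(2), of "q - 1"] odd_q q_ge_3 by (simp add: algebra_simps)
  from card_ge_distinct_list[OF finite_link_diffs this] show ?thesis
    using q_ge_3 r_nonneg by (simp add: n_def)
qed

lemma card_link_diffs_even:
  assumes "even d" "6 \<le> d" "d \<le> q - 3"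
  shows "4 \<le> card (link_diffs d)"
proof -
  have "set [n - 2, d + 2, 2, d - 2] \<subseteq> link_diffs d"
    using link_diffsI(2)[OF tri_cyc_2(1), of d] link_diffsI(1)[OF tri_cyc_2(2), of d]
      link_diffsI(3)[OF tri_cyc_2(1), of "d - 2"] link_diffsI(3)[OF tri_cyc_2(2), of "d - 2"] assms by simp
  from card_ge_distinct_list[OF finite_link_diffs this] show ?thesis
    using assms r_nonneg by (simp add: n_def)
qed

lemma card_link_diffs_long:
  assumes "2 * q \<le> d" "d \<le> 2 * q + r"
  shows "4 \<le> card (link_diffs d)"
proof -
  have "set [n - 1, d + 1, 1, d - 1] \<subseteq> link_diffs d"
    using link_diffsI(2)[OF tri_cyc_1(1), of d] link_diffsI(1)[OF tri_cyc_1(2), of d]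
      link_diffsI(3)[OF tri_cyc_1(1), of "d - 1"] link_diffsI(3)[OF tri_cyc_1(2), of "d - 1"] assms by simp
  from card_ge_distinct_list[OF finite_link_diffs this] show ?thesis
    using assms q_ge_3 by (simp add: n_def)
qed

text \<open>The difference 4 is exceptional only from q = 7 on: for q = 3 it equals q + 1 and for q
  = 5 it equals q - 1, and both have degree above 3.\<close>

lemma edge_diff_card_3:
  assumes "edge_diff d" "card (link_diffs d) = 3"
  shows "d = 2 * q - 1 \<or> d = n - (2 * q - 1) \<or> d = 4 \<and> 7 \<le> q"
proof -
  consider "d = 1" | "d = q" | "d = q - 1" | "d = q + 1" | "d = 2" "q \<noteq> 3" |
    "d = 4" "d \<noteq> q - 1" "d \<noteq> q + 1" |
    "even d" "6 \<le> d" "d \<le> q - 3" | "d = 2 * q - 1" | "2 * q \<le> d" "d \<le> 2 * q + r" | "d = 2 * q + r + 1"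
  proof -
    have "even e \<Longrightarrow> e \<noteq> q \<and> e \<noteq> q - 2" for e using odd_q by auto
    moreover have "even e \<Longrightarrow> e \<noteq> 3 \<and> e \<noteq> 5" for e :: int by auto
    ultimately show ?thesis using assms(1) that unfolding edge_diff_def by (smt (verit))
  qed
  then show ?thesis
  proof cases
    case 5
    then have "5 \<le> q" using q_ge_3 odd_q by presburger
    with 5 card_link_diffs_2 assms show ?thesis by simp
  next
    case 6
    then have "7 \<le> q" using q_ge_3 odd_q by presburger
    with 6 show ?thesis by simp
  next
    case 7
    with card_link_diffs_even[of d] assms show ?thesis by simp
  next
    case 9
    with card_link_diffs_long[of d] assms show ?thesis by simp
  qed (use assms card_link_diffs_1 card_link_diffs_q card_link_diffs_q_minus_1 card_link_diffs_q_plus_1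
      in \<open>simp_all add: n_def\<close>)
qed

lemma tri_cyc_edge_diff:
  assumes "tri_cyc a b"
  shows "edge_diff a \<or> edge_diff (n - a)" "edge_diff (a + b) \<or> edge_diff (n - (a + b))"
proof -
  note assms[unfolded tri_cyc_def]
  then show "edge_diff a \<or> edge_diff (n - a)" "edge_diff (a + b) \<or> edge_diff (n - (a + b))"
    using tri_edge_diff[of a b] tri_edge_diff[of b "n - a - b"] tri_edge_diff[of "n - a - b" a]
    by (auto simp: algebra_simps)
qed

text \<open>
  The degrees single out the directed pattern \<open>(0, 2q - 1, q)\<close>, so that automorphisms respect it.
\<close>

lemma link_diffs_degrees_3_5:
  assumes e: "e \<in> link_diffs d" and d: "0 < d" "d < n"
    and c3: "card (link_diffs d) = 3" and c5: "card (link_diffs e) = 5"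
  shows "d = 2 * q - 1 \<and> e = q"
proof -
  have e_bounds: "0 < e" "e < n" using e by (auto simp: link_diffs_def)
  have neg: "card (link_diffs (n - d)) = 3" "card (link_diffs (n - e)) = 5"
    using card_link_diffs_neg[of d] card_link_diffs_neg[of e] c3 c5 d e by (auto simp: link_diffs_def)
  have "edge_diff d \<or> edge_diff (n - d)"
    using e tri_cyc_edge_diff(1)[of d "e - d"] tri_cyc_edge_diff(2)[of e "d - e"]
    by (auto simp: link_diffs_def)
  then have D: "d = 2 * q - 1 \<or> d = n - (2 * q - 1) \<or> 7 \<le> q \<and> (d = 4 \<or> d = n - 4)"
    using edge_diff_card_3[OF _ c3] edge_diff_card_3[OF _ neg(1)] by linarith
  have ne: "e \<noteq> x \<and> e \<noteq> n - x" if "card (link_diffs x) \<noteq> 5" for x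
    using c5 neg(2) that by auto
  have deg: "card (link_diffs (2 * q)) \<noteq> 5" "card (link_diffs (q - 1)) \<noteq> 5"
    using card_link_diffs_2q card_link_diffs_q_minus_1 by simp_all
  show ?thesis
    using D
  proof (elim disjE conjE)
    assume d: "d = 2 * q - 1"
    with e have "e = q \<or> e = 2 * q \<or> e = n - 1" using link_diffs_2q_minus_1 by simp
    with ne[OF deg(1)] ne[OF card_link_diffs_1(1)] d show ?thesis by blast
  next
    \<comment> \<open>From the far end of the edge, the link vertices have differences 1, 2q and q -
      1 up to sign, none of degree 5. This asymmetry fixes the direction.\<close>
    assume d: "d = n - (2 * q - 1)"
    then have "link_diffs (n - d) = {q, 2 * q, n - 1}" using link_diffs_2q_minus_1 by simp
    then have "e - d \<in> {q, 2 * q, n - 1} \<or> e - d + n \<in> {q, 2 * q, n - 1}"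
      using link_diffs_neg[OF e] by simp
    with e_bounds d have "e = 1 \<or> e = n - 2 * q \<or> e = n - (q - 1)"
      using q_ge_3 r_nonneg by (auto simp: n_def)
    with ne[OF deg(1)] ne[OF deg(2)] ne[OF card_link_diffs_1(1)] show ?thesis by blast
  next
    \<comment> \<open>Up to sign, the link of 4 contains only the differences 2 and 6, and neither
      has degree 5.\<close>
    assume q: "7 \<le> q" and d: "d = 4"
    with e link_diffs_4 have "e = 2 \<or> e = 6 \<or> e = n - 2" by blast
    with ne[OF card_link_diffs_6[OF q]] ne[of 2] card_link_diffs_2(2)[OF q] show ?thesis by force
  next
    assume q: "7 \<le> q" and d: "d = n - 4"
    then have "link_diffs (n - d) \<subseteq> {2, 6, n - 2}" using link_diffs_4 by simp
    then have "e - d \<in> {2, 6, n - 2} \<or> e - d + n \<in> {2, 6, n - 2}"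
      using link_diffs_neg[OF e] by blast
    then have "e = 2 \<or> e = n - 6 \<or> e = n - 2"
      using e_bounds q r_nonneg unfolding d insert_iff empty_iff n_def by (elim disjE) simp_all
    with ne[OF card_link_diffs_6[OF q]] ne[of 2] card_link_diffs_2(2)[OF q] show ?thesis by force
  qed
qed

end

section \<open>The automorphism group\<close>

lemma group_Aut_complex: "group (Aut_complex K)"
proof -
  interpret B: group "BijGroup (\<Union>K)" by (rule group_BijGroup)
  have sub: "subgroup {f \<in> Bij (\<Union>K). (`) f ` K = K} (BijGroup (\<Union>K))"
  proof
    show "{f \<in> Bij (\<Union>K). (`) f ` K = K} \<subseteq> carrier (BijGroup (\<Union>K))"
      by (auto simp: BijGroup_def)
  next
    fix f g assume fg: "f \<in> {f \<in> Bij (\<Union>K). (`) f ` K = K}" "g \<in> {f \<in> Bij (\<Union>K). (`) f ` K = K}"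
    have "compose (\<Union>K) f g ` \<sigma> = f ` g ` \<sigma>" if "\<sigma> \<in> K" for \<sigma>
      unfolding image_image using that by (intro image_cong refl) (auto simp: compose_def)
    then have "(`) (compose (\<Union>K) f g) ` K = (\<lambda>\<sigma>. f ` g ` \<sigma>) ` K" by (rule image_cong[OF refl])
    also have "\<dots> = (`) f ` ((`) g ` K)" by (simp add: image_image)
    finally show "f \<otimes>\<^bsub>BijGroup (\<Union>K)\<^esub> g \<in> {f \<in> Bij (\<Union>K). (`) f ` K = K}"
      using fg by (simp add: BijGroup_def compose_Bij)
  next
    have "(\<lambda>x\<in>\<Union>K. x) ` \<sigma> = \<sigma>" if "\<sigma> \<in> K" for \<sigma>
    proof -
      have "(\<lambda>x\<in>\<Union>K. x) ` \<sigma> = (\<lambda>x. x) ` \<sigma>" using that by (intro image_cong refl) auto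
      then show ?thesis by simp
    qed
    then show "\<one>\<^bsub>BijGroup (\<Union>K)\<^esub> \<in> {f \<in> Bij (\<Union>K). (`) f ` K = K}"
      by (simp add: BijGroup_def id_Bij)
  next
    fix f assume f: "f \<in> {f \<in> Bij (\<Union>K). (`) f ` K = K}"
    let ?g = "\<lambda>x\<in>\<Union>K. inv_into (\<Union>K) f x"
    have bij: "bij_betw f (\<Union>K) (\<Union>K)" using f by (simp add: Bij_def)
    have "?g ` f ` \<sigma> = \<sigma>" if "\<sigma> \<in> K" for \<sigma>
    proof -
      have "?g (f x) = x" if "x \<in> \<sigma>" for x
        using bij that \<open>\<sigma> \<in> K\<close> bij_betw_inv_into_left[OF bij, of x] bij_betwE[OF bij] by auto
      then have "(\<lambda>x. ?g (f x)) ` \<sigma> = (\<lambda>x. x) ` \<sigma>" by (rule image_cong[OF refl])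
      then show ?thesis by (simp only: image_image image_ident)
    qed
    then have "(\<lambda>\<sigma>. ?g ` f ` \<sigma>) ` K = (\<lambda>\<sigma>. \<sigma>) ` K" by (rule image_cong[OF refl])
    then have "(`) ?g ` ((`) f ` K) = K" by (simp only: image_image image_ident)
    then have "(`) ?g ` K = K" using f by simp
    then show "inv\<^bsub>BijGroup (\<Union>K)\<^esub> f \<in> {f \<in> Bij (\<Union>K). (`) f ` K = K}"
      using f inv_BijGroup restrict_inv_into_Bij by force
  qed
  show ?thesis
    unfolding Aut_complex_def by (rule subgroup.subgroup_is_group[OF sub]) (rule B.is_group)
qed

context brieskorn begin

abbreviation sh :: "int \<Rightarrow> int \<Rightarrow> int" where "sh \<equiv> vertex_shift (nat n)"

lemma sh_eq: "sh g = (\<lambda>v\<in>{0..<n}. pt (v + g))"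
  using n_gt_0 by (simp add: vertex_shift_def pt_def)

lemma sh_Aut: "sh g \<in> carrier (Aut_complex K)"
proof -
  have "sh g ` \<sigma> = (\<lambda>v. pt (v + g)) ` \<sigma>" if "\<sigma> \<subseteq> {0..<n}" for \<sigma>
    using that by (intro image_cong refl) (auto simp: sh_eq)
  moreover have sub: "\<sigma> \<subseteq> {0..<n}" if "\<sigma> \<in> K" for \<sigma> using that K_vertices by blast
  ultimately have im: "(`) (sh g) ` K = (`) (\<lambda>v. pt (v + g)) ` K"
    by (metis (no_types, lifting) image_cong)
  have "\<sigma> \<in> (`) (\<lambda>v. pt (v + g)) ` K" if "\<sigma> \<in> K" for \<sigma>
  proof
    show "(\<lambda>v. pt (v + - g)) ` \<sigma> \<in> K" using that by (rule K_shift)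
    have "(\<lambda>v. v) ` \<sigma> = (\<lambda>v. pt (v + g)) ` (\<lambda>v. pt (v + - g)) ` \<sigma>"
      unfolding image_image using sub[OF that] pt_id
      by (intro image_cong refl) (auto simp: pt_pt subset_eq)
    then show "\<sigma> = (\<lambda>v. pt (v + g)) ` (\<lambda>v. pt (v + - g)) ` \<sigma>" by simp
  qed
  then have "(`) (sh g) ` K = K" unfolding im using K_shift by blast
  moreover have "bij_betw (sh g) {0..<n} {0..<n}"
    using pt_shift_bij[of g] by (subst bij_betw_cong[of _ _ "\<lambda>v. pt (v + g)"]) (auto simp: sh_eq)
  ultimately show ?thesis unfolding Aut_complex_def by (simp add: Bij_def K_vertices sh_eq)
qed

lemma Aut_preserves_triangle_pattern:
  assumes f: "f \<in> carrier (Aut_complex K)"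
  shows "f (pt (x + (2 * q - 1))) = pt (f (pt x) + (2 * q - 1))" "f (pt (x + q)) = pt (f (pt x) + q)"
proof -
  have bij: "bij_betw f {0..<n} {0..<n}" and fK: "(`) f ` K = K"
    using f by (auto simp: Aut_complex_def Bij_def K_vertices)
  note inj = bij_betw_imp_inj_on[OF bij]
  have V: "pt y \<in> {0..<n}" "f (pt y) \<in> {0..<n}" for y
    using pt_range bij_betwE[OF bij] by auto
  have K_f: "f ` \<sigma> \<in> K \<longleftrightarrow> \<sigma> \<in> K" if "\<sigma> \<subseteq> {0..<n}" for \<sigma>
  proof
    assume "f ` \<sigma> \<in> K"
    then obtain \<tau> where "\<tau> \<in> K" "f ` \<sigma> = f ` \<tau>" using fK by blast
    moreover have "\<tau> \<subseteq> {0..<n}" using \<open>\<tau> \<in> K\<close> K_vertices by blast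
    ultimately show "\<sigma> \<in> K" using inj_on_image_eq_iff[OF inj that] by blast
  qed (use fK in blast)
  have card_link_f: "card (link (f u) (f v)) = card (link u v)" if "u \<in> {0..<n}" "v \<in> {0..<n}" for u v
    using link_image[OF inj _ K_f that] bij card_image[OF inj_on_subset[OF inj link_subset]]
    by (simp add: bij_betw_def)
  \<comment> \<open>\<open>d y\<close> is the displacement from the image of x to the image of x +
    y. Degrees are preserved, so \<open>d y\<close> has the degree of y; the aim is
    \<open>d y = y\<close> for y = 2q - 1 and y = q.\<close>
  define d where "d y = pt (f (pt (x + y)) - f (pt x))" for y
  have fd: "f (pt (x + y)) = pt (f (pt x) + d y)" for y
    unfolding d_def pt_pt using V pt_id[of "f (pt (x + y))"] by simp
  have d_pos: "0 < d y" "d y < n" if "0 < y" "y < n" for y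
  proof -
    have "pt (x + y) \<noteq> pt x" using pt_inj[of "x + y" x] that by auto
    then have "f (pt (x + y)) \<noteq> f (pt x)" using inj_onD[OF inj _ V(1) V(1)] by blast
    then have "d y \<noteq> 0" using fd[of y] V(2)[of x] pt_id[of "f (pt x)"] by auto
    then show "0 < d y" "d y < n" using pt_range[of "f (pt (x + y)) - f (pt x)"] by (auto simp: d_def)
  qed
  have card_d: "card (link_diffs (d y)) = card (link_diffs y)" if "0 < y" "y < n" for y
  proof -
    have "card (link_diffs (d y)) = card (link (f (pt x)) (f (pt (x + y))))"
      unfolding fd[of y] using card_link[OF V(2) d_pos[OF that]] by simp
    also have "\<dots> = card (link (pt x) (pt (pt x + y)))" using card_link_f V by (simp add: pt_pt)
    also have "\<dots> = card (link_diffs y)" using card_link[OF V(1) that] .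
    finally show ?thesis .
  qed
  have b: "0 < 2 * q - 1" "2 * q - 1 < n" "0 < q" "q < n" using q_ge_3 r_nonneg by (simp_all add: n_def)
  have "q \<in> link_diffs (2 * q - 1)" by (simp add: link_diffs_2q_minus_1)
  have "vtri x q (q - 1) \<in> K" by (rule vtri_cyc_in_K[OF tri_cyc_q(2)])
  moreover have "vtri x q (q - 1) \<subseteq> {0..<n}" using V(1) by (simp add: vtri_def)
  ultimately have "f ` vtri x q (q - 1) \<in> K" using K_f by blast
  then have "{f (pt x), f (pt (x + q)), f (pt (x + (2 * q - 1)))} \<in> K" by (simp add: vtri_def algebra_simps)
  moreover have "f (pt (x + q)) \<noteq> f (pt x)" "f (pt (x + q)) \<noteq> f (pt (x + (2 * q - 1)))"
    using inj_onD[OF inj _ V(1) V(1)] pt_inj[of "x + q" x] pt_inj[of "x + q" "x + (2 * q - 1)"] b q_ge_3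
    by auto
  ultimately have lnk: "f (pt (x + q)) \<in> link (f (pt x)) (f (pt (x + (2 * q - 1))))"
    unfolding link_def by (auto simp: insert_commute)
  \<comment> \<open>\<open>?g\<close> carries 0 to \<open>f (pt x)\<close>, so the link of the image
    edge can be pulled back to the vertex 0, where \<open>link_zero\<close> describes it.\<close>
  let ?g = "\<lambda>v. pt (v + f (pt x))"
  have "link (?g 0) (?g (d (2 * q - 1))) = ?g ` link 0 (d (2 * q - 1))"
    by (rule link_image) (use pt_shift_bij[of "f (pt x)"] K_shift_iff d_pos[OF b(1,2)] n_gt_0 in
        \<open>auto simp: bij_betw_def\<close>)
  moreover have "?g 0 = f (pt x)" "?g (d y) = f (pt (x + y))" for y
    using fd[of y] pt_id V(2)[of x] by (simp_all add: add.commute)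
  ultimately have "?g (d q) \<in> ?g ` link_diffs (d (2 * q - 1))"
    using lnk link_zero[OF d_pos[OF b(1,2)]] by simp
  then obtain w where w: "w \<in> link_diffs (d (2 * q - 1))" "?g (d q) = ?g w" by auto
  then have "d q = w"
    using inj_onD[OF bij_betw_imp_inj_on[OF pt_shift_bij] w(2)] d_pos[OF b(3,4)]
    by (auto simp: link_diffs_def)
  with w have "d q \<in> link_diffs (d (2 * q - 1))" by simp
  from link_diffs_degrees_3_5[OF this d_pos[OF b(1,2)]]
  have "d (2 * q - 1) = 2 * q - 1" "d q = q"
    using card_d[OF b(1,2)] card_d[OF b(3,4)] card_link_diffs_2q_minus_1 card_link_diffs_q by simp_all
  then show "f (pt (x + (2 * q - 1))) = pt (f (pt x) + (2 * q - 1))" "f (pt (x + q)) = pt (f (pt x) + q)"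
    using fd[of "2 * q - 1"] fd[of q] by simp_all
qed

lemma Aut_eq_shift:
  assumes f: "f \<in> carrier (Aut_complex K)"
  shows "f = sh (f 0)"
proof -
  note P = Aut_preserves_triangle_pattern[OF f]
  have step: "f (pt (x + 1)) = pt (f (pt x) + 1)" for x
  proof -
    \<comment> \<open>From y, two steps of q lead to x + 1 and one step of 2q - 1 leads to
      x.\<close>
    define y where "y = x - (2 * q - 1)"
    have "f (pt (x + 1)) = f (pt (y + q + q))" by (simp add: y_def)
    also have "\<dots> = pt (f (pt y) + 2 * q)" by (simp only: P(2) pt_pt) (simp add: algebra_simps)
    also have "\<dots> = pt (f (pt (y + (2 * q - 1))) + 1)" by (simp only: P(1) pt_pt) (simp add: algebra_simps)
    finally show ?thesis by (simp add: y_def)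
  qed
  have "f (pt (int i)) = pt (int i + f 0)" for i
  proof (induction i)
    case 0
    have "f \<in> Bij {0..<n}" using f by (simp add: Aut_complex_def K_vertices)
    then have "f 0 \<in> {0..<n}" using n_gt_0 by (auto simp: Bij_def dest: bij_betwE)
    then show ?case by (simp add: pt_id n_gt_0)
  next
    case (Suc i)
    then show ?case using step[of "int i"] by (simp add: pt_pt algebra_simps)
  qed
  from this[of "nat _"] have val: "f v = pt (v + f 0)" if "v \<in> {0..<n}" for v
    using that pt_id[of v] by (metis atLeastLessThan_iff nat_0_le)
  show ?thesis
  proof (rule extensionalityI[of _ "{0..<n}"])
    show "f \<in> extensional {0..<n}" using f by (simp add: Aut_complex_def Bij_def K_vertices)
    show "sh (f 0) \<in> extensional {0..<n}" by (simp add: sh_eq)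
    show "f v = sh (f 0) v" if "v \<in> {0..<n}" for v
      unfolding val[OF that] sh_eq using that by simp
  qed
qed

lemma sh_zero: "0 \<le> g \<Longrightarrow> g < n \<Longrightarrow> sh g 0 = g"
  by (simp add: sh_eq pt_id n_gt_0)

lemma sh_mult: "sh g \<otimes>\<^bsub>Aut_complex K\<^esub> sh h = sh (g + h)"
proof -
  have "sh g \<in> Bij {0..<n}" "sh h \<in> Bij {0..<n}"
    using sh_Aut[of g] sh_Aut[of h] by (simp_all add: Aut_complex_def K_vertices)
  then have "sh g \<otimes>\<^bsub>Aut_complex K\<^esub> sh h = compose {0..<n} (sh g) (sh h)"
    by (simp add: Aut_complex_def BijGroup_def K_vertices)
  also have "\<dots> = sh (g + h)"
    unfolding compose_def sh_eq using pt_range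
    by (intro ext) (auto simp: pt_pt algebra_simps)
  finally show ?thesis .
qed

lemma sh_pt: "sh (pt g) = sh g"
  by (simp add: sh_eq pt_pt)

lemma carrier_Aut: "carrier (Aut_complex K) = sh ` {0..<n}"
proof
  show "sh ` {0..<n} \<subseteq> carrier (Aut_complex K)" using sh_Aut by blast
  show "carrier (Aut_complex K) \<subseteq> sh ` {0..<n}"
  proof
    fix f assume f: "f \<in> carrier (Aut_complex K)"
    then have "bij_betw f {0..<n} {0..<n}" by (simp add: Aut_complex_def Bij_def K_vertices)
    then have "f 0 \<in> {0..<n}" using n_gt_0 by (auto dest: bij_betwE)
    with Aut_eq_shift[OF f] show "f \<in> sh ` {0..<n}" by blast
  qed
qed

lemma sh_inj: "inj_on sh {0..<n}"
  by (rule inj_onI) (metis atLeastLessThan_iff sh_zero)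

lemma sh_iso: "sh \<in> iso (integer_mod_group (nat n)) (Aut_complex K)"
proof (rule isoI)
  have c: "carrier (integer_mod_group (nat n)) = {0..<n}"
    using n_gt_0 by (simp add: carrier_integer_mod_group)
  show "sh \<in> hom (integer_mod_group (nat n)) (Aut_complex K)"
  proof (rule homI)
    fix g h
    show "sh (g \<otimes>\<^bsub>integer_mod_group (nat n)\<^esub> h) = sh g \<otimes>\<^bsub>Aut_complex K\<^esub> sh h"
      using sh_pt[of "g + h"] n_gt_0 by (simp add: sh_mult mult_integer_mod_group pt_def)
  qed (rule sh_Aut)
  show "bij_betw sh (carrier (integer_mod_group (nat n))) (carrier (Aut_complex K))"
    unfolding c carrier_Aut using sh_inj by (simp add: bij_betw_def)
qed

lemma Aut_generate: "carrier (Aut_complex K) = generate (Aut_complex K) {sh 1}"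
proof
  interpret A: group "Aut_complex K" by (rule group_Aut_complex)
  show "generate (Aut_complex K) {sh 1} \<subseteq> carrier (Aut_complex K)"
    using A.generate_incl[of "{sh 1}"] sh_Aut by simp
  have "sh (1 + int i) \<in> generate (Aut_complex K) {sh 1}" for i
  proof (induction i)
    case 0
    then show ?case by (simp add: generate.incl)
  next
    case (Suc i)
    have "sh (1 + int (Suc i)) = sh 1 \<otimes>\<^bsub>Aut_complex K\<^esub> sh (1 + int i)" by (simp add: sh_mult)
    then show ?case using generate.eng[OF generate.incl[OF singletonI] Suc] by simp
  qed
  from this[of "nat _"] have gen: "sh g \<in> generate (Aut_complex K) {sh 1}" if "0 < g" for g
    using that by (metis add.commute diff_add_cancel nat_0_le zle_diff1_eq)
  \<comment> \<open>Adding n makes the shift amount positive, so the identity is reached as the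
    shift by n.\<close>
  have "sh g \<in> generate (Aut_complex K) {sh 1}" if "0 \<le> g" for g
    using gen[of "g + n"] that n_gt_0 sh_pt[of "g + n"] sh_pt[of g] pt_period[of g] by simp
  then show "carrier (Aut_complex K) \<subseteq> generate (Aut_complex K) {sh 1}"
    unfolding carrier_Aut by auto
qed

end

section \<open>Loops modulo boundaries\<close>

lemma simp_boundary_0 [simp]: "simp_boundary p 0 = 0"
  by (simp add: simp_boundary_def)

lemma simp_boundary_diff: "simp_boundary p (a - b) = simp_boundary p a - simp_boundary p b"
  by (simp add: simp_boundary_def frag_extend_diff)

lemma simp_boundary_add: "simp_boundary p (a + b) = simp_boundary p a + simp_boundary p b"
  by (simp add: simp_boundary_def frag_extend_add)

lemma simp_boundary_minus: "simp_boundary p (- a) = - simp_boundary p a"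
  by (simp add: simp_boundary_def frag_extend_minus)

lemma carrier_simp_chain_group: "carrier (simp_chain_group p K) = {c. Poly_Mapping.keys c \<subseteq> {\<sigma> \<in> K. card \<sigma> = Suc p}}"
  by (auto simp: simp_chain_group_def)

text \<open>Generators are sets oriented by the vertex order, which a shift modulo n disturbs. The
  signed edge [a, b] is independent of that order and natural under vertex maps; the value 0 for a =
  b covers degenerate images.\<close>

definition oedge :: "'a::linorder \<Rightarrow> 'a \<Rightarrow> 'a set \<Rightarrow>\<^sub>0 int" where
  "oedge a b = (if a < b then frag_of {a, b} else if b < a then - frag_of {a, b} else 0)"

lemma oedge_commute: "oedge b a = - oedge a b"
  by (auto simp: oedge_def insert_commute)

lemma oedge_self [simp]: "oedge a a = 0"
  by (simp add: oedge_def)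

lemma simp_boundary_oedge:
  "simp_boundary 1 (oedge a b) = frag_of {b} - frag_of {a}" if "a \<noteq> b" for a b :: "'a::linorder"
proof -
  have *: "simp_boundary 1 (frag_of {a, b}) = frag_of {b} - frag_of {a}" if "a < b" for a b :: 'a
  proof -
    have "{u. (u = a \<or> u = b) \<and> u < a} = {}" "{u. (u = a \<or> u = b) \<and> u < b} = {a}"
      "{a, b} - {a} = {b}" "{a, b} - {b} = {a}"
      using that by auto
    note * = this
    show ?thesis using that by (simp add: simp_boundary_def *)
  qed
  show ?thesis
    using that *[of a b] *[of b a]
    by (cases "a < b") (auto simp: oedge_def simp_boundary_minus insert_commute simp del: One_nat_def)
qed

lemma simp_boundary_oedge': "simp_boundary 1 (oedge a b) = frag_of {b} - frag_of {a}"
  for a b :: "'a::linorder"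
  by (cases "a = b") (simp_all add: simp_boundary_oedge del: One_nat_def)

text \<open>The sign depends on the order of the vertices. It is left open because the boundaries
  form a group, closed under negation.\<close>

lemma simp_boundary_triangle:
  fixes a b c :: "'a::linorder"
  assumes "a \<noteq> b" "b \<noteq> c" "a \<noteq> c"
  shows "simp_boundary 2 (frag_of {a, b, c}) = oedge a b + oedge b c + oedge c a \<or>
         simp_boundary 2 (frag_of {a, b, c}) = - (oedge a b + oedge b c + oedge c a)"
proof -
  have *: "simp_boundary 2 (frag_of {a, b, c}) = oedge a b + oedge b c + oedge c a"
    if "a < b" "b < c" for a b c :: 'a
  proof -
    have "{u. (u = a \<or> u = b \<or> u = c) \<and> u < a} = {}" "{u. (u = a \<or> u = b \<or> u = c) \<and> u < b} = {a}"
      "{u. (u = a \<or> u = b \<or> u = c) \<and> u < c} = {a, b}"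
      "{a, b, c} - {a} = {b, c}" "{a, b, c} - {b} = {a, c}" "{a, b, c} - {c} = {a, b}"
      using that by auto
    note * = this
    have ne: "a \<noteq> b" "a \<noteq> c" "b \<noteq> c" "a < c" "\<not> c < a" using that by auto
    have "simp_boundary 2 (frag_of {a, b, c}) =
        (\<Sum>v\<in>{a, b, c}. frag_cmul ((-1) ^ card {u. (u = a \<or> u = b \<or> u = c) \<and> u < v}) (frag_of ({a, b, c} - {v})))"
      by (simp add: simp_boundary_def)
    also have "\<dots> = frag_of {b, c} - frag_of {a, c} + frag_of {a, b}"
      using ne by (simp add: *)
    finally show ?thesis using that ne by (simp add: oedge_def insert_commute)
  qed
  consider "a < b" "b < c" | "a < c" "c < b" | "b < a" "a < c" | "b < c" "c < a" | "c < a" "a < b" | "c < b" "b < a"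
    using assms by (meson linorder_neqE)
  then show ?thesis
  proof cases
    case 1 from *[OF this] show ?thesis by simp
  next
    case 2 from *[OF this] show ?thesis
      by (simp add: insert_commute oedge_commute[of b a] oedge_commute[of c a] oedge_commute[of c b])
  next
    case 3 from *[OF this] show ?thesis
      by (simp add: insert_commute oedge_commute[of b a] oedge_commute[of c a] oedge_commute[of c b])
  next
    case 4 from *[OF this] show ?thesis
      by (simp add: insert_commute oedge_commute[of b a] oedge_commute[of c a] oedge_commute[of c b])
  next
    case 5 from *[OF this] show ?thesis
      by (simp add: insert_commute oedge_commute[of b a] oedge_commute[of c a] oedge_commute[of c b])
  next
    case 6 from *[OF this] show ?thesis
      by (simp add: insert_commute oedge_commute[of b a] oedge_commute[of c a] oedge_commute[of c b])
  qed
qed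

lemma simp_chain_map_diff: "simp_chain_map f (a - b) = simp_chain_map f a - simp_chain_map f b"
  by (simp add: simp_chain_map_def frag_extend_diff)

lemma simp_chain_map_add: "simp_chain_map f (a + b) = simp_chain_map f a + simp_chain_map f b"
  by (simp add: simp_chain_map_def frag_extend_add)

lemma simp_chain_map_minus: "simp_chain_map f (- a) = - simp_chain_map f a"
  by (simp add: simp_chain_map_def frag_extend_minus)

lemma simp_chain_map_0 [simp]: "simp_chain_map f 0 = 0"
  by (simp add: simp_chain_map_def)

text \<open>No injectivity is asked for: if f identifies a and b, both sides are 0.\<close>

lemma simp_chain_map_oedge: "simp_chain_map f (oedge a b) = oedge (f a) (f b)"
  for a b :: "'a::linorder" and f :: "'a \<Rightarrow> 'b::linorder"
proof -
  have *: "simp_chain_map f (frag_of {a, b}) = oedge (f a) (f b)" if "a < b" for a b :: 'a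
  proof -
    have "{(u, v). u \<in> {a, b} \<and> v \<in> {a, b} \<and> u < v \<and> f v < f u} = (if f b < f a then {(a, b)} else {})"
      using that by auto
    then show ?thesis using that by (auto simp: simp_chain_map_def oedge_def)
  qed
  show ?thesis
    using *[of a b] *[of b a] oedge_commute[of "f a" "f b"]
    by (cases a b rule: linorder_cases) (auto simp: oedge_def[of a b] simp_chain_map_minus insert_commute)
qed

lemma simp_boundaries_zero: "0 \<in> simp_boundaries p K"
  unfolding simp_boundaries_def by (rule image_eqI[of _ _ 0]) (simp_all add: carrier_simp_chain_group)

lemma simp_boundaries_diff: "a \<in> simp_boundaries p K \<Longrightarrow> b \<in> simp_boundaries p K \<Longrightarrow> a - b \<in> simp_boundaries p K"
  unfolding simp_boundaries_def
proof (elim imageE)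
  fix x y assume xy: "x \<in> carrier (simp_chain_group (Suc p) K)" "y \<in> carrier (simp_chain_group (Suc p) K)"
    and ab: "a = simp_boundary (Suc p) x" "b = simp_boundary (Suc p) y"
  have "x - y \<in> carrier (simp_chain_group (Suc p) K)"
    using xy keys_diff[of x y] by (auto simp: carrier_simp_chain_group)
  then show "a - b \<in> simp_boundary (Suc p) ` carrier (simp_chain_group (Suc p) K)"
    unfolding ab simp_boundary_diff[symmetric] by (rule imageI)
qed

context brieskorn begin

text \<open>The relation is used for arbitrary 1-chains, in particular for edges and paths, which
  are not cycles.\<close>

definition homologous :: "(int set \<Rightarrow>\<^sub>0 int) \<Rightarrow> (int set \<Rightarrow>\<^sub>0 int) \<Rightarrow> bool" (infix "\<simeq>" 50) where
  "c \<simeq> c' \<longleftrightarrow> c - c' \<in> simp_boundaries 1 K"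

lemma bd_zero: "0 \<in> simp_boundaries 1 K" and
  bd_diff: "a \<in> simp_boundaries 1 K \<Longrightarrow> b \<in> simp_boundaries 1 K \<Longrightarrow> a - b \<in> simp_boundaries 1 K"
  by (rule simp_boundaries_zero, rule simp_boundaries_diff)

lemma bd_minus: "a \<in> simp_boundaries 1 K \<Longrightarrow> - a \<in> simp_boundaries 1 K"
  using bd_diff[OF bd_zero] by simp

lemma bd_add: "a \<in> simp_boundaries 1 K \<Longrightarrow> b \<in> simp_boundaries 1 K \<Longrightarrow> a + b \<in> simp_boundaries 1 K"
  using bd_diff[of a "- b"] bd_minus[of b] by simp

lemma hom_refl: "c \<simeq> c" by (simp add: homologous_def bd_zero del: One_nat_def)

lemma hom_sym: "c \<simeq> d \<Longrightarrow> d \<simeq> c" unfolding homologous_def using bd_minus by force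

lemma hom_trans [trans]: "c \<simeq> d \<Longrightarrow> d \<simeq> e \<Longrightarrow> c \<simeq> e"
  unfolding homologous_def using bd_add[of "c - d" "d - e"] by simp

lemma hom_add: "c \<simeq> d \<Longrightarrow> c' \<simeq> d' \<Longrightarrow> c + c' \<simeq> d + d'"
  unfolding homologous_def using bd_add[of "c - d" "c' - d'"] by (simp add: algebra_simps)

lemma hom_diff: "c \<simeq> d \<Longrightarrow> c' \<simeq> d' \<Longrightarrow> c - c' \<simeq> d - d'"
  unfolding homologous_def using bd_diff[of "c - d" "c' - d'"] by (simp add: algebra_simps)

lemma hom_minus: "c \<simeq> d \<Longrightarrow> - c \<simeq> - d"
  using hom_diff[OF hom_refl[of 0]] by simp

lemma hom_sum: "(\<And>i. i \<in> I \<Longrightarrow> f i \<simeq> g i) \<Longrightarrow> sum f I \<simeq> sum g I"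
  by (induction I rule: infinite_finite_induct) (simp_all add: hom_refl hom_add)

definition E :: "int \<Rightarrow> int \<Rightarrow> int set \<Rightarrow>\<^sub>0 int" where
  "E x y = oedge (pt x) (pt y)"

lemma E_commute: "E y x = - E x y" unfolding E_def by (rule oedge_commute)

lemma triangle_homologous:
  assumes "tri_cyc a b"
  shows "E x (x + a) + E (x + a) (x + a + b) \<simeq> E x (x + a + b)"
proof -
  let ?\<sigma> = "{pt x, pt (x + a), pt (x + a + b)}"
  have \<sigma>: "?\<sigma> \<in> K" "card ?\<sigma> = 3"
    using vtri_cyc_in_K[OF assms] vtri_card[OF assms] by (simp_all add: vtri_def)
  then have ne: "pt x \<noteq> pt (x + a)" "pt (x + a) \<noteq> pt (x + a + b)" "pt x \<noteq> pt (x + a + b)"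
    by (auto simp: card_insert_if split: if_splits)
  have "simp_boundary 2 (frag_of ?\<sigma>) \<in> simp_boundaries 1 K"
    unfolding simp_boundaries_def numeral_2_eq_2 using \<sigma> by (auto simp: carrier_simp_chain_group numeral_3_eq_3)
  moreover have "E x (x + a) + E (x + a) (x + a + b) - E x (x + a + b) =
      oedge (pt x) (pt (x + a)) + oedge (pt (x + a)) (pt (x + a + b)) + oedge (pt (x + a + b)) (pt x)"
    using oedge_commute[of "pt x" "pt (x + a + b)"] by (simp add: E_def)
  ultimately show ?thesis
    unfolding homologous_def using simp_boundary_triangle[OF ne] by (metis bd_minus minus_minus)
qed

section \<open>Paths and loops along the cycle 0, 1, ..., n - 1\<close>

definition path :: "int \<Rightarrow> int \<Rightarrow> int set \<Rightarrow>\<^sub>0 int" where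
  "path x d = (\<Sum>j<nat d. E (x + int j) (x + int j + 1))"

lemma path_add:
  assumes "0 \<le> a" "0 \<le> b"
  shows "path x (a + b) = path x a + path (x + a) b"
proof -
  have "path x (int i + int j) = path x (int i) + path (x + int i) (int j)" for i j
    by (induction j) (simp_all add: path_def add.assoc nat_add_distrib)
  from this[of "nat a" "nat b"] show ?thesis using assms by simp
qed

lemma path_1: "path x 1 = E x (x + 1)" and path_0: "path x 0 = 0"
  by (simp_all add: path_def)

text \<open>In module terms: t^x (1 + t + ... + t^(d-1)) e minus the class of the edge [x, x + d].
  For d = 2 this is t^x u.\<close>

definition loop :: "int \<Rightarrow> int \<Rightarrow> int set \<Rightarrow>\<^sub>0 int" where
  "loop x d = path x d - E x (x + d)"

lemma loop_1: "loop x 1 = 0" by (simp add: loop_def path_1)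

text \<open>Paths add up exactly, and the triangle exchanges two of its edges for the third. Each
  triangle orbit thus becomes one additive relation between loops.\<close>

lemma loop_add:
  assumes "tri_cyc a b"
  shows "loop x (a + b) \<simeq> loop x a + loop (x + a) b"
proof -
  have "path x (a + b) = path x a + path (x + a) b"
    using tri_cyc_pos[OF assms] by (intro path_add) auto
  then show ?thesis
    using triangle_homologous[OF assms, of x]
    by (simp add: homologous_def loop_def algebra_simps)
qed

definition h :: nat where "h = nat (q div 2)"

lemma q_h: "q = 2 * int h + 1" and h_pos: "1 \<le> h"
  using odd_q q_ge_3 by (auto simp: h_def elim!: oddE)

abbreviation u :: "int \<Rightarrow> int set \<Rightarrow>\<^sub>0 int" where "u y \<equiv> loop y 2"

definition usum :: "int \<Rightarrow> nat \<Rightarrow> int set \<Rightarrow>\<^sub>0 int" where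
  "usum x j = (\<Sum>i<j. u (x + 2 * int i))"

lemma usum_Suc: "usum x (Suc j) = usum x j + u (x + 2 * int j)"
  and usum_Suc_shift: "usum x (Suc j) = u x + usum (x + 2) j"
  unfolding usum_def by simp (simp add: sum.lessThan_Suc_shift algebra_simps del: sum.lessThan_Suc)

text \<open>The triangles with differences 2j and 2 split off one loop \<open>u\<close> at a time.
  The bound j \<le> h lets the length reach 2h + 2 = q + 1.\<close>

lemma loop_even: "j \<le> h \<Longrightarrow> loop x (2 * int (Suc j)) \<simeq> usum x (Suc j)"
proof (induction j)
  case 0
  then show ?case by (simp add: usum_def hom_refl)
next
  case (Suc j)
  have "tri_cyc (2 * int (Suc j)) 2" using Suc.prems q_h by (intro tri_cyc_2) auto
  from loop_add[OF this, of x]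
  have "loop x (2 * int (Suc (Suc j))) \<simeq> loop x (2 * int (Suc j)) + u (x + 2 * int (Suc j))"
    by (simp add: algebra_simps)
  also have "\<dots> \<simeq> usum x (Suc (Suc j))"
    unfolding usum_Suc[of x "Suc j"] using Suc by (intro hom_add hom_refl) simp
  finally show ?case .
qed

lemma loop_q_minus_1: "loop x (q - 1) \<simeq> usum x h"
  using loop_even[of "h - 1" x] h_pos q_h by (cases h) auto

lemma loop_q: "loop x q \<simeq> usum x h"
  using hom_trans[OF loop_add[OF tri_cyc_q(4), of x]] loop_q_minus_1[of x] by (simp add: loop_1)

text \<open>The loop of length q + 1 is evaluated twice: through the triangle with differences 1 and
  q, and through the even differences. Comparing the results gives \<open>usum_relation\<close>, the
  alternating relation with its even powers of t on one side and its odd powers on the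
  other.\<close>

lemma loop_q_plus_1: "loop x (q + 1) \<simeq> usum (x + 1) h" "loop x (q + 1) \<simeq> usum x (Suc h)"
proof -
  have "loop x (1 + q) \<simeq> loop x 1 + loop (x + 1) q" by (rule loop_add[OF tri_cyc_q(1)])
  also have "\<dots> = loop (x + 1) q" by (simp add: loop_1)
  also have "\<dots> \<simeq> usum (x + 1) h" by (rule loop_q)
  finally show "loop x (q + 1) \<simeq> usum (x + 1) h" by (simp add: add.commute)
  have "q + 1 = 2 * int (Suc h)" using q_h by simp
  then show "loop x (q + 1) \<simeq> usum x (Suc h)" using loop_even[of h x] by (simp only:)
qed

lemma usum_relation: "usum x (Suc h) \<simeq> usum (x + 1) h"
  using hom_trans[OF hom_sym loop_q_plus_1(1)] loop_q_plus_1(2) by blast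

text \<open>Adding \<open>usum_relation\<close> at \<open>x\<close> and at \<open>x + 1\<close> cancels everything except the two outer terms.\<close>

lemma u_antiperiodic: "u (x + q) \<simeq> - u x"
proof -
  have "usum (x + 1) (Suc h) + usum x (Suc h) \<simeq> usum (x + 2) h + usum (x + 1) h"
    using hom_add[OF usum_relation[of "x + 1"] usum_relation[of x]] by (simp add: algebra_simps)
  moreover have e: "x + 1 + 2 * int h = x + q" using q_h by simp
  ultimately show ?thesis
    unfolding usum_Suc[of "x + 1"] usum_Suc_shift[of x] e homologous_def
    by (simp add: algebra_simps)
qed

lemma usum_antiperiodic: "usum (x + q) j \<simeq> - usum x j"
  unfolding usum_def sum_negf[symmetric]
  using u_antiperiodic[of "x + 2 * int _"] by (intro hom_sum) (simp add: algebra_simps)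

lemma usum_cancel: "usum x j + usum (x + q) j \<simeq> 0"
  using hom_add[OF hom_refl[of "usum x j"] usum_antiperiodic[of x j]] by simp

text \<open>At length 2q - 1 the triangle with differences q and q - 1 leaves two copies of
  \<open>usum\<close> shifted by q, which cancel since t^q = -1. The triangles with differences 1
  and d carry the vanishing from d to d + 1.\<close>

lemma loop_long: "2 * q - 1 \<le> d \<Longrightarrow> d \<le> 2 * q + r + 1 \<Longrightarrow> loop x d \<simeq> 0"
proof (induction d arbitrary: x rule: int_ge_induct)
  case base
  have "loop x (q + (q - 1)) \<simeq> loop x q + loop (x + q) (q - 1)" by (rule loop_add[OF tri_cyc_q(2)])
  also have "\<dots> \<simeq> usum x h + usum (x + q) h" by (intro hom_add loop_q loop_q_minus_1)
  also have "\<dots> \<simeq> 0" by (rule usum_cancel)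
  finally show ?case by simp
next
  case (step d)
  have "loop x (1 + d) \<simeq> loop x 1 + loop (x + 1) d" using step by (intro loop_add tri_cyc_1) auto
  also have "\<dots> = loop (x + 1) d" by (simp add: loop_1)
  also have "\<dots> \<simeq> 0" using step by simp
  finally show ?case by (simp add: add.commute)
qed

text \<open>The circuit is cut at 0 and 2q. Both parts are long enough for \<open>loop_long\<close>,
  and their chords are the same edge in opposite directions.\<close>

lemma path_full: "path 0 n \<simeq> 0"
proof -
  have "path 0 n = path 0 (2 * q) + path (2 * q) (2 * q + r)"
    using path_add[of "2 * q" "2 * q + r" 0] q_ge_3 r_nonneg by (simp add: n_def)
  also have "\<dots> = loop 0 (2 * q) + loop (2 * q) (2 * q + r) + (E 0 (2 * q) + E (2 * q) n)"
    by (simp add: loop_def n_def)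
  also have "E (2 * q) n = - E 0 (2 * q)"
    using E_commute[of "2 * q" 0] pt_period[of 0] by (simp add: E_def)
  also have "loop 0 (2 * q) + loop (2 * q) (2 * q + r) + (E 0 (2 * q) + - E 0 (2 * q)) \<simeq> 0 + 0 + 0"
    using r_nonneg by (intro hom_add loop_long) (simp_all add: hom_refl)
  finally show ?thesis by simp
qed

text \<open>\<open>path 0\<close> serves as a potential on the vertices. Only the edge from n - 1 to
  0 is no extension of such a path, and there \<open>path_full\<close> closes the gap.\<close>

lemma E_1_homologous: "E x (x + 1) \<simeq> path 0 (pt (x + 1)) - path 0 (pt x)"
proof -
  define v where "v = pt x"
  have v: "0 \<le> v" "v < n" using pt_range by (simp_all add: v_def)
  have E: "E x (x + 1) = E v (v + 1)" by (simp add: E_def v_def pt_pt)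
  have p: "path 0 (v + 1) = path 0 v + E v (v + 1)" using path_add[of v 1 0] v by (simp add: path_1)
  have pt: "pt (x + 1) = pt (v + 1)" by (simp add: v_def pt_pt)
  show ?thesis
  proof (cases "v + 1 = n")
    case True
    then have "pt (x + 1) = 0" using pt_period[of 0] pt_id[of 0] n_gt_0 by (simp add: pt)
    moreover have "E v (v + 1) = path 0 n - path 0 v" using p True by simp
    moreover have "path 0 n - path 0 v \<simeq> 0 - path 0 v" by (intro hom_diff path_full hom_refl)
    ultimately show ?thesis unfolding E by (simp add: path_0 v_def)
  next
    case False
    then have "pt (x + 1) = v + 1" using v by (simp add: pt pt_id)
    then show ?thesis unfolding E using p by (simp add: v_def hom_refl)
  qed
qed

lemma path_homologous: "path x (int d) \<simeq> path 0 (pt (x + int d)) - path 0 (pt x)"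
proof (induction d)
  case 0
  then show ?case by (simp add: path_0 hom_refl)
next
  case (Suc d)
  have "path x (int (Suc d)) = path x (int d) + E (x + int d) (x + int d + 1)"
    using path_add[of "int d" 1 x] by (simp add: path_1 add.commute)
  also have "\<dots> \<simeq> (path 0 (pt (x + int d)) - path 0 (pt x)) + (path 0 (pt (x + int d + 1)) - path 0 (pt (x + int d)))"
    by (intro hom_add Suc E_1_homologous)
  also have "\<dots> = path 0 (pt (x + int (Suc d))) - path 0 (pt x)" by (simp add: algebra_simps)
  finally show ?case .
qed


section \<open>Powers of t in coordinates\<close>

text \<open>
  \<open>W y\<close> is \<open>t\<^sup>y\<close> in the ring \<open>\<int>[t] / (1 - t + t\<^sup>2 - \<dots> + t\<^bsup>q-1\<^esup>)\<close>, written in the basis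
  \<open>1, t, \<dots>, t\<^bsup>q-2\<^esup>\<close>; note that \<open>t\<^sup>q = -1\<close>.
\<close>

definition W :: "int \<Rightarrow> nat \<Rightarrow>\<^sub>0 int" where
  "W y = frag_cmul (if even (y div q) then 1 else -1)
     (if nat (y mod q) < 2 * h then frag_of (nat (y mod q))
      else (\<Sum>i<h. frag_of (2 * i + 1) - frag_of (2 * i)))"

lemma W_basis: "i < 2 * h \<Longrightarrow> W (int i) = frag_of i"
  using q_h by (simp add: W_def)

lemma W_last: "W (int (2 * h)) = (\<Sum>i<h. frag_of (2 * i + 1) - frag_of (2 * i))"
  using q_h by (simp add: W_def)

lemma W_antiperiodic: "W (y + q) = - W y"
  using q_ge_3 by (simp add: W_def)

lemma W_minus_q: "W (y - q) = - W y"
  using W_antiperiodic[of "y - q"] by simp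

lemma W_periodic: "2 * q dvd x - y \<Longrightarrow> W x = W y"
proof -
  have *: "W (z + 2 * q) = W z" for z
    using W_antiperiodic[of "z + q"] W_antiperiodic[of z] by (simp add: algebra_simps)
  have nat: "W (z + 2 * q * int i) = W z" for z i
  proof (induction i)
    case (Suc i)
    then show ?case using *[of "z + 2 * q * int i"] by (simp add: algebra_simps)
  qed simp
  assume "2 * q dvd x - y"
  then obtain k where k: "x = y + 2 * q * k" by (metis dvdE add.commute diff_eq_eq)
  show "W x = W y"
  proof (cases "0 \<le> k")
    case True
    then show ?thesis using nat[of y "nat k"] k by simp
  next
    case False
    then show ?thesis using nat[of x "nat (- k)"] k by simp
  qed
qed

text \<open>Vertices are taken modulo n and exponents modulo 2q; the two agree because 2q divides
  n.\<close>

lemma W_pt: "W (pt x + y) = W (x + y)"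
proof (rule W_periodic)
  have "2 * q dvd n" using dvd_r by (simp add: n_def)
  moreover have "n dvd pt x - x" using pt_eq_iff[of "pt x" x] by (simp add: pt_pt)
  ultimately have "2 * q dvd pt x - x" by (rule dvd_trans)
  then show "2 * q dvd pt x + y - (x + y)" by simp
qed

definition Wsum :: "int \<Rightarrow> nat \<Rightarrow> nat \<Rightarrow>\<^sub>0 int" where
  "Wsum x j = (\<Sum>i<j. W (x + 2 * int i))"

lemma Wsum_Suc: "Wsum x (Suc j) = Wsum x j + W (x + 2 * int j)"
  and Wsum_Suc_shift: "Wsum x (Suc j) = W x + Wsum (x + 2) j"
  unfolding Wsum_def by simp (simp add: sum.lessThan_Suc_shift algebra_simps del: sum.lessThan_Suc)

lemma Wsum_antiperiodic: "Wsum (x + q) j = - Wsum x j"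
proof -
  have "W (x + q + 2 * int i) = - W (x + 2 * int i)" for i
    using W_antiperiodic[of "x + 2 * int i"] by (simp add: algebra_simps)
  then show ?thesis by (simp add: Wsum_def sum_negf)
qed

lemma Wsum_pt: "Wsum (pt x) j = Wsum x j"
  by (simp add: Wsum_def W_pt)

text \<open>At x = 0 the equation holds by the choice of \<open>W\<close> at the exponent q - 1 =
  2h. Antiperiodicity moves it from x to x + 1 and to x - 1: the term leaving at one end returns at
  the other with opposite sign.\<close>

lemma Wsum_relation: "Wsum x (Suc h) = Wsum (x + 1) h"
proof (induction x rule: int_induct[where k = 0])
  case base
  have "Wsum 0 (Suc h) = (\<Sum>i<h. W (int (2 * i))) + W (int (2 * h))"
    by (simp add: Wsum_def)
  also have "\<dots> = (\<Sum>i<h. frag_of (2 * i)) + (\<Sum>i<h. frag_of (2 * i + 1) - frag_of (2 * i))"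
    unfolding W_last by (intro arg_cong2[of _ _ _ _ "(+)"] sum.cong refl W_basis) simp
  also have "\<dots> = (\<Sum>i<h. W (int (2 * i + 1)))"
    unfolding sum.distrib[symmetric] by (intro sum.cong refl, subst W_basis) auto
  also have "\<dots> = Wsum (0 + 1) h" by (simp add: Wsum_def add.commute)
  finally show ?case .
next
  case (step1 x)
  have "x + 1 + 2 * int h = x + q" using q_h by simp
  then have "Wsum (x + 1) (Suc h) = Wsum (x + 1) h - W x"
    by (simp only: Wsum_Suc[of "x + 1"] W_antiperiodic) simp
  also have "\<dots> = Wsum (x + 2) h" using step1(2) Wsum_Suc_shift[of x h] by (metis add_diff_cancel_left')
  finally show ?case by (simp add: add.assoc)
next
  case (step2 x)
  have "x + 2 * int h = x - 1 + q" using q_h by simp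
  then have "Wsum x (Suc h) = Wsum x h - W (x - 1)"
    by (simp only: Wsum_Suc[of x] W_antiperiodic) simp
  then show ?case using step2(2) Wsum_Suc_shift[of "x - 1" h] by (simp add: algebra_simps)
qed

definition U :: "(nat \<Rightarrow>\<^sub>0 int) \<Rightarrow> int set \<Rightarrow>\<^sub>0 int" where
  "U = frag_extend (\<lambda>i. u (int i))"

lemma U_add: "U (a + b) = U a + U b" and U_diff: "U (a - b) = U a - U b"
  and U_minus: "U (- a) = - U a" and U_0: "U 0 = 0" and U_of: "U (frag_of i) = u (int i)"
  and U_cmul: "U (frag_cmul c a) = frag_cmul c (U a)"
  by (simp_all add: U_def frag_extend_add frag_extend_diff frag_extend_minus frag_extend_cmul)

lemma U_sum: "U (sum f I) = (\<Sum>i\<in>I. U (f i))"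
  by (induction I rule: infinite_finite_induct) (simp_all add: U_0 U_add)

text \<open>Both sides change sign up to homology under y |-> y + q, so 0 \<le> y < q suffices.
  There only y = q - 1 is not a basis exponent, and that case is \<open>usum_relation\<close> at
  0.\<close>

lemma U_W: "U (W y) \<simeq> u y"
proof -
  have small: "U (W (int i)) \<simeq> u (int i)" if i: "i < 2 * h + 1" for i
  proof (cases "i < 2 * h")
    case True
    then show ?thesis by (simp add: W_basis U_of hom_refl)
  next
    case False
    then have "i = 2 * h" using i by simp
    have "u (int (2 * h)) = usum 0 (Suc h) - usum 0 h" by (simp add: usum_Suc)
    also have "\<dots> \<simeq> usum (0 + 1) h - usum 0 h" by (intro hom_diff usum_relation hom_refl)
    also have "\<dots> = U (W (int (2 * h)))"
      unfolding W_last by (simp add: U_sum U_diff U_of usum_def sum_subtractf add.commute)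
    finally show ?thesis using \<open>i = 2 * h\<close> hom_sym by simp
  qed
  have shift: "U (W (y + q)) \<simeq> u (y + q) \<longleftrightarrow> U (W y) \<simeq> u y" for y
  proof
    assume "U (W y) \<simeq> u y"
    then have "U (W (y + q)) \<simeq> - u y" by (simp add: W_antiperiodic U_minus hom_minus)
    then show "U (W (y + q)) \<simeq> u (y + q)" using hom_trans hom_sym u_antiperiodic by blast
  next
    assume "U (W (y + q)) \<simeq> u (y + q)"
    then have "- U (W (y + q)) \<simeq> - u (y + q)" by (rule hom_minus)
    then have "U (W y) \<simeq> - u (y + q)" by (simp add: W_antiperiodic U_minus)
    also have "\<dots> \<simeq> - (- u y)" by (intro hom_minus u_antiperiodic)
    finally show "U (W y) \<simeq> u y" by simp
  qed
  have "U (W (y mod q + q * k)) \<simeq> u (y mod q + q * k)" for k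
  proof (induction k rule: int_induct[where k = 0])
    case base
    have "nat (y mod q) < 2 * h + 1" using q_h q_ge_3 pos_mod_bound[of q y] by linarith
    then show ?case using small[of "nat (y mod q)"] q_ge_3 by simp
  next
    case (step1 k)
    then show ?case using shift[of "y mod q + q * k"] by (simp add: algebra_simps)
  next
    case (step2 k)
    then show ?case using shift[of "y mod q + q * (k - 1)"] by (simp add: algebra_simps)
  qed
  from this[of "y div q"] show ?thesis by simp
qed

lemma U_Wsum: "U (Wsum x j) \<simeq> usum x j"
  unfolding Wsum_def usum_def U_sum by (intro hom_sum U_W)

text \<open>
  The class of \<open>loop x d\<close> in the coordinates of the loops \<open>u 0, \<dots>, u (q - 2)\<close>.
\<close>

definition loop_coords :: "int \<Rightarrow> int \<Rightarrow> nat \<Rightarrow>\<^sub>0 int" where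
  "loop_coords x d = (if even d \<and> d \<le> q + 1 then Wsum x (nat (d div 2)) else if d = q then Wsum x h else 0)"

lemma loop_coords_pt: "loop_coords (pt x) d = loop_coords x d"
  by (simp add: loop_coords_def Wsum_pt)

lemma loop_coords_simps:
  "loop_coords x 1 = 0" "loop_coords x q = Wsum x h" "loop_coords x (q - 1) = Wsum x h"
  "loop_coords x (q + 1) = Wsum x (Suc h)" "q + 1 < d \<Longrightarrow> loop_coords x d = 0"
  "even d \<Longrightarrow> d \<le> q + 1 \<Longrightarrow> loop_coords x d = Wsum x (nat (d div 2))"
  "loop_coords x 2 = W x"
proof -
  have "nat ((q - 1) div 2) = h" "nat ((q + 1) div 2) = Suc h" using q_h by simp_all
  then show "loop_coords x (q - 1) = Wsum x h" "loop_coords x (q + 1) = Wsum x (Suc h)"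
    using odd_q unfolding loop_coords_def by (simp_all only: even_diff even_add odd_one simp_thms if_True) simp_all
  show "loop_coords x 1 = 0" "loop_coords x q = Wsum x h" "q + 1 < d \<Longrightarrow> loop_coords x d = 0"
    "even d \<Longrightarrow> d \<le> q + 1 \<Longrightarrow> loop_coords x d = Wsum x (nat (d div 2))" "loop_coords x 2 = W x"
    using odd_q q_ge_3 by (auto simp: loop_coords_def Wsum_def)
qed

text \<open>This is the cocycle condition, checked on each triangle orbit; it is the reason why
  \<open>\<Psi>\<close> vanishes on boundaries.\<close>

lemma loop_coords_add:
  assumes "tri a b"
  shows "loop_coords x (a + b) = loop_coords x a + loop_coords (x + a) b"
proof -
  note S = loop_coords_simps
  have two: "loop_coords y (2 + 2 * int j) = Wsum y (Suc j)" "loop_coords y (2 * int j) = Wsum y j"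
    if "j \<le> h" for y j
    using that q_h S(6)[of "2 + 2 * int j" y] S(6)[of "2 * int j" y]
    by (simp_all add: nat_add_distrib)
  consider "a = 1" "b = q" | "a = q" "b = q - 1" | "a = q" "b = q" | "a = q - 1" "b = 1" |
    "a = q - 1" "b = q + 1" | "a = q + 1" "b = q - 1" | "a = 1" "2 * q - 1 \<le> b" |
    "a = 2" "even b" "2 \<le> b" "b \<le> q - 1" | "b = 2" "even a" "2 \<le> a" "a \<le> q - 1"
    using assms unfolding tri_def by blast
  then show ?thesis
  proof cases
    case 1
    then show ?thesis using S(4)[of x] Wsum_relation[of x] by (simp add: S add.commute)
  next
    case 2
    then show ?thesis using S(5)[of "q + (q - 1)" x] q_ge_3 by (simp add: S(2,3) Wsum_antiperiodic)
  next
    case 3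
    then show ?thesis using S(5)[of "q + q" x] q_ge_3 by (simp add: S(2) Wsum_antiperiodic)
  next
    case 4
    then show ?thesis by (simp add: S(1-3))
  next
    case 5
    have "Wsum (x + (q - 1)) (Suc h) = - Wsum x h"
      using Wsum_relation[of "x + (q - 1)"] Wsum_antiperiodic[of x h] by (simp add: algebra_simps)
    then show ?thesis using S(5)[of "q - 1 + (q + 1)" x] 5 q_ge_3 by (simp add: S(3,4))
  next
    case 6
    have "Wsum (x + (q + 1)) h = - Wsum x (Suc h)"
      using Wsum_relation[of x] Wsum_antiperiodic[of "x + 1" h] by (simp add: algebra_simps)
    then show ?thesis using S(5)[of "q + 1 + (q - 1)" x] 6 q_ge_3 by (simp add: S(3,4))
  next
    case 7
    then show ?thesis using S(5)[of b "x + 1"] S(5)[of "1 + b" x] q_ge_3 by (simp add: S(1))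
  next
    case 8
    then obtain c where c: "b = 2 * c" by (elim evenE)
    define j where "j = nat c"
    have j: "b = 2 * int j" "j \<le> h" using 8 c q_h by (auto simp: j_def)
    then show ?thesis using 8 two[of j x] two(2)[of j "x + 2"] by (simp add: S(7) Wsum_Suc_shift)
  next
    case 9
    then obtain c where c: "a = 2 * c" by (elim evenE)
    define j where "j = nat c"
    have j: "a = 2 * int j" "j \<le> h" using 9 c q_h by (auto simp: j_def)
    then show ?thesis using 9 two[of j x] by (simp add: S(7) Wsum_Suc add.commute)
  qed
qed

lemma loop_homologous:
  assumes "edge_diff d"
  shows "loop x d \<simeq> U (loop_coords x d)"
proof -
  consider "d = 1" | "d = q" | j where "d = 2 * int (Suc j)" "j \<le> h" | "2 * q - 1 \<le> d" "d \<le> 2 * q + r + 1"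
  proof -
    have "\<exists>j. d = 2 * int (Suc j) \<and> j \<le> h" if even: "even d" "2 \<le> d" "d \<le> q + 1"
    proof -
      obtain c where "d = 2 * c" using even(1) by (elim evenE)
      then show ?thesis using even q_h by (intro exI[of _ "nat (c - 1)"]) auto
    qed
    then show ?thesis using assms that unfolding edge_diff_def by blast
  qed
  then show ?thesis
  proof cases
    case 1
    then show ?thesis by (simp add: loop_1 loop_coords_simps(1) U_0 hom_refl)
  next
    case 2
    then show ?thesis using hom_trans[OF loop_q hom_sym[OF U_Wsum]] by (simp add: loop_coords_simps(2))
  next
    case (3 j)
    have "d \<le> q + 1" using 3 q_h by simp
    then have "loop_coords x d = Wsum x (Suc j)"
      using 3 loop_coords_simps(6)[of d x] by (simp add: nat_add_distrib)
    then show ?thesis using 3 hom_trans[OF loop_even hom_sym[OF U_Wsum]] by simp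
  next
    case 4
    then show ?thesis using loop_long[of d x] loop_coords_simps(5)[of d x] q_ge_3 by (simp add: U_0)
  qed
qed

text \<open>A 1-cocycle with values in the coordinates.\<close>

definition edge_coords :: "int \<Rightarrow> int \<Rightarrow> nat \<Rightarrow>\<^sub>0 int" where
  "edge_coords a b = loop_coords b (pt (a - b)) - loop_coords a (pt (b - a))"

text \<open>A two-element set, as a generator, is oriented upwards, hence \<open>Min\<close> and
  \<open>Max\<close>. Antisymmetry of \<open>edge_coords\<close> makes the value on an oriented edge
  independent of that order.\<close>

definition \<Psi> :: "(int set \<Rightarrow>\<^sub>0 int) \<Rightarrow> nat \<Rightarrow>\<^sub>0 int" where
  "\<Psi> = frag_extend (\<lambda>\<sigma>. edge_coords (Min \<sigma>) (Max \<sigma>))"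

lemma \<Psi>_add: "\<Psi> (a + b) = \<Psi> a + \<Psi> b" and \<Psi>_diff: "\<Psi> (a - b) = \<Psi> a - \<Psi> b"
  and \<Psi>_minus: "\<Psi> (- a) = - \<Psi> a" and \<Psi>_0: "\<Psi> 0 = 0"
  by (simp_all add: \<Psi>_def frag_extend_add frag_extend_diff frag_extend_minus)

lemma \<Psi>_oedge: "a \<noteq> b \<Longrightarrow> \<Psi> (oedge a b) = edge_coords a b"
proof -
  have *: "\<Psi> (frag_of {a, b}) = edge_coords a b" if "a < b" for a b
    using that by (simp add: \<Psi>_def)
  assume "a \<noteq> b"
  then show ?thesis
    using *[of a b] *[of b a] by (cases "a < b") (auto simp: oedge_def \<Psi>_minus insert_commute edge_coords_def)
qed

text \<open>The bound makes n - d exceed q + 1, so the reversed reading of the edge contributes 0 to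
  \<open>edge_coords\<close>. The sign reflects that the edge enters \<open>loop\<close> negatively;
  unit edges have value 0, so \<open>loop x d\<close> itself has value
  \<open>loop_coords x d\<close>.\<close>

lemma \<Psi>_E:
  assumes "0 < d" "d < n - (q + 1)"
  shows "\<Psi> (E x (x + d)) = - loop_coords x d"
proof -
  have d: "0 < d" "d < n" using assms q_ge_3 by auto
  have ne: "pt x \<noteq> pt (x + d)" using pt_inj[of x "x + d"] d by auto
  have p: "pt (pt (x + d) - pt x) = d" "pt (pt x - pt (x + d)) = n - d"
  proof -
    have "pt (pt (x + d) - pt x) = pt d"
      by (simp add: pt_def mod_diff_eq)
    then show "pt (pt (x + d) - pt x) = d" using d by (simp add: pt_id)
    have "pt (pt x - pt (x + d)) = pt (- d)"
      by (simp add: pt_def mod_diff_eq)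
    then show "pt (pt x - pt (x + d)) = n - d" using d pt_period[of "- d"] pt_id[of "n - d"] by simp
  qed
  have "loop_coords y (n - d) = 0" for y using assms by (intro loop_coords_simps(5)) simp
  then show ?thesis using \<Psi>_oedge[OF ne] by (simp add: E_def edge_coords_def p loop_coords_pt)
qed

lemma edge_diff_short: "edge_diff d \<Longrightarrow> d < n - (q + 1)"
  using q_ge_3 r_nonneg unfolding edge_diff_def n_def by auto

text \<open>A vertex is replaced by the path from 0 to it. On the boundary of a chain this collects
  the potential terms left by \<open>path_homologous\<close>.\<close>

definition vpath :: "(int set \<Rightarrow>\<^sub>0 int) \<Rightarrow> int set \<Rightarrow>\<^sub>0 int" where
  "vpath = frag_extend (\<lambda>\<sigma>. path 0 (the_elem \<sigma>))"

lemma vpath_diff: "vpath (a - b) = vpath a - vpath b" and vpath_0: "vpath 0 = 0"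
  and vpath_of: "vpath (frag_of {v}) = path 0 v" and vpath_minus: "vpath (- a) = - vpath a"
  by (simp_all add: vpath_def frag_extend_diff frag_extend_minus)

lemma E_homologous:
  assumes "edge_diff d"
  shows "E x (x + d) \<simeq> U (\<Psi> (E x (x + d))) + vpath (simp_boundary 1 (E x (x + d)))"
proof -
  have d: "0 < d" "d < n" using edge_diff_bounds[OF assms] by auto
  have "E x (x + d) = path x d - loop x d" by (simp add: loop_def)
  also have "\<dots> \<simeq> (path 0 (pt (x + d)) - path 0 (pt x)) - U (loop_coords x d)"
    using path_homologous[of x "nat d"] d by (intro hom_diff loop_homologous assms) simp
  also have "\<dots> = U (\<Psi> (E x (x + d))) + vpath (simp_boundary 1 (E x (x + d)))"
    unfolding \<Psi>_E[OF d(1) edge_diff_short[OF assms]]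
    by (simp only: E_def simp_boundary_oedge' vpath_diff vpath_of U_minus) simp
  finally show ?thesis .
qed

text \<open>
  The correction term depends only on the boundary of \<open>c\<close>, so it disappears for cycles.
\<close>

lemma chain_homologous:
  assumes "c \<in> carrier (simp_chain_group 1 K)"
  shows "c \<simeq> U (\<Psi> c) + vpath (simp_boundary 1 c)"
proof -
  have "Poly_Mapping.keys c \<subseteq> {\<sigma> \<in> K. card \<sigma> = 2}"
    using assms by (auto simp: carrier_simp_chain_group)
  then show ?thesis
  proof (induction c rule: frag_induction)
    case zero
    then show ?case by (simp add: \<Psi>_0 U_0 vpath_0 hom_refl)
  next
    case (one \<sigma>)
    then obtain x d where d: "edge_diff d" "\<sigma> = {pt x, pt (x + d)}" using K_edge by blast
    have ne: "pt x \<noteq> pt (x + d)" using pt_inj[of x "x + d"] edge_diff_bounds[OF d(1)] by auto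
    have "frag_of \<sigma> = E x (x + d) \<or> frag_of \<sigma> = - E x (x + d)"
      using ne unfolding d(2) E_def oedge_def by auto
    then show ?case
    proof
      assume "frag_of \<sigma> = - E x (x + d)"
      then show ?thesis
        using hom_minus[OF E_homologous[OF d(1), of x]]
        by (simp add: \<Psi>_minus U_minus vpath_minus simp_boundary_minus)
    qed (use E_homologous[OF d(1), of x] in simp)
  next
    case (diff a b)
    then show ?case
      using hom_diff[OF diff] by (simp add: \<Psi>_diff U_diff vpath_diff simp_boundary_diff algebra_simps)
  qed
qed

lemma cycle_homologous: "c \<in> simp_cycles 1 K \<Longrightarrow> c \<simeq> U (\<Psi> c)"
  using chain_homologous[of c] by (simp add: simp_cycles_def vpath_0)

end

declare One_nat_def [simp del]

section \<open>The first homology group\<close>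

lemma subgroup_simp_cycles: "subgroup (simp_cycles p K) (simp_chain_group p K)"
proof
  fix x y assume "x \<in> simp_cycles p K" "y \<in> simp_cycles p K"
  then show "x \<otimes>\<^bsub>simp_chain_group p K\<^esub> y \<in> simp_cycles p K"
    using keys_add[of x y] by (auto simp: simp_cycles_def simp_chain_group_def simp_boundary_add)
next
  fix x assume "x \<in> simp_cycles p K"
  then show "inv\<^bsub>simp_chain_group p K\<^esub> x \<in> simp_cycles p K"
    by (simp add: simp_cycles_def simp_chain_group_def simp_boundary_minus)
qed (auto simp: simp_cycles_def simp_chain_group_def)

text \<open>The bridge between the columns on which matrices act and the free abelian group on which
  \<open>U\<close> and \<open>\<Psi>\<close> are related.\<close>

definition frag_of_vec :: "int vec \<Rightarrow> nat \<Rightarrow>\<^sub>0 int" where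
  "frag_of_vec x = (\<Sum>i<dim_vec x. frag_cmul (x $ i) (frag_of i))"

lemma lookup_sum_frag:
  "finite I \<Longrightarrow> poly_mapping.lookup (\<Sum>i\<in>I. frag_cmul (c i) (frag_of i)) j = (if j \<in> I then c j else 0)"
  by (induction I rule: finite_induct) (auto simp: lookup_add)

lemma lookup_frag_of_vec: "poly_mapping.lookup (frag_of_vec x) i = (if i < dim_vec x then x $ i else 0)"
  by (simp add: frag_of_vec_def lookup_sum_frag)

lemma frag_of_vec_add: "dim_vec x = dim_vec y \<Longrightarrow> frag_of_vec (x + y) = frag_of_vec x + frag_of_vec y"
  by (rule poly_mapping_eqI) (simp add: lookup_frag_of_vec lookup_add)

lemma frag_of_vec_inj: "dim_vec x = dim_vec y \<Longrightarrow> frag_of_vec x = frag_of_vec y \<Longrightarrow> x = y"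
  by (rule eq_vecI) (metis lookup_frag_of_vec, simp)

lemma frag_of_vec_surj:
  assumes "Poly_Mapping.keys v \<subseteq> {..<d}"
  shows "frag_of_vec (vec d (poly_mapping.lookup v)) = v"
  using assms by (intro poly_mapping_eqI) (auto simp: lookup_frag_of_vec in_keys_iff)

lemma keys_frag_of_vec: "Poly_Mapping.keys (frag_of_vec x) \<subseteq> {..<dim_vec x}"
  by (auto simp: in_keys_iff lookup_frag_of_vec split: if_splits)

context brieskorn begin

lemma keys_E:
  assumes "{pt x, pt y} \<in> K" "pt x \<noteq> pt y"
  shows "E x y \<in> carrier (simp_chain_group 1 K)"
  using assms by (auto simp: carrier_simp_chain_group E_def oedge_def)

lemma simp_chain_group_add: "c \<in> carrier (simp_chain_group p L) \<Longrightarrow> c' \<in> carrier (simp_chain_group p L) \<Longrightarrow>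
    c + c' \<in> carrier (simp_chain_group p L)"
  and simp_chain_group_diff: "c \<in> carrier (simp_chain_group p L) \<Longrightarrow> c' \<in> carrier (simp_chain_group p L) \<Longrightarrow>
    c - c' \<in> carrier (simp_chain_group p L)"
  using keys_add[of c c'] keys_diff[of c c'] by (auto simp: carrier_simp_chain_group)

lemma E_chain:
  assumes "tri a b"
  shows "E x (x + a) \<in> carrier (simp_chain_group 1 K)" "E (x + a) (x + a + b) \<in> carrier (simp_chain_group 1 K)"
    "E x (x + a + b) \<in> carrier (simp_chain_group 1 K)"
proof -
  have K: "vtri x a b \<in> K" "card (vtri x a b) = 3"
    using vtri_in_K[OF assms] vtri_card[OF tri_cyc_tri[OF assms]] by auto
  then have "pt x \<noteq> pt (x + a)" "pt (x + a) \<noteq> pt (x + a + b)" "pt x \<noteq> pt (x + a + b)"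
    by (auto simp: vtri_def card_insert_if split: if_splits)
  then show "E x (x + a) \<in> carrier (simp_chain_group 1 K)" "E (x + a) (x + a + b) \<in> carrier (simp_chain_group 1 K)"
    "E x (x + a + b) \<in> carrier (simp_chain_group 1 K)"
    by (intro keys_E K_subset[OF K(1)]; simp add: vtri_def)+
qed

lemma simp_boundary_E: "simp_boundary 1 (E x y) = frag_of {pt y} - frag_of {pt x}"
  unfolding E_def by (rule simp_boundary_oedge')

lemma u_eq: "u y = E y (y + 1) + E (y + 1) (y + 2) - E y (y + 2)"
  by (simp add: loop_def path_def numeral_2_eq_2 add.commute)

lemma u_cycle: "u y \<in> simp_cycles 1 K"
proof -
  \<comment> \<open>These two orbits serve to exhibit edges of difference 1 and 2, the ones
    occurring in \<open>u\<close>.\<close>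
  have t: "tri 1 q" "tri 2 2" using q_ge_3 by (simp_all add: tri_def)
  have "u y \<in> carrier (simp_chain_group 1 K)"
    using E_chain(1)[OF t(1), of y] E_chain(1)[OF t(1), of "y + 1"] E_chain(1)[OF t(2), of y]
    unfolding u_eq by (intro simp_chain_group_add simp_chain_group_diff) (simp_all add: add.assoc)
  moreover have "simp_boundary 1 (u y) = 0"
    unfolding u_eq by (simp add: simp_boundary_add simp_boundary_diff simp_boundary_E)
  ultimately show ?thesis by (simp add: simp_cycles_def)
qed

lemma \<Psi>_u: "\<Psi> (u y) = W y"
proof -
  have b: "1 < n - (q + 1)" "2 < n - (q + 1)" using q_ge_3 r_nonneg by (simp_all add: n_def)
  have "\<Psi> (E y (y + 1)) = 0" "\<Psi> (E (y + 1) (y + 2)) = 0" "\<Psi> (E y (y + 2)) = - W y"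
    using \<Psi>_E[of 1 y] \<Psi>_E[of 1 "y + 1"] \<Psi>_E[of 2 y] b
    by (simp_all add: loop_coords_simps(1,7) add.assoc)
  then show ?thesis by (simp add: u_eq \<Psi>_add \<Psi>_diff)
qed

lemma \<Psi>_U: "Poly_Mapping.keys v \<subseteq> {..<2 * h} \<Longrightarrow> \<Psi> (U v) = v"
  by (induction v rule: frag_induction)
    (simp_all add: U_0 \<Psi>_0 U_of \<Psi>_u W_basis U_diff \<Psi>_diff)

lemma keys_W: "Poly_Mapping.keys (W y) \<subseteq> {..<2 * h}"
proof -
  have "Poly_Mapping.keys (\<Sum>i<h. frag_of (2 * i + 1) - frag_of (2 * i)) \<subseteq> {..<2 * h}"
    by (rule order_trans[OF keys_sum]) (use keys_diff in fastforce)
  then show ?thesis by (auto simp: W_def)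
qed

lemma keys_loop_coords: "Poly_Mapping.keys (loop_coords y d) \<subseteq> {..<2 * h}"
proof -
  have "Poly_Mapping.keys (Wsum y j) \<subseteq> {..<2 * h}" for y j
    unfolding Wsum_def by (rule order_trans[OF keys_sum]) (use keys_W in auto)
  then show ?thesis by (simp add: loop_coords_def)
qed

lemma keys_\<Psi>: "Poly_Mapping.keys (\<Psi> c) \<subseteq> {..<2 * h}"
proof -
  have "Poly_Mapping.keys (edge_coords a b) \<subseteq> {..<2 * h}" for a b
    unfolding edge_coords_def by (rule order_trans[OF keys_diff Un_least[OF keys_loop_coords keys_loop_coords]])
  then show ?thesis unfolding \<Psi>_def by (intro order_trans[OF keys_frag_extend] UN_least)
qed

text \<open>Generators become oriented triangles with one representative per shift orbit. The sign
  left open in \<open>simp_boundary_triangle\<close> is absorbed by closure under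
  differences.\<close>

lemma boundaries_induct [consumes 1, case_names zero triangle diff]:
  assumes "c \<in> simp_boundaries 1 K" and "P 0"
    and tri: "\<And>x a b. tri a b \<Longrightarrow> P (E x (x + a) + E (x + a) (x + a + b) - E x (x + a + b))"
    and diff: "\<And>c d. P c \<Longrightarrow> P d \<Longrightarrow> P (c - d)"
  shows "P c"
proof -
  obtain z where z: "Poly_Mapping.keys z \<subseteq> {\<sigma> \<in> K. card \<sigma> = 3}" "c = simp_boundary 2 z"
    using assms(1) by (auto simp: simp_boundaries_def carrier_simp_chain_group numeral_2_eq_2 numeral_3_eq_3)
  have minus: "P (- c)" if "P c" for c using diff[OF assms(2) that] by simp
  have "P (simp_boundary 2 (frag_of \<sigma>))" if \<sigma>: "\<sigma> \<in> K" "card \<sigma> = 3" for \<sigma>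
  proof -
    obtain x a b where t: "tri a b" "\<sigma> = vtri x a b" using K_triangle[OF \<sigma>] .
    have ne: "pt x \<noteq> pt (x + a)" "pt (x + a) \<noteq> pt (x + a + b)" "pt x \<noteq> pt (x + a + b)"
      using \<sigma>(2) unfolding t(2) vtri_def by (auto simp: card_insert_if split: if_splits)
    have "oedge (pt x) (pt (x + a)) + oedge (pt (x + a)) (pt (x + a + b)) + oedge (pt (x + a + b)) (pt x)
        = E x (x + a) + E (x + a) (x + a + b) - E x (x + a + b)"
      using oedge_commute[of "pt x" "pt (x + a + b)"] by (simp add: E_def)
    then show ?thesis
      using simp_boundary_triangle[OF ne] tri[OF t(1), of x] minus unfolding t(2) vtri_def by metis
  qed
  with z(1) show "P c" unfolding z(2)
    by (induction z rule: frag_induction) (simp_all add: assms(2) simp_boundary_diff diff)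
qed

lemma \<Psi>_boundaries: "c \<in> simp_boundaries 1 K \<Longrightarrow> \<Psi> c = 0"
proof (induction c rule: boundaries_induct)
  case (triangle x a b)
  have "\<Psi> (E x (x + a)) = - loop_coords x a" "\<Psi> (E (x + a) (x + a + b)) = - loop_coords (x + a) b"
    "\<Psi> (E x (x + (a + b))) = - loop_coords x (a + b)"
    using tri_edge_diff[OF triangle] tri_bounds[OF triangle] by (intro \<Psi>_E edge_diff_short; simp)+
  then show ?case by (simp add: \<Psi>_add \<Psi>_diff loop_coords_add[OF triangle] add.assoc)
qed (simp_all add: \<Psi>_0 \<Psi>_diff)

lemma boundaries_subset_cycles: "simp_boundaries 1 K \<subseteq> simp_cycles 1 K"
proof
  fix c assume "c \<in> simp_boundaries 1 K"
  then have "c \<in> carrier (simp_chain_group 1 K) \<and> simp_boundary 1 c = 0"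
  proof (induction c rule: boundaries_induct)
    case zero
    then show ?case by (simp add: carrier_simp_chain_group)
  next
    case (triangle x a b)
    then show ?case
      using E_chain[OF triangle, of x]
      by (intro conjI simp_chain_group_add simp_chain_group_diff)
        (simp_all add: simp_boundary_add simp_boundary_diff simp_boundary_E)
  next
    case (diff c d)
    then show ?case using simp_chain_group_diff[of c 1 K d] by (simp add: simp_boundary_diff)
  qed
  then show "c \<in> simp_cycles 1 K" by (simp add: simp_cycles_def)
qed

section \<open>The quotient group and its basis\<close>

abbreviation Z1 where "Z1 \<equiv> subgroup_generated (simp_chain_group 1 K) (simp_cycles 1 K)"

abbreviation H where "H \<equiv> simp_homology_group 1 K"

lemma H_def: "H = Z1 Mod simp_boundaries 1 K"
  by (simp add: simp_homology_group_def)

lemma carrier_Z1: "carrier Z1 = simp_cycles 1 K"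
  by (rule subgroup.carrier_subgroup_generated_subgroup[OF subgroup_simp_cycles])

lemma mult_Z1: "a \<otimes>\<^bsub>Z1\<^esub> b = a + b"
  by (simp add: simp_chain_group_def)

lemma comm_group_Z1: "comm_group Z1"
proof -
  have "comm_group (simp_chain_group 1 K)" "group (simp_chain_group 1 K)"
    unfolding simp_chain_group_def by (simp_all add: abelian_free_Abelian_group)
  then show ?thesis using group.abelian_subgroup_generated by blast
qed

lemma subgroup_boundaries: "subgroup (simp_boundaries 1 K) Z1"
proof -
  have "subgroup (simp_boundaries 1 K) (simp_chain_group 1 K)"
  proof
    have "simp_boundaries 1 K \<subseteq> carrier (simp_chain_group 1 K)"
      using boundaries_subset_cycles by (auto simp: simp_cycles_def)
    then show "simp_boundaries 1 K \<subseteq> carrier (simp_chain_group 1 K)" .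
    fix x assume "x \<in> simp_boundaries 1 K"
    moreover have "Poly_Mapping.keys x \<subseteq> {\<sigma> \<in> K. card \<sigma> = Suc 1}"
      using \<open>simp_boundaries 1 K \<subseteq> _\<close> \<open>x \<in> _\<close> by (auto simp: carrier_simp_chain_group)
    ultimately show "inv\<^bsub>simp_chain_group 1 K\<^esub> x \<in> simp_boundaries 1 K"
      unfolding simp_chain_group_def using bd_minus by simp
  qed (use bd_zero bd_add in \<open>simp_all add: simp_chain_group_def\<close>)
  moreover have "group (simp_chain_group 1 K)" by (simp add: simp_chain_group_def)
  ultimately show ?thesis
    using group.subgroup_of_subgroup_generated boundaries_subset_cycles by blast
qed

lemma comm_group_H: "comm_group H"
  unfolding H_def by (rule comm_group.abelian_FactGroup[OF comm_group_Z1 subgroup_boundaries])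

text \<open>The coset of c modulo boundaries in additive form. It is defined for all chains, so that
  \<open>cl_eq_iff\<close> needs no side condition.\<close>

definition cl :: "(int set \<Rightarrow>\<^sub>0 int) \<Rightarrow> (int set \<Rightarrow>\<^sub>0 int) set" where
  "cl c = (\<lambda>b. b + c) ` simp_boundaries 1 K"

lemma cl_eq_coset: "cl c = simp_boundaries 1 K #>\<^bsub>Z1\<^esub> c"
  unfolding cl_def r_coset_def mult_Z1 by auto

lemma cl_hom: "cl \<in> hom Z1 H"
proof -
  have "simp_boundaries 1 K \<lhd> Z1"
    using comm_group.normal_iff_subgroup[OF comm_group_Z1] subgroup_boundaries by blast
  moreover have "cl = (\<lambda>c. simp_boundaries 1 K #>\<^bsub>Z1\<^esub> c)" by (rule ext) (rule cl_eq_coset)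
  ultimately show ?thesis unfolding H_def by (simp only: normal.r_coset_hom_Mod)
qed

lemma carrier_H: "carrier H = cl ` simp_cycles 1 K"
  unfolding H_def carrier_FactGroup carrier_Z1 cl_eq_coset ..

lemma cl_eq_iff: "cl c = cl c' \<longleftrightarrow> c \<simeq> c'"
proof
  assume eq: "cl c = cl c'"
  have "c \<in> cl c" unfolding cl_def by (rule image_eqI[OF _ bd_zero]) simp
  then have "c \<in> cl c'" by (simp only: eq)
  then obtain b where "c = b + c'" "b \<in> simp_boundaries 1 K" unfolding cl_def by (rule imageE)
  then show "c \<simeq> c'" by (simp add: homologous_def)
next
  have *: "cl c \<subseteq> cl c'" if "c \<simeq> c'" for c c'
  proof
    fix x assume "x \<in> cl c"
    then obtain b where b: "x = b + c" "b \<in> simp_boundaries 1 K" unfolding cl_def by (rule imageE)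
    then have "x = (b + (c - c')) + c'" by simp
    moreover have "b + (c - c') \<in> simp_boundaries 1 K" using bd_add[OF b(2)] that by (simp add: homologous_def)
    ultimately show "x \<in> cl c'" unfolding cl_def by (rule image_eqI)
  qed
  assume "c \<simeq> c'"
  then show "cl c = cl c'" using * hom_sym by blast
qed

lemma cl_add: "a \<in> simp_cycles 1 K \<Longrightarrow> b \<in> simp_cycles 1 K \<Longrightarrow> cl (a + b) = cl a \<otimes>\<^bsub>H\<^esub> cl b"
  using hom_mult[OF cl_hom, of a b] carrier_Z1 mult_Z1 by simp

lemma cl_cmul:
  assumes "a \<in> simp_cycles 1 K"
  shows "cl (frag_cmul m a) = cl a [^]\<^bsub>H\<^esub> m"
proof -
  have "group (simp_chain_group 1 K)" by (simp add: simp_chain_group_def)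
  moreover have "Poly_Mapping.keys a \<subseteq> {\<sigma> \<in> K. card \<sigma> = Suc 1}"
    using assms by (simp add: simp_cycles_def carrier_simp_chain_group)
  ultimately have "a [^]\<^bsub>Z1\<^esub> m = frag_cmul m a"
    using group.int_pow_subgroup_generated[of "simp_chain_group 1 K" a "simp_cycles 1 K" m] assms carrier_Z1
    by (simp add: simp_chain_group_def)
  then show ?thesis
    using hom_int_pow[OF cl_hom, of a m] assms carrier_Z1 comm_group_Z1 comm_group_H
    by (simp add: comm_group_def)
qed

lemma simp_cycles_diff: "a \<in> simp_cycles 1 K \<Longrightarrow> b \<in> simp_cycles 1 K \<Longrightarrow> a - b \<in> simp_cycles 1 K"
  and simp_cycles_0: "0 \<in> simp_cycles 1 K"
  using simp_chain_group_diff[of a 1 K b]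
  by (simp_all add: simp_cycles_def simp_boundary_diff carrier_simp_chain_group[of _ K])

lemma simp_cycles_cmul: "a \<in> simp_cycles 1 K \<Longrightarrow> frag_cmul m a \<in> simp_cycles 1 K"
  by (rule frag_closure_minus_cmul[where P = "\<lambda>a. a \<in> simp_cycles 1 K"]) (use simp_cycles_0 simp_cycles_diff in auto)

lemma U_cycle: "U v \<in> simp_cycles 1 K"
proof -
  have "Poly_Mapping.keys v \<subseteq> UNIV" by simp
  then show ?thesis
    by (induction v rule: frag_induction)
      (use simp_cycles_0 simp_cycles_diff u_cycle in \<open>auto simp: U_0 U_of U_diff\<close>)
qed

definition basis :: "nat \<Rightarrow> (int set \<Rightarrow>\<^sub>0 int) set" where "basis i = cl (u (int i))"

lemma lin_comb_basis: "lin_comb H basis x = cl (U (frag_of_vec x))"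
proof -
  interpret H: comm_group H by (rule comm_group_H)
  have mem: "basis i [^]\<^bsub>H\<^esub> m \<in> carrier H" for i and m :: int
    using carrier_H u_cycle by (intro H.int_pow_closed) (auto simp: basis_def)
  have "(\<Otimes>\<^bsub>H\<^esub>i\<in>{..<k}. basis i [^]\<^bsub>H\<^esub> (x $ i)) = cl (U (\<Sum>i<k. frag_cmul (x $ i) (frag_of i)))" for k
  proof (induction k)
    case 0
    have "cl 0 = simp_boundaries 1 K" by (simp add: cl_def)
    moreover have "\<one>\<^bsub>H\<^esub> = simp_boundaries 1 K" unfolding H_def by simp
    ultimately show ?case by (simp add: U_0)
  next
    case (Suc k)
    have "(\<Otimes>\<^bsub>H\<^esub>i\<in>{..<Suc k}. basis i [^]\<^bsub>H\<^esub> (x $ i)) =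
        basis k [^]\<^bsub>H\<^esub> (x $ k) \<otimes>\<^bsub>H\<^esub> (\<Otimes>\<^bsub>H\<^esub>i\<in>{..<k}. basis i [^]\<^bsub>H\<^esub> (x $ i))"
      unfolding lessThan_Suc by (rule H.finprod_insert) (use mem in auto)
    also have "\<dots> = cl (frag_cmul (x $ k) (u (int k))) \<otimes>\<^bsub>H\<^esub> cl (U (\<Sum>i<k. frag_cmul (x $ i) (frag_of i)))"
      by (simp only: Suc basis_def[of k] cl_cmul[OF u_cycle])
    also have "\<dots> = cl (frag_cmul (x $ k) (u (int k)) + U (\<Sum>i<k. frag_cmul (x $ i) (frag_of i)))"
      using cl_add simp_cycles_cmul u_cycle U_cycle by simp
    also have "\<dots> = cl (U (\<Sum>i<Suc k. frag_cmul (x $ i) (frag_of i)))"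
      by (simp add: U_add U_cmul U_of add.commute)
    finally show ?case .
  qed
  then show ?thesis by (simp add: lin_comb_def frag_of_vec_def)
qed

lemma is_int_basis_H: "is_int_basis H (2 * h) basis"
  unfolding is_int_basis_def
proof
  show "basis \<in> {..<2 * h} \<rightarrow> carrier H" using carrier_H u_cycle by (auto simp: basis_def)
  have keys: "Poly_Mapping.keys (frag_of_vec x) \<subseteq> {..<2 * h}" if "x \<in> carrier_vec (2 * h)" for x
    using keys_frag_of_vec[of x] that by simp
  have mem: "lin_comb H basis x \<in> carrier H" for x
    using lin_comb_basis carrier_H U_cycle by simp
  show "lin_comb H basis \<in> iso (monoid_vec TYPE(int) (2 * h)) H"
  proof (rule isoI)
    show "lin_comb H basis \<in> hom (monoid_vec TYPE(int) (2 * h)) H"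
    proof (rule homI)
      fix x y assume "x \<in> carrier (monoid_vec TYPE(int) (2 * h))" "y \<in> carrier (monoid_vec TYPE(int) (2 * h))"
      then show "lin_comb H basis (x \<otimes>\<^bsub>monoid_vec TYPE(int) (2 * h)\<^esub> y) = lin_comb H basis x \<otimes>\<^bsub>H\<^esub> lin_comb H basis y"
        using cl_add[OF U_cycle U_cycle] by (simp add: monoid_vec_simps lin_comb_basis frag_of_vec_add U_add)
    qed (rule mem)
    show "bij_betw (lin_comb H basis) (carrier (monoid_vec TYPE(int) (2 * h))) (carrier H)"
      unfolding bij_betw_def monoid_vec_simps
    proof
      show "inj_on (lin_comb H basis) (carrier_vec (2 * h))"
      proof (rule inj_onI)
        fix x y assume xy: "x \<in> carrier_vec (2 * h)" "y \<in> carrier_vec (2 * h)"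
          and "lin_comb H basis x = lin_comb H basis y"
        then have "U (frag_of_vec x) - U (frag_of_vec y) \<in> simp_boundaries 1 K"
          by (simp only: lin_comb_basis cl_eq_iff homologous_def)
        then have "\<Psi> (U (frag_of_vec x)) - \<Psi> (U (frag_of_vec y)) = 0"
          using \<Psi>_boundaries by (simp only: \<Psi>_diff[symmetric])
        then have "frag_of_vec x = frag_of_vec y" using \<Psi>_U[OF keys] xy by simp
        then show "x = y" using xy frag_of_vec_inj by simp
      qed
      show "lin_comb H basis ` carrier_vec (2 * h) = carrier H"
      proof
        show "lin_comb H basis ` carrier_vec (2 * h) \<subseteq> carrier H" using mem by auto
        show "carrier H \<subseteq> lin_comb H basis ` carrier_vec (2 * h)"
        proof
          fix X assume "X \<in> carrier H"
          then obtain c where c: "c \<in> simp_cycles 1 K" "X = cl c" using carrier_H by auto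
          then have "X = cl (U (\<Psi> c))" using cl_eq_iff cycle_homologous by simp
          also have "\<dots> = lin_comb H basis (vec (2 * h) (poly_mapping.lookup (\<Psi> c)))"
            by (simp only: lin_comb_basis frag_of_vec_surj[OF keys_\<Psi>])
          finally show "X \<in> lin_comb H basis ` carrier_vec (2 * h)" by auto
        qed
      qed
    qed
  qed
qed

end

section \<open>The action on homology\<close>

lemma eq_mat_of_mult_vec:
  fixes A B :: "'a::semiring_1 mat"
  assumes "A \<in> carrier_mat n m" "B \<in> carrier_mat n m"
    and "\<And>x. x \<in> carrier_vec m \<Longrightarrow> A *\<^sub>v x = B *\<^sub>v x"
  shows "A = B"
proof (rule eq_matI)
  fix i j assume ij: "i < dim_row B" "j < dim_col B"
  then have "(A *\<^sub>v unit_vec m j) $ i = (B *\<^sub>v unit_vec m j) $ i" using assms by simp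
  then show "A $$ (i, j) = B $$ (i, j)" using assms(1,2) ij by (simp add: scalar_prod_right_unit)
qed (use assms in auto)

lemma pow_mat_add:
  assumes "(A :: 'a::semiring_1 mat) \<in> carrier_mat n n"
  shows "A ^\<^sub>m (j + k) = A ^\<^sub>m j * A ^\<^sub>m k"
  using assms by (induction k) (simp_all add: assoc_mult_mat[of _ n n _ n _ n])

lemma det_pow_mat:
  assumes "(A :: 'a::comm_ring_1 mat) \<in> carrier_mat n n"
  shows "det (A ^\<^sub>m k) = det A ^ k"
  using assms by (induction k) (simp_all add: det_mult[of _ n])

context brieskorn begin

text \<open>Multiplication by \<open>t\<^sup>g\<close>.\<close>

definition T :: "int \<Rightarrow> (nat \<Rightarrow>\<^sub>0 int) \<Rightarrow> nat \<Rightarrow>\<^sub>0 int" where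
  "T g = frag_extend (\<lambda>i. W (int i + g))"

lemma T_diff: "T g (a - b) = T g a - T g b" and T_minus: "T g (- a) = - T g a"
  and T_0: "T g 0 = 0" and T_cmul: "T g (frag_cmul c a) = frag_cmul c (T g a)" and T_of: "T g (frag_of i) = W (int i + g)"
  by (simp_all add: T_def frag_extend_diff frag_extend_minus frag_extend_cmul)

lemma T_sum: "T g (sum f I) = (\<Sum>i\<in>I. T g (f i))"
  by (induction I rule: infinite_finite_induct) (simp_all add: T_def frag_extend_add)

text \<open>As in \<open>U_W\<close>, antiperiodicity reduces to 0 \<le> y < q. At the exponent q -
  1 the claim is \<open>Wsum_relation\<close> at g.\<close>

lemma T_W: "T g (W y) = W (y + g)"
proof -
  have small: "T g (W (int i)) = W (int i + g)" if i: "i < 2 * h + 1" for i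
  proof (cases "i < 2 * h")
    case True
    then show ?thesis by (simp add: W_basis T_of)
  next
    case False
    then have "i = 2 * h" using i by simp
    have "T g (W (int (2 * h))) = Wsum (g + 1) h - Wsum g h"
      unfolding W_last by (simp add: T_sum T_diff T_of Wsum_def sum_subtractf algebra_simps)
    also have "\<dots> = W (g + 2 * int h)" unfolding Wsum_relation[symmetric] by (simp add: Wsum_Suc)
    finally show ?thesis using \<open>i = 2 * h\<close> by (simp add: add.commute)
  qed
  have shift: "T g (W (y + q)) = W (y + q + g) \<longleftrightarrow> T g (W y) = W (y + g)" for y
  proof -
    have "y + q + g = y + g + q" by simp
    then show ?thesis by (simp only: W_antiperiodic T_minus neg_equal_iff_equal)
  qed
  have "T g (W (y mod q + q * k)) = W (y mod q + q * k + g)" for k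
  proof (induction k rule: int_induct[where k = 0])
    case base
    have "nat (y mod q) < 2 * h + 1" using q_h q_ge_3 pos_mod_bound[of q y] by linarith
    then show ?case using small[of "nat (y mod q)"] q_ge_3 by simp
  next
    case (step1 k)
    then show ?case using shift[of "y mod q + q * k"] by (simp add: algebra_simps)
  next
    case (step2 k)
    then show ?case using shift[of "y mod q + q * (k - 1)"] by (simp add: algebra_simps)
  qed
  from this[of "y div q"] show ?thesis by simp
qed

lemma T_T: "T g (T g' v) = T (g + g') v"
proof -
  have "Poly_Mapping.keys v \<subseteq> UNIV" by simp
  then show ?thesis
    by (induction v rule: frag_induction) (simp_all add: T_0 T_of T_W T_diff algebra_simps)
qed

lemma T_id: "Poly_Mapping.keys v \<subseteq> {..<2 * h} \<Longrightarrow> T 0 v = v"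
  by (induction v rule: frag_induction) (simp_all add: T_0 T_of W_basis T_diff)

lemma T_q: "Poly_Mapping.keys v \<subseteq> {..<2 * h} \<Longrightarrow> T q v = - v"
  by (induction v rule: frag_induction) (simp_all add: T_0 T_of W_antiperiodic W_basis T_diff)

lemma T_2q: "Poly_Mapping.keys v \<subseteq> {..<2 * h} \<Longrightarrow> T (2 * q) v = v"
  using T_T[of q q v] T_q[of v] by (simp add: T_minus)

lemma keys_frag_of_vec_dim: "x \<in> carrier_vec (2 * h) \<Longrightarrow> Poly_Mapping.keys (frag_of_vec x) \<subseteq> {..<2 * h}"
  using keys_frag_of_vec[of x] by simp

section \<open>The companion matrix and its powers\<close>

abbreviation A :: "int mat" where "A \<equiv> shift_matrix (2 * h)"

lemma A_carrier: "A \<in> carrier_mat (2 * h) (2 * h)"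
  by (simp add: shift_matrix_def)

text \<open>The last column of the matrix originates here: t^(q-1) = -1 + t - t^2 + ... +
  t^(q-2).\<close>

lemma lookup_W_last: "i < 2 * h \<Longrightarrow> poly_mapping.lookup (W (int (2 * h))) i = (-1) ^ Suc i"
proof -
  have *: "poly_mapping.lookup (\<Sum>i<k. frag_of (2 * i + 1) - frag_of (2 * i)) i
      = (if i < 2 * k then (-1) ^ Suc i else 0)" for k
  proof (induction k)
    case (Suc k)
    have "i < 2 * Suc k \<longleftrightarrow> i < 2 * k \<or> i = 2 * k \<or> i = 2 * k + 1" by auto
    then show ?case using Suc by (auto simp: lookup_add lookup_minus)
  qed simp
  assume "i < 2 * h"
  then show ?thesis unfolding W_last by (simp only: *) simp
qed

text \<open>Column j of the matrix is \<open>W (int j + 1)\<close>: the next basis vector, except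
  that the last column is the reduced power t^(q-1).\<close>

lemma T_1_mult_vec:
  assumes "x \<in> carrier_vec (2 * h)"
  shows "frag_of_vec (A *\<^sub>v x) = T 1 (frag_of_vec x)"
proof (rule poly_mapping_eqI)
  fix i
  let ?d = "2 * h"
  have T: "T 1 (frag_of_vec x) = (\<Sum>j<?d. frag_cmul (x $ j) (W (int j + 1)))"
    using assms by (simp add: frag_of_vec_def T_sum T_cmul T_of)
  have lookup_sum: "poly_mapping.lookup (\<Sum>j<k. f j) i = (\<Sum>j<k. poly_mapping.lookup (f j) i)" for f :: "nat \<Rightarrow> nat \<Rightarrow>\<^sub>0 int" and k
    by (induction k) (simp_all add: lookup_add)
  show "poly_mapping.lookup (frag_of_vec (A *\<^sub>v x)) i = poly_mapping.lookup (T 1 (frag_of_vec x)) i"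
  proof (cases "i < ?d")
    case True
    have "A $$ (i, j) = poly_mapping.lookup (W (int j + 1)) i" if "j < ?d" for j
    proof (cases "j = ?d - 1")
      case True
      then have "int j + 1 = int ?d" using h_pos by auto
      then show ?thesis using True \<open>i < ?d\<close> that lookup_W_last by (simp add: shift_matrix_def)
    next
      case False
      then have "W (int j + 1) = frag_of (Suc j)" using W_basis[of "Suc j"] that by (simp add: add.commute)
      then show ?thesis using False \<open>i < ?d\<close> that by (simp add: shift_matrix_def)
    qed
    then have "(A *\<^sub>v x) $ i = (\<Sum>j<?d. poly_mapping.lookup (W (int j + 1)) i * x $ j)"
      using True assms A_carrier by (simp add: scalar_prod_def atLeast0LessThan)
    then show ?thesis
      using True A_carrier by (simp add: T lookup_sum lookup_frag_of_vec mult.commute)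
  next
    case False
    have "poly_mapping.lookup (W y) i = 0" for y using keys_W[of y] False by (auto simp: in_keys_iff)
    then show ?thesis using False A_carrier by (simp add: T lookup_sum lookup_frag_of_vec)
  qed
qed

lemma T_mult_vec:
  assumes "x \<in> carrier_vec (2 * h)"
  shows "frag_of_vec ((A ^\<^sub>m g) *\<^sub>v x) = T (int g) (frag_of_vec x)"
  using assms
proof (induction g arbitrary: x)
  case 0
  then show ?case using T_id[OF keys_frag_of_vec_dim] A_carrier by simp
next
  case (Suc g)
  have Ax: "A *\<^sub>v x \<in> carrier_vec (2 * h)" using A_carrier Suc.prems by simp
  have "(A ^\<^sub>m Suc g) *\<^sub>v x = (A ^\<^sub>m g) *\<^sub>v (A *\<^sub>v x)"
    using assoc_mult_mat_vec[OF pow_carrier_mat[OF A_carrier] A_carrier Suc.prems] by simp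
  then show ?case
    using Suc.IH[OF Ax] T_1_mult_vec[OF Suc.prems] by (simp add: T_T add.commute)
qed

lemma A_pow_eqI:
  assumes "\<And>x. x \<in> carrier_vec (2 * h) \<Longrightarrow> T (int j) (frag_of_vec x) = T (int k) (frag_of_vec x)"
  shows "A ^\<^sub>m j = A ^\<^sub>m k"
proof (rule eq_mat_of_mult_vec)
  show "A ^\<^sub>m j \<in> carrier_mat (2 * h) (2 * h)" "A ^\<^sub>m k \<in> carrier_mat (2 * h) (2 * h)"
    using pow_carrier_mat[OF A_carrier] by auto
  fix x :: "int vec" assume x: "x \<in> carrier_vec (2 * h)"
  show "(A ^\<^sub>m j) *\<^sub>v x = (A ^\<^sub>m k) *\<^sub>v x"
    using A_carrier x by (intro frag_of_vec_inj) (simp_all add: T_mult_vec assms)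
qed

lemma A_pow_2q: "A ^\<^sub>m (nat (2 * q)) = 1\<^sub>m (2 * h)"
proof -
  have "A ^\<^sub>m (nat (2 * q)) = A ^\<^sub>m 0"
  proof (rule A_pow_eqI)
    fix x :: "int vec" assume x: "x \<in> carrier_vec (2 * h)"
    show "T (int (nat (2 * q))) (frag_of_vec x) = T (int 0) (frag_of_vec x)"
      using T_2q[OF keys_frag_of_vec_dim[OF x]] T_id[OF keys_frag_of_vec_dim[OF x]] q_ge_3 by simp
  qed
  then show ?thesis using A_carrier by simp
qed

lemma A_pow_periodic: "A ^\<^sub>m (j + nat (2 * q) * k) = A ^\<^sub>m j"
proof (induction k)
  case (Suc k)
  have "j + nat (2 * q) * Suc k = j + nat (2 * q) * k + nat (2 * q)" by simp
  then have "A ^\<^sub>m (j + nat (2 * q) * Suc k) = A ^\<^sub>m (j + nat (2 * q) * k) * A ^\<^sub>m (nat (2 * q))"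
    by (simp only: pow_mat_add[OF A_carrier])
  then show ?case using Suc A_carrier by (simp add: A_pow_2q)
qed simp

lemma A_pow_mod: "nat (2 * q) dvd m \<Longrightarrow> A ^\<^sub>m (j mod m) = A ^\<^sub>m j"
proof -
  assume "nat (2 * q) dvd m"
  then obtain c where "m = nat (2 * q) * c" by (elim dvdE)
  then have "j = j mod m + nat (2 * q) * (c * (j div m))" using mod_mult_div_eq[of j m] by (simp add: mult.assoc)
  then show ?thesis using A_pow_periodic[of "j mod m" "c * (j div m)"] by simp
qed

lemma det_A: "det A = 1"
proof -
  have "A ^\<^sub>m nat q = (-1) \<cdot>\<^sub>m 1\<^sub>m (2 * h)"
  proof (rule eq_mat_of_mult_vec)
    fix x :: "int vec" assume x: "x \<in> carrier_vec (2 * h)"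
    have "frag_of_vec (- x) = - frag_of_vec x"
      by (rule poly_mapping_eqI) (simp add: lookup_frag_of_vec)
    then have "frag_of_vec ((A ^\<^sub>m nat q) *\<^sub>v x) = frag_of_vec (- x)"
      using T_mult_vec[OF x] T_q[OF keys_frag_of_vec_dim[OF x]] q_ge_3 by simp
    then have "(A ^\<^sub>m nat q) *\<^sub>v x = - x" using x A_carrier by (intro frag_of_vec_inj) simp_all
    then show "(A ^\<^sub>m nat q) *\<^sub>v x = ((-1) \<cdot>\<^sub>m 1\<^sub>m (2 * h)) *\<^sub>v x"
      using x by (intro eq_vecI) simp_all
  qed (use A_carrier pow_carrier_mat in auto)
  then have "det A ^ nat q = 1" by (simp add: det_pow_mat[OF A_carrier, symmetric])
  moreover have "odd (nat q)" using odd_q q_ge_3 by (simp add: even_nat_iff)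
  \<comment> \<open>An integer with a power equal to 1 is 1 or -1, and the odd exponent excludes
    -1.\<close>
  ultimately show ?thesis
    by (metis abs_1 abs_minus_cancel abs_if power_minus_odd power_one one_neq_neg_one zdvd1_eq dvd_power odd_pos)
qed

lemma A_pow_inj: "inj_on (\<lambda>j. A ^\<^sub>m j) {..<nat (2 * q)}"
proof -
  have neq: "A ^\<^sub>m j \<noteq> A ^\<^sub>m k" if "j < k" "k < nat (2 * q)" for j k
  proof
    assume eq: "A ^\<^sub>m j = A ^\<^sub>m k"
    \<comment> \<open>The first unit vector is t^0, so the j-th power of the matrix sends it to
      \<open>W (int j)\<close>.\<close>
    define x :: "int vec" where "x = unit_vec (2 * h) 0"
    have x: "x \<in> carrier_vec (2 * h)" by (simp add: x_def)
    have fx: "frag_of_vec x = W 0"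
      using W_basis[of 0] h_pos by (intro poly_mapping_eqI) (auto simp: lookup_frag_of_vec x_def lookup_one)
    have "W (int j) = W (int k)"
      using T_mult_vec[OF x, of j] T_mult_vec[OF x, of k] eq by (simp add: fx T_W)
    then have "T (2 * q - int j) (W (int j)) = T (2 * q - int j) (W (int k))" by simp
    then have "W (2 * q) = W (int (k - j) + 2 * q)" using that by (simp add: T_W of_nat_diff algebra_simps)
    moreover define m where "m = int (k - j)"
    ultimately have Wm: "W m = frag_of 0"
      using W_basis[of 0] h_pos W_periodic[of "2 * q" 0] W_periodic[of "m + 2 * q" m] by simp
    have m: "0 < m" "m < 2 * q" using that by (auto simp: m_def)
    \<comment> \<open>Two coefficients suffice. Among t^0, ..., t^(q-1) only t^0 has coefficient 1
      at index 0, so m < q is impossible. If m \<ge> q, then t^(m-q) = -1; coefficient -1 at index 0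
      forces the exponent q - 1, whose coefficient at index 1 is 1 instead of 0.\<close>
    have small: "poly_mapping.lookup (W (int i)) 0 = (if i = 0 then 1 else if i < 2 * h then 0 else -1)"
      "poly_mapping.lookup (W (int i)) 1 = (if i = 1 then 1 else if i < 2 * h then 0 else 1)"
      if "i < 2 * h + 1" for i
    proof -
      have "i < 2 * h \<or> i = 2 * h" using that by auto
      then show "poly_mapping.lookup (W (int i)) 0 = (if i = 0 then 1 else if i < 2 * h then 0 else -1)"
        "poly_mapping.lookup (W (int i)) 1 = (if i = 1 then 1 else if i < 2 * h then 0 else 1)"
        using h_pos lookup_W_last[of 0] lookup_W_last[of 1] W_basis[of 0] W_basis[of 1]
        by (auto simp: W_basis lookup_one)
    qed
    show False
    proof (cases "m < q")
      case True
      then have "nat m < 2 * h + 1" using q_h m by linarith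
      then show False using small(1)[of "nat m"] Wm m h_pos by (auto split: if_splits)
    next
      case False
      then have l: "nat (m - q) < 2 * h + 1" using q_h m by linarith
      have "W (m - q) = - frag_of 0" using W_minus_q[of m] Wm by simp
      then show False
        using small[OF l] False h_pos by (auto simp: lookup_one split: if_splits)
    qed
  qed
  show ?thesis
    by (rule inj_onI) (metis lessThan_iff linorder_neqE_nat neq)
qed

section \<open>Vertex shifts on chains and on homology classes\<close>

lemma sh_chain_map_E: "simp_chain_map (sh g) (E x y) = E (x + g) (y + g)"
proof -
  have "sh g (pt z) = pt (z + g)" for z using pt_range by (simp add: sh_eq pt_pt)
  then show ?thesis by (simp add: E_def simp_chain_map_oedge)
qed

lemma sh_chain_map_u: "simp_chain_map (sh g) (u y) = u (y + g)"
  unfolding u_eq by (simp add: simp_chain_map_add simp_chain_map_diff sh_chain_map_E algebra_simps)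

lemma sh_chain_map_boundaries:
  "c \<in> simp_boundaries 1 K \<Longrightarrow> simp_chain_map (sh g) c \<in> simp_boundaries 1 K"
proof (induction c rule: boundaries_induct)
  case zero
  then show ?case by (simp add: bd_zero)
next
  case (triangle x a b)
  have "simp_chain_map (sh g) (E x (x + a) + E (x + a) (x + a + b) - E x (x + a + b)) =
      E (x + g) (x + g + a) + E (x + g + a) (x + g + a + b) - E (x + g) (x + g + a + b)"
    by (simp add: simp_chain_map_add simp_chain_map_diff sh_chain_map_E algebra_simps)
  then show ?case
    using triangle_homologous[OF tri_cyc_tri[OF triangle], of "x + g"] by (simp add: homologous_def)
next
  case (diff c d)
  then show ?case by (simp add: simp_chain_map_diff bd_diff)
qed

text \<open>The shift maps boundaries to boundaries, so the sum of the two sets collapses to a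
  single coset.\<close>

lemma sh_induced_cl: "simp_hom_induced 1 K (sh g) (cl c) = cl (simp_chain_map (sh g) c)"
proof -
  have "simp_hom_induced 1 K (sh g) (cl c) =
      (\<Union>b\<in>simp_boundaries 1 K. \<Union>b'\<in>simp_boundaries 1 K. {b + simp_chain_map (sh g) (b' + c)})"
    unfolding simp_hom_induced_def set_mult_def cl_def by (simp add: simp_chain_group_def)
  also have "\<dots> = cl (simp_chain_map (sh g) c)"
  proof (intro equalityI subsetI)
    fix z assume "z \<in> (\<Union>b\<in>simp_boundaries 1 K. \<Union>b'\<in>simp_boundaries 1 K. {b + simp_chain_map (sh g) (b' + c)})"
    then obtain b b' where b: "b \<in> simp_boundaries 1 K" "b' \<in> simp_boundaries 1 K"
      and z: "z = b + simp_chain_map (sh g) (b' + c)" by blast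
    have "z = (b + simp_chain_map (sh g) b') + simp_chain_map (sh g) c"
      unfolding z by (simp add: simp_chain_map_add)
    moreover have "b + simp_chain_map (sh g) b' \<in> simp_boundaries 1 K"
      using bd_add sh_chain_map_boundaries b by simp
    ultimately show "z \<in> cl (simp_chain_map (sh g) c)" unfolding cl_def by (rule image_eqI)
  next
    fix z assume "z \<in> cl (simp_chain_map (sh g) c)"
    then obtain b where b: "z = b + simp_chain_map (sh g) c" "b \<in> simp_boundaries 1 K"
      unfolding cl_def by (rule imageE)
    then have "z = b + simp_chain_map (sh g) (0 + c)" by simp
    with b(2) bd_zero show "z \<in> (\<Union>b\<in>simp_boundaries 1 K. \<Union>b'\<in>simp_boundaries 1 K. {b + simp_chain_map (sh g) (b' + c)})"
      by blast
  qed
  finally show ?thesis .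
qed

text \<open>Multiplication by t^g on coordinates matches the shift on cycles only up to boundaries,
  since exponents leaving the basis range are reduced.\<close>

lemma U_T: "U (T g v) \<simeq> simp_chain_map (sh g) (U v)"
proof -
  have "Poly_Mapping.keys v \<subseteq> UNIV" by simp
  then show ?thesis
  proof (induction v rule: frag_induction)
    case (one i)
    show ?case using U_W[of "int i + g"] by (simp add: T_of U_of sh_chain_map_u)
  next
    case (diff a b)
    then show ?case using hom_diff[OF diff] by (simp add: T_diff U_diff simp_chain_map_diff)
  qed (simp add: T_0 U_0 hom_refl)
qed

lemma represents_sh:
  assumes "0 \<le> g"
  shows "represents H (2 * h) basis (A ^\<^sub>m nat g) (simp_hom_induced 1 K (sh g))"
  unfolding represents_def
proof (intro conjI ballI)
  show "A ^\<^sub>m nat g \<in> carrier_mat (2 * h) (2 * h)" by (rule pow_carrier_mat[OF A_carrier])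
  fix x :: "int vec" assume x: "x \<in> carrier_vec (2 * h)"
  have "simp_hom_induced 1 K (sh g) (lin_comb H basis x) = cl (simp_chain_map (sh g) (U (frag_of_vec x)))"
    by (simp only: lin_comb_basis sh_induced_cl)
  also have "\<dots> = cl (U (T g (frag_of_vec x)))" unfolding cl_eq_iff by (rule hom_sym[OF U_T])
  also have "\<dots> = lin_comb H basis ((A ^\<^sub>m nat g) *\<^sub>v x)"
    using assms by (simp add: lin_comb_basis T_mult_vec[OF x])
  finally show "simp_hom_induced 1 K (sh g) (lin_comb H basis x) = lin_comb H basis ((A ^\<^sub>m nat g) *\<^sub>v x)" .
qed

text \<open>An automorphism is the shift by its value at 0, so no preimage has to be chosen.\<close>

definition \<rho> :: "(int \<Rightarrow> int) \<Rightarrow> int mat" where "\<rho> f = A ^\<^sub>m nat (f 0)"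

lemma \<rho>_sh: "0 \<le> g \<Longrightarrow> g < n \<Longrightarrow> \<rho> (sh g) = A ^\<^sub>m nat g"
  by (simp add: \<rho>_def sh_zero)

lemma dvd_n: "nat (2 * q) dvd nat n"
proof -
  have "2 * q dvd n" using dvd_r by (simp add: n_def)
  then show ?thesis using nat_dvd_iff q_ge_3 by (simp add: nat_dvd_iff)
qed

text \<open>Shift amounts add modulo n, exponents as natural numbers. \<open>A_pow_mod\<close>
  reconciles them because 2q divides n.\<close>

lemma \<rho>_hom: "\<rho> \<in> hom (Aut_complex K) (SL_int (2 * h))"
proof (rule homI)
  show "\<rho> f \<in> carrier (SL_int (2 * h))" for f
    unfolding \<rho>_def SL_int_def using pow_carrier_mat[OF A_carrier] det_pow_mat[OF A_carrier] det_A by simp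
  fix f f' assume "f \<in> carrier (Aut_complex K)" "f' \<in> carrier (Aut_complex K)"
  then obtain g g' where g: "f = sh g" "0 \<le> g" "g < n" "f' = sh g'" "0 \<le> g'" "g' < n"
    unfolding carrier_Aut by auto
  have "f \<otimes>\<^bsub>Aut_complex K\<^esub> f' = sh (pt (g + g'))" unfolding g by (simp add: sh_mult sh_pt)
  then have "\<rho> (f \<otimes>\<^bsub>Aut_complex K\<^esub> f') = A ^\<^sub>m nat (pt (g + g'))" using \<rho>_sh pt_range by simp
  also have "nat (pt (g + g')) = (nat g + nat g') mod nat n"
    using g n_gt_0 by (simp add: pt_def nat_mod_distrib nat_add_distrib)
  also have "A ^\<^sub>m \<dots> = A ^\<^sub>m nat g * A ^\<^sub>m nat g'"
    unfolding A_pow_mod[OF dvd_n] by (rule pow_mat_add[OF A_carrier])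
  also have "\<dots> = \<rho> f \<otimes>\<^bsub>SL_int (2 * h)\<^esub> \<rho> f'" using g by (simp add: SL_int_def \<rho>_sh)
  finally show "\<rho> (f \<otimes>\<^bsub>Aut_complex K\<^esub> f') = \<rho> f \<otimes>\<^bsub>SL_int (2 * h)\<^esub> \<rho> f'" .
qed

lemma card_\<rho>: "card (\<rho> ` carrier (Aut_complex K)) = nat (2 * q)"
proof -
  have "\<rho> ` carrier (Aut_complex K) = (\<lambda>j. A ^\<^sub>m j) ` {..<nat (2 * q)}"
  proof (intro equalityI subsetI)
    fix X assume "X \<in> \<rho> ` carrier (Aut_complex K)"
    then obtain g where "0 \<le> g" "X = A ^\<^sub>m nat g" unfolding carrier_Aut using \<rho>_sh by auto
    then have "X = A ^\<^sub>m (nat g mod nat (2 * q))" by (simp add: A_pow_mod)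
    moreover have "nat g mod nat (2 * q) \<in> {..<nat (2 * q)}" using q_ge_3 by simp
    ultimately show "X \<in> (\<lambda>j. A ^\<^sub>m j) ` {..<nat (2 * q)}" by (rule image_eqI)
  next
    fix X assume "X \<in> (\<lambda>j. A ^\<^sub>m j) ` {..<nat (2 * q)}"
    then obtain j where j: "j < nat (2 * q)" "X = A ^\<^sub>m j" by auto
    \<comment> \<open>All exponents below 2q are shift amounts below n, so every one of the 2q
      powers is attained.\<close>
    then have jn: "int j < n" using q_ge_3 r_nonneg by (simp add: n_def)
    then have "X = \<rho> (sh (int j))" using j \<rho>_sh[of "int j"] by simp
    then show "X \<in> \<rho> ` carrier (Aut_complex K)" using sh_Aut by blast
  qed
  then show ?thesis using card_image[OF A_pow_inj] by simp
qed

end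

theorem theorem1p4:
  fixes q k n :: nat
    and K :: "int set set"
    and G :: "(int \<Rightarrow> int) monoid"
    and H :: "(int set \<Rightarrow>\<^sub>0 int) set monoid"
  assumes "prime q" and "q > 2"
  defines "n \<equiv> 2 * q * (k + 2)"
    and "K \<equiv> M_complex 2 (int q) (2 * int k * int q)"
    and "G \<equiv> Aut_complex K"
    and "H \<equiv> simp_homology_group 1 K"
  shows "group G
    \<and> vertex_shift n \<in> iso (integer_mod_group n) G
    \<and> carrier G = generate G {vertex_shift n 1}
    \<and> (\<exists>e \<rho>.
          is_int_basis H (q - 1) e
        \<and> \<rho> \<in> hom G (SL_int (q - 1))
        \<and> (\<forall>f\<in>carrier G. represents H (q - 1) e (\<rho> f) (simp_hom_induced 1 K f))
        \<and> (\<forall>g\<in>carrier (integer_mod_group n).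
             \<rho> (vertex_shift n g) = shift_matrix (q - 1) ^\<^sub>m nat g)
        \<and> card (\<rho> ` carrier G) = 2 * q)"
proof -
  have "odd q" using assms(1,2) prime_odd_nat by blast
  interpret M: brieskorn "int q" "2 * int k * int q" "4 * int q + 2 * int k * int q" K
    by unfold_locales (use \<open>odd q\<close> assms(2) in \<open>simp_all add: K_def\<close>)
  have n: "4 * int q + 2 * int k * int q = int n" by (simp add: n_def algebra_simps)
  have h: "2 * M.h = q - 1" using M.q_h by linarith
  have sh: "M.sh = vertex_shift n" unfolding n by simp
  have carrier_n: "carrier (integer_mod_group n) = {0..<int n}"
    using assms(2) by (simp add: carrier_integer_mod_group n_def)
  have "\<forall>f\<in>carrier G. represents H (q - 1) M.basis (M.\<rho> f) (simp_hom_induced 1 K f)"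
  proof
    fix f assume "f \<in> carrier G"
    then obtain g where "f = M.sh g" "0 \<le> g" "g < int n"
      unfolding G_def M.carrier_Aut unfolding n by auto
    then show "represents H (q - 1) M.basis (M.\<rho> f) (simp_hom_induced 1 K f)"
      using M.represents_sh[of g] M.\<rho>_sh[of g] unfolding n h H_def by simp
  qed
  moreover have "\<forall>g\<in>carrier (integer_mod_group n). M.\<rho> (vertex_shift n g) = shift_matrix (q - 1) ^\<^sub>m nat g"
    using M.\<rho>_sh unfolding carrier_n n h by simp
  moreover have "is_int_basis H (q - 1) M.basis" "M.\<rho> \<in> hom G (SL_int (q - 1))" "card (M.\<rho> ` carrier G) = 2 * q"
    using M.is_int_basis_H M.\<rho>_hom M.card_\<rho> unfolding h H_def G_def by simp_all
  moreover have "group G" "vertex_shift n \<in> iso (integer_mod_group n) G" "carrier G = generate G {vertex_shift n 1}"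
    using group_Aut_complex M.sh_iso M.Aut_generate unfolding G_def n by simp_all
  ultimately show ?thesis by blast
qed

end
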